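(* There exists a smooth family $\{M_t^3\}_{t\in[0,3/2)}$ of codimension-$2$ submanifolds of the unit sphere $S^5\subset\mathbb{C}^3$ (equipped with its standard contact form $\alpha$) such that (1) $M_0^3$ is the standard $S^3=S^5\cap\{z_3=0\}\subset\mathbb{C}^2\subset\mathbb{C}^3$; (2) $M_t^3$ is an embedded contact submanifold of $S^5$ for $0\le t<1$; (3) $M_1^3$ admits a Reeb foliation whose leaves are injectively immersed Legendrian submanifolds of $S^5$; and (4) $-M_t^3$ is an embedded overtwisted contact submanifold of $S^5$ for $1<t<3/2$.
   Context: Let $z_1,z_2,z_3$ be the coordinates of $\mathbb{C}^3$, $r_i=|z_i|$, $\theta_i=\arg z_i$. The unit sphere $S^5=\{r_1^2+r_2^2+r_3^2=1\}$ carries the standard contact form $\alpha=\left(r_1^2d\theta_1+r_2^2d\theta_2+r_3^2d\theta_3\right)|_{S^5}$ (each $r_i^2d\theta_i$ extends smoothly over $z_i=0$). The standard $S^3$ has its usual orientation as the unit sphere of $\mathbb{C}^2$ (for which $\alpha\wedge d\alpha|_{S^3}>0$), and the members of the family are oriented consistently with it along the family. For an oriented manifold $M$, $-M$ denotes $M$ with the reversed orientation. An oriented embedded $3$-dimensional submanifold $M\subset S^5$ is a contact submanifold if $(\alpha\wedge d\alpha)|_M>0$ everywhere with respect to the orientation of $M$, so that $\ker(\alpha|_M)$ is a positive contact structure on $M$; it is overtwisted if this contact structure on $M$ is overtwisted. A Legendrian submanifold of $S^5$ is an (injectively immersed) $2$-dimensional submanifold on which $\alpha$ vanishes. A Reeb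 foliation of $S^3$ (or of a manifold diffeomorphic to $S^3$) is a codimension-one smooth foliation obtained by gluing two Reeb components, $S^1\times D^2$ and $D^2\times S^1$, along their boundary tori. Here a Reeb component is the usual foliation of the solid torus in which the boundary torus is a leaf and the interior is foliated by planes spiralling toward the boundary torus. *)

theory Defs
  imports "HOL-Analysis.Analysis"
begin

section \<open>Smooth maps and submanifolds of Euclidean spaces\<close>

primrec Ck_on :: "nat \<Rightarrow> ('a::euclidean_space \<Rightarrow> 'b::euclidean_space) \<Rightarrow> 'a set \<Rightarrow> bool" where
  "Ck_on 0 f U \<longleftrightarrow> continuous_on U f"
| "Ck_on (Suc k) f U \<longleftrightarrow> (\<forall>x\<in>U. f differentiable (at x)) \<and>
     (\<forall>v. Ck_on k (\<lambda>x. frechet_derivative f (at x) v) U)"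

text \<open>Smoothness on an arbitrary set means smoothness on some open neighbourhood of it. Every map
  that is smooth on a subset in the sense of admitting smooth extensions agrees there with such a
  map, and \<^term>\<open>smooth_on\<close> is only applied to existentially quantified maps below. At a point of
  the set, only the restriction of the Frechet derivative to tangent vectors is used.\<close>

definition smooth_on :: "'a::euclidean_space set \<Rightarrow> ('a \<Rightarrow> 'b::euclidean_space) \<Rightarrow> bool" where
  "smooth_on S f \<longleftrightarrow> (\<exists>U. open U \<and> S \<subseteq> U \<and> (\<forall>k. Ck_on k f U))"

definition tangent_space :: "'a::euclidean_space set \<Rightarrow> 'a \<Rightarrow> 'a set" where
  "tangent_space M p = {v. \<exists>\<gamma> \<epsilon>. \<epsilon> > 0 \<and> smooth_on {-\<epsilon><..<\<epsilon>} \<gamma> \<and> \<gamma> ` {-\<epsilon><..<\<epsilon>} \<subseteq> M \<and>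
     \<gamma> 0 = p \<and> (\<gamma> has_vector_derivative v) (at (0::real))}"

text \<open>The tangent spaces \<open>T x\<close> of the source are a parameter, so that the definitions also apply to
  sources with boundary, where \<^const>\<open>tangent_space\<close> would be too small at boundary points.\<close>

definition injective_immersion ::
  "('a::euclidean_space \<Rightarrow> 'a set) \<Rightarrow> 'a set \<Rightarrow> ('a \<Rightarrow> 'b::euclidean_space) \<Rightarrow> bool" where
  "injective_immersion T S f \<longleftrightarrow> smooth_on S f \<and> inj_on f S \<and>
     (\<forall>x\<in>S. inj_on (frechet_derivative f (at x)) (T x))"

definition smooth_embedding ::
  "('a::euclidean_space \<Rightarrow> 'a set) \<Rightarrow> 'a set \<Rightarrow> ('a \<Rightarrow> 'b::euclidean_space) \<Rightarrow> bool" where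
  "smooth_embedding T S f \<longleftrightarrow> injective_immersion T S f \<and> (\<exists>g. homeomorphism S (f ` S) f g)"

definition local_param ::
  "'a::euclidean_space set \<Rightarrow> (real^'k) set \<Rightarrow> (real^'k \<Rightarrow> 'a) \<Rightarrow> bool" where
  "local_param M V \<psi> \<longleftrightarrow> open V \<and> smooth_embedding (\<lambda>_. UNIV) V \<psi> \<and>
     openin (top_of_set M) (\<psi> ` V)"

definition embedded_surface :: "'a::euclidean_space set \<Rightarrow> bool" where
  "embedded_surface S \<longleftrightarrow> (\<forall>p\<in>S. \<exists>V (\<psi> :: real^2 \<Rightarrow> 'a). local_param S V \<psi> \<and> p \<in> \<psi> ` V)"


section \<open>Oriented 3-dimensional submanifolds\<close>

text \<open>An orientation assigns to each point the set of positively oriented bases of the tangent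
  space there; only its values at points of the submanifold matter.\<close>

type_synonym 'a orientation = "'a \<Rightarrow> ('a \<times> 'a \<times> 'a) set"

definition push_frames :: "('a \<Rightarrow> 'b) \<Rightarrow> ('a \<times> 'a \<times> 'a) set \<Rightarrow> ('b \<times> 'b \<times> 'b) set" where
  "push_frames D B = (\<lambda>(u, v, w). (D u, D v, D w)) ` B"

definition oriented_submanifold3 :: "'a::euclidean_space set \<Rightarrow> 'a orientation \<Rightarrow> bool" where
  "oriented_submanifold3 M Or \<longleftrightarrow>
     (\<forall>p\<in>M. \<exists>V (\<psi> :: real^3 \<Rightarrow> 'a). local_param M V \<psi> \<and> p \<in> \<psi> ` V \<and>
        (\<forall>y\<in>V. Or (\<psi> y) = push_frames (frechet_derivative \<psi> (at y))
                             {(a, b, c). det (vector [a, b, c] :: real^3^3) > 0}))"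

definition reverse_orientation :: "'a orientation \<Rightarrow> 'a orientation" where
  "reverse_orientation Or p = {(u, v, w). (v, u, w) \<in> Or p}"

abbreviation S3 :: "(complex^2) set" where "S3 \<equiv> sphere 0 1"
abbreviation S5 :: "(complex^3) set" where "S5 \<equiv> sphere 0 1"

definition real_coords :: "complex^2 \<Rightarrow> real^4" where
  "real_coords z = vector [Re (z$1), Im (z$1), Re (z$2), Im (z$2)]"

text \<open>Boundary orientation of the unit ball: outward normal first.\<close>

definition S3_orientation :: "(complex^2) orientation" where
  "S3_orientation x = {(u, v, w). u \<in> tangent_space S3 x \<and> v \<in> tangent_space S3 x \<and>
     w \<in> tangent_space S3 x \<and>
     det (vector [real_coords x, real_coords u, real_coords v, real_coords w] :: real^4^4) > 0}"

definition incl :: "complex^2 \<Rightarrow> complex^3" where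
  "incl z = vector [z$1, z$2, 0]"

text \<open>A smooth family, over a set \<open>I\<close> of parameters, of oriented submanifolds of the 5-sphere that
  are diffeomorphic to the 3-sphere: a smooth family of embeddings, with orientations carried along
  by it.\<close>

definition smooth_S3_family ::
  "real set \<Rightarrow> (real \<Rightarrow> (complex^3) set) \<Rightarrow> (real \<Rightarrow> (complex^3) orientation) \<Rightarrow> bool" where
  "smooth_S3_family I M Or \<longleftrightarrow>
     (\<exists>F :: real \<Rightarrow> complex^2 \<Rightarrow> complex^3.
        smooth_on (I \<times> S3) (\<lambda>(t, x). F t x) \<and>
        (\<forall>t\<in>I. smooth_embedding (tangent_space S3) S3 (F t) \<and> F t ` S3 = M t \<and> M t \<subseteq> S5 \<and>
           (\<forall>x\<in>S3. Or t (F t x) =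
              push_frames (frechet_derivative (F t) (at x)) (S3_orientation x))))"


section \<open>Contact and Legendrian submanifolds of the 5-sphere\<close>

text \<open>In each coordinate, \<open>r\<^sup>2 d\<theta> = x dy - y dx\<close>, whose value at \<open>z\<close> on \<open>v\<close> is
  the imaginary part of \<open>cnj z * v\<close>.\<close>

definition alpha :: "complex^3 \<Rightarrow> complex^3 \<Rightarrow> real" where
  "alpha z v = (\<Sum>i\<in>UNIV. Im (cnj (z$i) * v$i))"

definition ext_deriv1 ::
  "('a::euclidean_space \<Rightarrow> 'a \<Rightarrow> real) \<Rightarrow> 'a \<Rightarrow> 'a \<Rightarrow> 'a \<Rightarrow> real" where
  "ext_deriv1 \<omega> p u v =
     frechet_derivative (\<lambda>q. \<omega> q v) (at p) u - frechet_derivative (\<lambda>q. \<omega> q u) (at p) v"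

definition wedge12 :: "('a \<Rightarrow> real) \<Rightarrow> ('a \<Rightarrow> 'a \<Rightarrow> real) \<Rightarrow> 'a \<Rightarrow> 'a \<Rightarrow> 'a \<Rightarrow> real" where
  "wedge12 a b u v w = a u * b v w - a v * b u w + a w * b u v"

definition contact_submanifold :: "(complex^3) set \<Rightarrow> (complex^3) orientation \<Rightarrow> bool" where
  "contact_submanifold M Or \<longleftrightarrow> M \<subseteq> S5 \<and> oriented_submanifold3 M Or \<and>
     (\<forall>p\<in>M. \<forall>(u, v, w)\<in>Or p. wedge12 (alpha p) (ext_deriv1 alpha p) u v w > 0)"

definition contact_plane :: "(complex^3) set \<Rightarrow> complex^3 \<Rightarrow> (complex^3) set" where
  "contact_plane M p = {v \<in> tangent_space M p. alpha p v = 0}"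

text \<open>An overtwisted disc is an embedded closed disc that is tangent to the contact structure at
  every point of its boundary.\<close>

definition overtwisted :: "(complex^3) set \<Rightarrow> bool" where
  "overtwisted M \<longleftrightarrow> (\<exists>f :: complex \<Rightarrow> complex^3.
     smooth_embedding (\<lambda>_. UNIV) (cball 0 1) f \<and> f ` cball 0 1 \<subseteq> M \<and>
     (\<forall>x\<in>sphere 0 1. range (frechet_derivative f (at x)) = contact_plane M (f x)))"

text \<open>Abstract surfaces are represented as embedded surfaces in \<open>\<real>\<^sup>4\<close>, which is no
  restriction by the Whitney embedding theorem.\<close>

definition immersed_surface ::
  "(complex \<times> complex) set \<Rightarrow> (complex \<times> complex \<Rightarrow> 'a::euclidean_space) \<Rightarrow> bool" where
  "immersed_surface S j \<longleftrightarrow> embedded_surface S \<and> injective_immersion (tangent_space S) S j"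

definition legendrian_submanifold :: "(complex^3) set \<Rightarrow> bool" where
  "legendrian_submanifold L \<longleftrightarrow> L \<subseteq> S5 \<and> (\<exists>S j. immersed_surface S j \<and> j ` S = L \<and>
     (\<forall>x\<in>S. \<forall>v\<in>tangent_space S x. alpha (j x) (frechet_derivative j (at x) v) = 0))"


section \<open>Reeb foliations\<close>

definition cube3 :: "(real^3) set" where
  "cube3 = {y. \<forall>i. \<bar>y$i\<bar> < 1}"

text \<open>A foliation is given by its set of leaves. A partition into connected injectively immersed
  surfaces is one if it is locally saturated by the horizontal plaques of charts.\<close>

definition codim1_foliation :: "'a::euclidean_space set \<Rightarrow> 'a set set \<Rightarrow> bool" where
  "codim1_foliation M \<L> \<longleftrightarrow> partition_on M \<L> \<and>
     (\<forall>L\<in>\<L>. \<exists>S j. connected S \<and> immersed_surface S j \<and> j ` S = L) \<and>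
     (\<forall>p\<in>M. \<exists>\<psi>. local_param M cube3 \<psi> \<and> p \<in> \<psi> ` cube3 \<and>
        (\<forall>L\<in>\<L>. \<forall>y\<in>cube3. \<forall>y'\<in>cube3. \<psi> y \<in> L \<and> y$3 = y'$3 \<longrightarrow> \<psi> y' \<in> L))"

definition solid_torus :: "(complex \<times> complex) set" where
  "solid_torus = sphere 0 1 \<times> cball 0 1"

definition solid_torus_tangent :: "complex \<times> complex \<Rightarrow> (complex \<times> complex) set" where
  "solid_torus_tangent x = tangent_space (sphere 0 1) (fst x) \<times> UNIV"

text \<open>The planes are rotated copies of one graph over the open disc, spiralling along the circle
  factor in a fixed direction as the boundary is approached.\<close>

definition reeb_profile :: "(real \<Rightarrow> real) \<Rightarrow> bool" where
  "reeb_profile h \<longleftrightarrow> smooth_on (ball 0 1) (\<lambda>w::complex. h (norm w)) \<and>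
     (filterlim h at_top (at_left 1) \<or> filterlim h at_bot (at_left 1))"

definition reeb_component :: "(real \<Rightarrow> real) \<Rightarrow> (complex \<times> complex) set set" where
  "reeb_component h = insert (sphere 0 1 \<times> sphere 0 1)
     (range (\<lambda>c. {(cis (c + h (norm w)), w) | w. w \<in> ball 0 1}))"

text \<open>Both Reeb components are parametrized by \<open>S\<^sup>1 \<times> D\<^sup>2\<close>; the swap in the gluing condition turns
  the second one into \<open>D\<^sup>2 \<times> S\<^sup>1\<close>, glued to the first along the identity of
  \<open>S\<^sup>1 \<times> S\<^sup>1\<close>.\<close>

definition reeb_foliation :: "'a::euclidean_space set \<Rightarrow> 'a set set \<Rightarrow> bool" where
  "reeb_foliation M \<L> \<longleftrightarrow> codim1_foliation M \<L> \<and>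
     (\<exists>\<Phi>\<^sub>1 \<Phi>\<^sub>2 h\<^sub>1 h\<^sub>2.
        smooth_embedding solid_torus_tangent solid_torus \<Phi>\<^sub>1 \<and>
        smooth_embedding solid_torus_tangent solid_torus \<Phi>\<^sub>2 \<and>
        \<Phi>\<^sub>1 ` solid_torus \<union> \<Phi>\<^sub>2 ` solid_torus = M \<and>
        \<Phi>\<^sub>1 ` solid_torus \<inter> \<Phi>\<^sub>2 ` solid_torus = \<Phi>\<^sub>1 ` (sphere 0 1 \<times> sphere 0 1) \<and>
        (\<forall>a\<in>sphere 0 1. \<forall>b\<in>sphere 0 1. \<Phi>\<^sub>1 (a, b) = \<Phi>\<^sub>2 (b, a)) \<and>
        reeb_profile h\<^sub>1 \<and> reeb_profile h\<^sub>2 \<and>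
        \<L> = (`) \<Phi>\<^sub>1 ` reeb_component h\<^sub>1 \<union> (`) \<Phi>\<^sub>2 ` reeb_component h\<^sub>2)"

end

theory Submission
  imports Defs
begin

text \<open>
  Let the torus \<open>\<theta>\<^sub>1 + \<theta>\<^sub>2 + \<theta>\<^sub>3 = 0\<close> act on the 5-sphere by rotations; it preserves \<open>\<alpha>\<close>. The
  submanifolds of the family are invariant: they are images of the 3-sphere under maps
  \<open>(z\<^sub>1, z\<^sub>2) \<mapsto> (p z\<^sub>1, q z\<^sub>2, r e\<^sup>i\<^sup>s cnj (z\<^sub>1 z\<^sub>2))\<close>, called twists, where \<open>s = \<bar>z\<^sub>1\<bar>\<^sup>2 - \<bar>z\<^sub>2\<bar>\<^sup>2\<close> is the height and
  \<open>p\<close>, \<open>q\<close>, \<open>r\<close> are real functions of \<open>s\<close>. Such a map pulls \<open>\<alpha>\<close> back to \<open>u d\<theta>\<^sub>1 + v d\<theta>\<^sub>2 + w ds\<close>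
  with coefficients depending on \<open>s\<close> only. Hence \<open>\<alpha> \<and> d\<alpha>\<close> is a positive multiple of
  \<open>v u' - u v'\<close>: the contact condition says that the plane curve \<open>(u, v)\<close> turns strictly around the
  origin (\<open>twist_contact_volume\<close>). On the circle \<open>z\<^sub>2 = 0\<close>, where \<open>s = 1\<close>, the curve is on the positive
  first axis, and for \<open>s = -1\<close> it is on the positive second axis.

  For \<open>t = 0\<close> the curve is the segment between the unit points of the axes. As \<open>t\<close> grows to \<open>1\<close>,
  the curve is pushed towards the origin but keeps turning counterclockwise through the first quadrant
  as \<open>s\<close> decreases (\<open>contact_sign_pos\<close>). For \<open>t > 1\<close> it passes the origin on the other side, so that
  it turns clockwise by three quarters of a full turn (\<open>contact_sign_neg\<close>). Therefore the
  orientation of the contact structure is reversed. Moreover the curve now meets the negative first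
  axis. There the circles in direction \<open>\<theta>\<^sub>2\<close> are Legendrian; they bound discs transverse to the core
  circle \<open>z\<^sub>2 = 0\<close>, which can be chosen tangent to the contact structure along the boundary. These are
  overtwisted discs (\<open>overtwisted_fam\<close>).

  For \<open>t = 1\<close> the curve consists of the parts of the two positive half axes between the origin and
  the end points. Now \<open>\<alpha> \<and> d\<alpha> = 0\<close>. For \<open>s > 0\<close> the form is \<open>u d\<theta>\<^sub>1 + w ds\<close>, and its integral
  surfaces are discs swept out by the rotation of \<open>z\<^sub>2\<close>, on which \<open>\<theta>\<^sub>1\<close> is a function of \<open>s\<close> that
  tends to infinity for \<open>s \<rightarrow> 0\<close>; for \<open>s < 0\<close> the angles change their roles. For \<open>s = 0\<close> only \<open>w ds\<close> remains, and the
  torus of height \<open>0\<close> is a leaf. It is here that the factor \<open>e\<^sup>i\<^sup>s\<close> is essential: it makes \<open>w\<close> nonzero,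
  and it keeps the image embedded although the curve stops at the corner. This is the Reeb foliation
  by Legendrian leaves (\<open>alpha_leaf\<close>, \<open>S3_leaves_reeb\<close>).

  The corner forces \<open>u\<close> and \<open>v\<close> to be flat at \<open>s = 0\<close>, and their shape is chosen such that the angle
  along a leaf is \<open>exp (1 / (s (2 - s)))\<close>, an elementary function with elementary inverse. Then the
  translations of this angle, which give the foliated charts near the torus, have a closed form that
  is visibly smooth at \<open>s = 0\<close> (\<open>shift_pos\<close>, \<open>slide\<close>, \<open>local_param_boundary_chart\<close>).
\<close>

section \<open>Calculus of smooth maps\<close>

lemma Ck_on_subset: "Ck_on k f U \<Longrightarrow> V \<subseteq> U \<Longrightarrow> Ck_on k f V"
  by (induction k arbitrary: f) (auto intro: continuous_on_subset)

lemma Ck_on_cong: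
  assumes "open U" "\<And>x. x \<in> U \<Longrightarrow> f x = g x" "Ck_on k f U"
  shows "Ck_on k g U"
  using assms(2,3)
proof (induction k arbitrary: f g)
  case 0
  then show ?case by (simp cong: continuous_on_cong)
next
  case (Suc k)
  have D: "(g has_derivative frechet_derivative f (at x)) (at x)" if "x \<in> U" for x
  proof -
    have "(f has_derivative frechet_derivative f (at x)) (at x)"
      using Suc.prems(2) that by (simp add: frechet_derivative_works[symmetric])
    then show ?thesis using assms(1) that Suc.prems(1) by (rule has_derivative_transform_within_open)
  qed
  have "Ck_on k (\<lambda>x. frechet_derivative g (at x) v) U" for v
    by (rule Suc.IH[of "\<lambda>x. frechet_derivative f (at x) v"])
      (use frechet_derivative_at[OF D] Suc.prems(2) in auto)
  then show ?case using D by (auto simp: differentiable_def)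
qed

lemma Ck_on_SucI:
  assumes "open U" "\<And>x. x \<in> U \<Longrightarrow> (f has_derivative f' x) (at x)" "\<And>v. Ck_on k (\<lambda>x. f' x v) U"
  shows "Ck_on (Suc k) f U"
proof -
  have "Ck_on k (\<lambda>x. frechet_derivative f (at x) v) U" for v
    by (rule Ck_on_cong[OF assms(1) _ assms(3)[of v]]) (use frechet_derivative_at[OF assms(2)] in auto)
  then show ?thesis using assms(2) by (auto simp: differentiable_def)
qed

lemma Ck_on_Suc_derivative:
  "Ck_on (Suc k) f U \<Longrightarrow> x \<in> U \<Longrightarrow> (f has_derivative frechet_derivative f (at x)) (at x)"
  by (simp add: frechet_derivative_works[symmetric])

lemma Ck_on_SucD: "Ck_on (Suc k) f U \<Longrightarrow> Ck_on k f U"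
proof (induction k arbitrary: f)
  case 0
  then show ?case
    by (auto intro!: continuous_at_imp_continuous_on differentiable_imp_continuous_within)
next
  case (Suc k)
  have "f differentiable (at x)" if "x \<in> U" for x
    using Suc.prems that by (simp only: Ck_on.simps(2))
  moreover have "Ck_on k (\<lambda>x. frechet_derivative f (at x) v) U" for v
    by (rule Suc.IH) (use Suc.prems in \<open>simp only: Ck_on.simps(2)[of "Suc k"]\<close>)
  ultimately show ?case by simp
qed

lemma Ck_on_const: "open U \<Longrightarrow> Ck_on k (\<lambda>x. c) U"
proof (induction k arbitrary: c)
  case (Suc k)
  then show ?case by (intro Ck_on_SucI[OF Suc.prems has_derivative_const]) auto
qed simp

lemma Ck_on_linear_comp:
  assumes "bounded_linear L" "open U" "Ck_on k f U"
  shows "Ck_on k (\<lambda>x. L (f x)) U"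
  using assms(3)
proof (induction k arbitrary: f)
  case 0
  then show ?case
    using assms(1) by (simp add: bounded_linear.continuous_on)
next
  case (Suc k)
  show ?case
  proof (rule Ck_on_SucI[OF assms(2)])
    fix x assume "x \<in> U"
    show "((\<lambda>x. L (f x)) has_derivative (\<lambda>v. L (frechet_derivative f (at x) v))) (at x)"
      using bounded_linear.has_derivative[OF assms(1) Ck_on_Suc_derivative[OF Suc.prems \<open>x \<in> U\<close>]] .
  qed (use Suc in simp)
qed

lemma Ck_on_id: "open U \<Longrightarrow> Ck_on k (\<lambda>x. x) U"
proof (cases k)
  case (Suc j)
  assume "open U"
  then show ?thesis unfolding Suc by (intro Ck_on_SucI[OF _ has_derivative_ident] Ck_on_const)
qed (auto intro: continuous_intros)

lemma Ck_on_add: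
  assumes "open U" "Ck_on k f U" "Ck_on k g U"
  shows "Ck_on k (\<lambda>x. f x + g x) U"
  using assms(2,3)
proof (induction k arbitrary: f g)
  case 0
  then show ?case by (simp add: continuous_on_add)
next
  case (Suc k)
  show ?case
  proof (rule Ck_on_SucI[OF assms(1)])
    fix x assume "x \<in> U"
    show "((\<lambda>x. f x + g x) has_derivative
       (\<lambda>v. frechet_derivative f (at x) v + frechet_derivative g (at x) v)) (at x)"
      using Ck_on_Suc_derivative[OF Suc.prems(1) \<open>x \<in> U\<close>] Ck_on_Suc_derivative[OF Suc.prems(2) \<open>x \<in> U\<close>]
      by (rule has_derivative_add)
  qed (use Suc in simp)
qed

lemma Ck_on_bilinear:
  assumes "bounded_bilinear B" "open U" "Ck_on k f U" "Ck_on k g U"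
  shows "Ck_on k (\<lambda>x. B (f x) (g x)) U"
  using assms(3,4)
proof (induction k arbitrary: f g)
  case 0
  then show ?case by (simp add: bounded_bilinear.continuous_on[OF assms(1)])
next
  case (Suc k)
  show ?case
  proof (rule Ck_on_SucI[OF assms(2)])
    fix x assume "x \<in> U"
    show "((\<lambda>x. B (f x) (g x)) has_derivative
       (\<lambda>v. B (f x) (frechet_derivative g (at x) v) + B (frechet_derivative f (at x) v) (g x))) (at x)"
      using bounded_bilinear.FDERIV[OF assms(1) Ck_on_Suc_derivative[OF Suc.prems(1) \<open>x \<in> U\<close>]
          Ck_on_Suc_derivative[OF Suc.prems(2) \<open>x \<in> U\<close>]] .
  next
    fix v
    show "Ck_on k (\<lambda>x. B (f x) (frechet_derivative g (at x) v) + B (frechet_derivative f (at x) v) (g x)) U"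
      by (intro Ck_on_add[OF assms(2)] Suc.IH Ck_on_SucD[OF Suc.prems(1)] Ck_on_SucD[OF Suc.prems(2)])
        (use Suc.prems in simp_all)
  qed
qed

lemma Ck_on_sum:
  assumes "finite I" "open U" "\<And>i. i \<in> I \<Longrightarrow> Ck_on k (f i) U"
  shows "Ck_on k (\<lambda>x. \<Sum>i\<in>I. f i x) U"
  using assms(1,3)
proof (induction I rule: finite_induct)
  case empty
  then show ?case by (simp only: sum.empty Ck_on_const[OF assms(2)])
next
  case (insert i I)
  have "Ck_on k (\<lambda>x. f i x + (\<Sum>i\<in>I. f i x)) U"
    using insert by (intro Ck_on_add[OF assms(2)]) blast+
  with insert show ?case by (simp only: sum.insert not_False_eq_True)
qed

text \<open>The chain rule gives \<open>D(g \<circ> f) v = Dg (f x) (Df x v)\<close>, where the direction in which \<open>g\<close> is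
  differentiated varies with \<open>x\<close>. Expanding it in the standard basis brings back derivatives
  of \<open>g\<close> in fixed directions, to which the induction hypothesis applies.\<close>

lemma Ck_on_compose:
  fixes f :: "'a::euclidean_space \<Rightarrow> 'b::euclidean_space" and g :: "'b \<Rightarrow> 'c::euclidean_space"
  assumes "open U" "open V" "f ` U \<subseteq> V" "Ck_on k f U" "Ck_on k g V"
  shows "Ck_on k (\<lambda>x. g (f x)) U"
  using assms(4,5)
proof (induction k arbitrary: g)
  case 0
  then show ?case using assms(3) by (auto intro: continuous_on_compose2)
next
  case (Suc k)
  let ?D = "\<lambda>x v. \<Sum>b\<in>Basis. (frechet_derivative f (at x) v \<bullet> b) *\<^sub>R frechet_derivative g (at (f x)) b"
  show ?case
  proof (rule Ck_on_SucI[OF assms(1)])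
    fix x assume x: "x \<in> U"
    have f: "(f has_derivative frechet_derivative f (at x)) (at x)"
      using Suc.prems(1) x by (rule Ck_on_Suc_derivative)
    have g: "(g has_derivative frechet_derivative g (at (f x))) (at (f x))"
      using assms(3) x by (intro Ck_on_Suc_derivative[OF Suc.prems(2)]) blast
    have "frechet_derivative g (at (f x)) w = (\<Sum>b\<in>Basis. (w \<bullet> b) *\<^sub>R frechet_derivative g (at (f x)) b)" for w
    proof -
      have "frechet_derivative g (at (f x)) (\<Sum>b\<in>Basis. (w \<bullet> b) *\<^sub>R b) =
          (\<Sum>b\<in>Basis. (w \<bullet> b) *\<^sub>R frechet_derivative g (at (f x)) b)"
        by (simp only: linear_sum[OF has_derivative_linear[OF g]] linear_scale[OF has_derivative_linear[OF g]])
      then show ?thesis by (simp only: euclidean_representation)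
    qed
    then have "(\<lambda>v. frechet_derivative g (at (f x)) (frechet_derivative f (at x) v)) = ?D x"
      by (rule ext)
    then show "((\<lambda>x. g (f x)) has_derivative ?D x) (at x)"
      using diff_chain_at[OF f g] by (simp add: o_def)
  next
    fix v
    have "Ck_on k (\<lambda>x. frechet_derivative g (at x) b) V" for b
      using Suc.prems(2) by simp
    then have "Ck_on k (\<lambda>x. frechet_derivative g (at (f x)) b) U" for b
      by (rule Suc.IH[OF Ck_on_SucD[OF Suc.prems(1)]])
    moreover have "Ck_on k (\<lambda>x. frechet_derivative f (at x) v) U"
      using Suc.prems(1) by simp
    then have "Ck_on k (\<lambda>x. frechet_derivative f (at x) v \<bullet> b) U" for b
      by (rule Ck_on_linear_comp[OF bounded_linear_inner_left assms(1)])
    ultimately show "Ck_on k (\<lambda>x. ?D x v) U"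
      by (intro Ck_on_sum[OF finite_Basis assms(1)] Ck_on_bilinear[OF bounded_bilinear_scaleR assms(1)])
  qed
qed

text \<open>Unlike \<^const>\<open>smooth_on\<close>, this has the open domain as part of the predicate, so that it passes
  through compositions without choosing a neighbourhood at each step.\<close>

definition C_inf :: "'a::euclidean_space set \<Rightarrow> ('a \<Rightarrow> 'b::euclidean_space) \<Rightarrow> bool" where
  "C_inf U f \<longleftrightarrow> open U \<and> (\<forall>k. Ck_on k f U)"

lemma smooth_on_altdef: "smooth_on S f \<longleftrightarrow> (\<exists>U. S \<subseteq> U \<and> C_inf U f)"
  by (auto simp: smooth_on_def C_inf_def)

lemma C_inf_open: "C_inf U f \<Longrightarrow> open U"
  by (simp add: C_inf_def)

lemma C_inf_subset: "C_inf U f \<Longrightarrow> open V \<Longrightarrow> V \<subseteq> U \<Longrightarrow> C_inf V f"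
  by (auto simp: C_inf_def intro: Ck_on_subset)

lemma C_inf_derivative:
  "C_inf U f \<Longrightarrow> x \<in> U \<Longrightarrow> (f has_derivative frechet_derivative f (at x)) (at x)"
  unfolding C_inf_def by (blast intro: Ck_on_Suc_derivative[where k = 0])

lemma C_inf_continuous: "C_inf U f \<Longrightarrow> continuous_on U f"
  by (simp only: C_inf_def Ck_on.simps(1)[symmetric])

lemma C_inf_cong:
  assumes "C_inf U f" "\<And>x. x \<in> U \<Longrightarrow> f x = g x"
  shows "C_inf U g"
  using assms(1) Ck_on_cong[of U f g, OF _ assms(2)] by (simp add: C_inf_def)

named_theorems C_inf_intros

lemma C_inf_const [C_inf_intros]: "open U \<Longrightarrow> C_inf U (\<lambda>x. c)"
  by (simp add: C_inf_def Ck_on_const)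

lemma C_inf_id [C_inf_intros]: "open U \<Longrightarrow> C_inf U (\<lambda>x. x)"
  by (simp add: C_inf_def Ck_on_id)

lemma C_inf_linear: "bounded_linear L \<Longrightarrow> C_inf U f \<Longrightarrow> C_inf U (\<lambda>x. L (f x))"
  by (simp add: C_inf_def Ck_on_linear_comp)

lemma C_inf_bilinear: "bounded_bilinear B \<Longrightarrow> C_inf U f \<Longrightarrow> C_inf U g \<Longrightarrow> C_inf U (\<lambda>x. B (f x) (g x))"
  by (simp add: C_inf_def Ck_on_bilinear)

lemma C_inf_compose:
  assumes "C_inf V g" "C_inf U f" "f ` U \<subseteq> V"
  shows "C_inf U (\<lambda>x. g (f x))"
  using assms(1,2) Ck_on_compose[OF _ _ assms(3)] unfolding C_inf_def by blast

lemma C_inf_add [C_inf_intros]: "C_inf U f \<Longrightarrow> C_inf U g \<Longrightarrow> C_inf U (\<lambda>x. f x + g x)"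
  by (simp add: C_inf_def Ck_on_add)

lemmas C_inf_mult [C_inf_intros] =
  C_inf_bilinear[OF bounded_bilinear_mult[where 'a = real]]
  C_inf_bilinear[OF bounded_bilinear_mult[where 'a = complex]]
lemmas C_inf_scaleR [C_inf_intros] = C_inf_bilinear[OF bounded_bilinear_scaleR]
lemmas C_inf_minus [C_inf_intros] = C_inf_linear[OF bounded_linear_minus[OF bounded_linear_ident]]
lemmas C_inf_fst [C_inf_intros] = C_inf_linear[OF bounded_linear_fst]
lemmas C_inf_snd [C_inf_intros] = C_inf_linear[OF bounded_linear_snd]
lemmas C_inf_Re [C_inf_intros] = C_inf_linear[OF bounded_linear_Re]
lemmas C_inf_Im [C_inf_intros] = C_inf_linear[OF bounded_linear_Im]
lemmas C_inf_cnj [C_inf_intros] = C_inf_linear[OF bounded_linear_cnj]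
lemmas C_inf_of_real [C_inf_intros] = C_inf_linear[OF bounded_linear_of_real[where 'a = complex]]
lemmas C_inf_vec_nth [C_inf_intros] = C_inf_linear[OF bounded_linear_vec_nth]

lemma C_inf_diff [C_inf_intros]: "C_inf U f \<Longrightarrow> C_inf U g \<Longrightarrow> C_inf U (\<lambda>x. f x - g x)"
  using C_inf_add[OF _ C_inf_minus] by fastforce

lemma C_inf_sum: "finite I \<Longrightarrow> open U \<Longrightarrow> (\<And>i. i \<in> I \<Longrightarrow> C_inf U (f i)) \<Longrightarrow> C_inf U (\<lambda>x. \<Sum>i\<in>I. f i x)"
  by (auto simp: C_inf_def intro: Ck_on_sum)

lemma C_inf_Pair [C_inf_intros]:
  assumes "C_inf U f" "C_inf U g" shows "C_inf U (\<lambda>x. (f x, g x))"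
proof -
  have "bounded_linear (\<lambda>a. (a, 0::'c))" "bounded_linear (\<lambda>b. (0::'b, b))"
    by (auto intro!: bounded_linear_Pair bounded_linear_ident bounded_linear_zero)
  from C_inf_add[OF C_inf_linear[OF this(1) assms(1)] C_inf_linear[OF this(2) assms(2)]]
  show ?thesis by simp
qed

lemma bounded_linear_axis: "bounded_linear (axis i :: 'a::euclidean_space \<Rightarrow> 'a^'n)"
  by (intro linear_conv_bounded_linear[THEN iffD1] linearI) (auto simp: axis_def vec_eq_iff)

lemma vec_eq_sum_axis: "v = (\<Sum>i\<in>UNIV. axis i (v $ i))"
  by (simp add: vec_eq_iff axis_def if_distrib[of "\<lambda>f. f $ _"] sum.delta cong: if_cong)

lemma C_inf_vec:
  fixes f :: "'a::euclidean_space \<Rightarrow> 'b::euclidean_space^'n"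
  assumes "open U" "\<And>i. C_inf U (\<lambda>x. f x $ i)"
  shows "C_inf U f"
proof -
  have "C_inf U (\<lambda>x. \<Sum>i\<in>UNIV. axis i (f x $ i))"
    by (intro C_inf_sum C_inf_linear[OF bounded_linear_axis] assms) auto
  then show ?thesis by (simp add: vec_eq_sum_axis[symmetric])
qed

lemma C_inf_vector2 [C_inf_intros]:
  assumes "C_inf U a" "C_inf U b"
  shows "C_inf U (\<lambda>x. vector [a x, b x] :: _^2)"
proof (rule C_inf_vec)
  show "C_inf U (\<lambda>x. (vector [a x, b x] :: _^2) $ i)" for i
    using exhaust_2[of i] assms by auto
qed (rule C_inf_open[OF assms(1)])

lemma C_inf_vector3 [C_inf_intros]:
  assumes "C_inf U a" "C_inf U b" "C_inf U c"
  shows "C_inf U (\<lambda>x. vector [a x, b x, c x] :: _^3)"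
proof (rule C_inf_vec)
  show "C_inf U (\<lambda>x. (vector [a x, b x, c x] :: _^3) $ i)" for i
    using exhaust_3[of i] assms by auto
qed (rule C_inf_open[OF assms(1)])

lemma C_inf_power [C_inf_intros]:
  "C_inf U f \<Longrightarrow> C_inf U (\<lambda>x. f x ^ n :: real)"
  by (induction n) (auto intro: C_inf_intros C_inf_open)

subsection \<open>Elementary functions\<close>

lemma Ck_on_real_derivative:
  fixes f :: "real \<Rightarrow> 'a::euclidean_space"
  assumes "open U" "\<And>x. x \<in> U \<Longrightarrow> (f has_vector_derivative f' x) (at x)" "Ck_on k f' U"
  shows "Ck_on (Suc k) f U"
proof (rule Ck_on_SucI[OF assms(1)])
  show "(f has_derivative (\<lambda>v. v *\<^sub>R f' x)) (at x)" if "x \<in> U" for x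
    using assms(2)[OF that] by (simp add: has_vector_derivative_def)
  show "Ck_on k (\<lambda>x. v *\<^sub>R f' x) U" for v
    by (rule Ck_on_linear_comp[OF bounded_linear_scaleR_right assms(1,3)])
qed

lemma C_inf_real_exp: "C_inf UNIV (exp :: real \<Rightarrow> real)"
proof -
  have "Ck_on k (exp :: real \<Rightarrow> real) UNIV" for k
  proof (induction k)
    case (Suc k)
    show ?case
      by (rule Ck_on_real_derivative[OF _ _ Suc])
        (auto simp: has_real_derivative_iff_has_vector_derivative[symmetric] intro: DERIV_exp)
  qed (auto intro: continuous_intros)
  then show ?thesis by (simp add: C_inf_def)
qed

lemma C_inf_cis_UNIV: "C_inf UNIV cis"
proof -
  have "Ck_on k cis UNIV" for k
  proof (induction k)
    case (Suc k)
    have "(cis has_vector_derivative \<i> * cis x) (at x)" for x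
      using has_derivative_cis[OF has_derivative_ident, of x UNIV]
      by (simp add: has_vector_derivative_def scaleR_conv_of_real mult.commute)
    then show ?case
      by (intro Ck_on_real_derivative[OF _ _ Ck_on_linear_comp[OF bounded_linear_mult_right _ Suc]]) auto
  qed (auto intro: continuous_intros)
  then show ?thesis by (simp add: C_inf_def)
qed

lemma C_inf_inverse_nonzero: "C_inf (- {0}) (inverse :: real \<Rightarrow> real)"
proof -
  have "Ck_on k (inverse :: real \<Rightarrow> real) (- {0})" for k
  proof (induction k)
    case (Suc k)
    have "Ck_on k (\<lambda>x::real. - (inverse x * inverse x)) (- {0})"
      by (intro Ck_on_linear_comp[OF bounded_linear_minus[OF bounded_linear_ident]]
          Ck_on_bilinear[OF bounded_bilinear_mult] Suc open_delete) auto
    then show ?case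
      by (rule Ck_on_real_derivative[rotated 2])
        (auto simp: has_real_derivative_iff_has_vector_derivative[symmetric]
          intro!: derivative_eq_intros)
  qed (auto intro!: continuous_intros)
  then show ?thesis by (auto simp: C_inf_def)
qed

lemma C_inf_ln_pos: "C_inf {0<..} (ln :: real \<Rightarrow> real)"
proof -
  have "Ck_on k (ln :: real \<Rightarrow> real) {0<..}" for k
  proof (cases k)
    case (Suc j)
    have "Ck_on j (inverse :: real \<Rightarrow> real) {0<..}"
      using C_inf_inverse_nonzero by (auto simp: C_inf_def intro: Ck_on_subset)
    then show ?thesis unfolding Suc
      by (rule Ck_on_real_derivative[rotated 2])
        (auto simp: has_real_derivative_iff_has_vector_derivative[symmetric] DERIV_ln)
  qed (auto intro!: continuous_intros)
  then show ?thesis by (simp add: C_inf_def)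
qed

lemma C_inf_exp [C_inf_intros]: "C_inf U f \<Longrightarrow> C_inf U (\<lambda>x. exp (f x :: real))"
  using C_inf_compose[OF C_inf_real_exp] by auto

lemma C_inf_cis [C_inf_intros]: "C_inf U f \<Longrightarrow> C_inf U (\<lambda>x. cis (f x))"
  using C_inf_compose[OF C_inf_cis_UNIV] by auto

lemma C_inf_ln [C_inf_intros]:
  "C_inf U f \<Longrightarrow> (\<And>x. x \<in> U \<Longrightarrow> f x > 0) \<Longrightarrow> C_inf U (\<lambda>x. ln (f x :: real))"
  using C_inf_compose[OF C_inf_ln_pos] by force

lemma C_inf_divide [C_inf_intros]:
  assumes "C_inf U f" "C_inf U g" "\<And>x. x \<in> U \<Longrightarrow> g x \<noteq> 0"
  shows "C_inf U (\<lambda>x. f x / g x :: real)"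
  using C_inf_mult(1)[OF assms(1) C_inf_compose[OF C_inf_inverse_nonzero assms(2)]] assms(3)
  by (force simp: divide_inverse)

lemma C_inf_sqrt [C_inf_intros]:
  assumes "C_inf U f" "\<And>x. x \<in> U \<Longrightarrow> f x > 0"
  shows "C_inf U (\<lambda>x. sqrt (f x))"
proof -
  have "C_inf U (\<lambda>x. exp (ln (f x) / 2))"
    by (intro C_inf_intros assms C_inf_open[OF assms(1)]) auto
  moreover have "exp (ln (f x) / 2) = sqrt (f x)" if "x \<in> U" for x
    using assms(2)[OF that] by (simp add: ln_sqrt[symmetric])
  ultimately show ?thesis by (rule C_inf_cong)
qed

lemma C_inf_norm_sq [C_inf_intros]: "C_inf U f \<Longrightarrow> C_inf U (\<lambda>x. (cmod (f x))\<^sup>2)"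
  unfolding cmod_power2 by (intro C_inf_intros)

lemma C_inf_inner [C_inf_intros]: "C_inf U f \<Longrightarrow> C_inf U g \<Longrightarrow> C_inf U (\<lambda>x. f x \<bullet> g x)"
  by (rule C_inf_bilinear[OF bounded_bilinear_inner])

lemma C_inf_arctan_UNIV: "C_inf UNIV (arctan :: real \<Rightarrow> real)"
proof -
  have "C_inf UNIV (\<lambda>x::real. 1 / (1 + x\<^sup>2))"
    by (intro C_inf_intros open_UNIV) (smt (verit) zero_le_power2)
  then have "Ck_on j (\<lambda>x::real. 1 / (1 + x\<^sup>2)) UNIV" for j
    by (simp add: C_inf_def)
  then have "Ck_on (Suc j) (arctan :: real \<Rightarrow> real) UNIV" for j
    by (rule Ck_on_real_derivative[rotated 2])
      (auto simp: has_real_derivative_iff_has_vector_derivative[symmetric] inverse_eq_divide[symmetric]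
        intro: DERIV_arctan)
  then show ?thesis using Ck_on_SucD by (auto simp: C_inf_def simp del: Ck_on.simps)
qed

lemma C_inf_arctan [C_inf_intros]: "C_inf U f \<Longrightarrow> C_inf U (\<lambda>x. arctan (f x))"
  using C_inf_compose[OF C_inf_arctan_UNIV] by auto

subsection \<open>A flat function\<close>

text \<open>The factor \<open>(1 / x) ^ m\<close> closes this family of functions under differentiation up to linear
  combinations, so that smoothness of all members follows by one induction.\<close>

definition flat_pow :: "nat \<Rightarrow> real \<Rightarrow> real" where
  "flat_pow m x = (if x > 0 then (1 / x) ^ m * exp (- (1 / x)) else 0)"

lemma flat_pow_tendsto_0: "(flat_pow m \<longlongrightarrow> 0) (at_right 0)"
proof -
  have "((\<lambda>u::real. u ^ m / exp u) \<longlongrightarrow> 0) at_top"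
    by (rule tendsto_power_div_exp_0)
  from filterlim_compose[OF this filterlim_inverse_at_top_right]
  have "((\<lambda>x::real. inverse x ^ m / exp (inverse x)) \<longlongrightarrow> 0) (at_right 0)" .
  then show ?thesis
    by (rule Lim_transform_eventually)
      (auto simp: eventually_at_right_field flat_pow_def exp_minus field_simps intro!: exI[of _ 1])
qed

text \<open>Away from 0 this is the product rule; at 0 the difference quotient is, up to its sign, another
  member of the family and tends to 0.\<close>

lemma flat_pow_derivative:
  "(flat_pow m has_real_derivative (flat_pow (m + 2) x - m * flat_pow (m + 1) x)) (at x)"
proof (cases "x = 0")
  case False
  show ?thesis
  proof (cases "x > 0")
    case True
    have "((\<lambda>x. (1 / x) ^ m * exp (- (1 / x))) has_real_derivative
        (flat_pow (m + 2) x - m * flat_pow (m + 1) x)) (at x)"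
    proof -
      define u where "u = 1 / x"
      have u: "((\<lambda>x. 1 / x) has_real_derivative - (u * u)) (at x)"
        using True by (auto intro!: derivative_eq_intros simp: u_def)
      have "((\<lambda>u. u ^ m * exp (- u)) has_real_derivative
          real m * u ^ (m - 1) * exp (- u) - u ^ m * exp (- u)) (at (1 / x))"
        by (auto intro!: derivative_eq_intros simp: u_def)
      from DERIV_chain2[OF this u] show ?thesis
        using True by (cases m) (simp_all add: flat_pow_def flip: u_def, simp_all add: algebra_simps)
    qed
    then show ?thesis
      by (rule has_field_derivative_transform_within_open[of _ _ _ "{0<..}"]) (use True in \<open>auto simp: flat_pow_def\<close>)
  next
    case neg: False
    have "((\<lambda>x::real. 0) has_real_derivative (flat_pow (m + 2) x - m * flat_pow (m + 1) x)) (at x)"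
      using neg by (auto simp: flat_pow_def)
    then show ?thesis
      by (rule has_field_derivative_transform_within_open[of _ _ _ "{..<0}"])
        (use neg False in \<open>auto simp: flat_pow_def\<close>)
  qed
next
  case True
  have "((\<lambda>h. flat_pow m h / h) \<longlongrightarrow> 0) (at_right 0)"
    using flat_pow_tendsto_0[of "Suc m"]
    by (rule Lim_transform_eventually)
      (auto simp: eventually_at_right_field flat_pow_def intro!: exI[of _ 1])
  moreover have "((\<lambda>h. flat_pow m h / h) \<longlongrightarrow> 0) (at_left 0)"
    by (rule tendsto_eventually) (auto simp: eventually_at_left_field flat_pow_def intro!: exI[of _ "-1"])
  ultimately have "((\<lambda>h. flat_pow m h / h) \<longlongrightarrow> 0) (at 0)"
    by (rule filterlim_split_at_real[rotated])
  then have "(flat_pow m has_real_derivative 0) (at 0)"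
    by (simp add: DERIV_def flat_pow_def[of _ 0])
  then show ?thesis
    by (simp add: True flat_pow_def[of _ 0])
qed

lemma C_inf_flat_pow: "C_inf UNIV (flat_pow m)"
proof -
  have "Ck_on k (flat_pow m) UNIV" for k
  proof (induction k arbitrary: m)
    case 0
    then show ?case
      using DERIV_isCont[OF flat_pow_derivative] by (auto intro: continuous_at_imp_continuous_on)
  next
    case (Suc k)
    have "Ck_on k (\<lambda>x. flat_pow (m + 2) x + (- real m) *\<^sub>R flat_pow (m + 1) x) UNIV"
      by (intro Ck_on_add Ck_on_linear_comp[OF bounded_linear_scaleR_right] Suc) auto
    then show ?case
      by (rule Ck_on_real_derivative[rotated 2])
        (use flat_pow_derivative in \<open>auto simp: has_real_derivative_iff_has_vector_derivative[symmetric]\<close>)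
  qed
  then show ?thesis by (simp add: C_inf_def)
qed

definition flat :: "real \<Rightarrow> real" where
  "flat x = (if x > 0 then exp (- (1 / x)) else 0)"

lemma flat_eq: "flat = flat_pow 0"
  by (auto simp: flat_def flat_pow_def)

lemma C_inf_flat [C_inf_intros]: "C_inf U f \<Longrightarrow> C_inf U (\<lambda>x. flat (f x))"
  using C_inf_compose[OF C_inf_flat_pow] by (auto simp: flat_eq)

lemma flat_nonneg: "flat x \<ge> 0" and flat_pos: "x > 0 \<Longrightarrow> flat x > 0"
  and flat_less_1: "flat x < 1" and flat_nonpos: "x \<le> 0 \<Longrightarrow> flat x = 0"
  by (auto simp: flat_def)

section \<open>Tangent vectors and local parametrizations\<close>

lemma smooth_onI: "C_inf U f \<Longrightarrow> S \<subseteq> U \<Longrightarrow> smooth_on S f"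
  by (auto simp: smooth_on_altdef)

lemma smooth_on_open: "open U \<Longrightarrow> smooth_on U f \<longleftrightarrow> C_inf U f"
  unfolding smooth_on_altdef using C_inf_subset by blast

lemma smooth_on_subset: "smooth_on S f \<Longrightarrow> T \<subseteq> S \<Longrightarrow> smooth_on T f"
  unfolding smooth_on_altdef by blast

lemma smooth_on_derivative:
  "smooth_on S f \<Longrightarrow> x \<in> S \<Longrightarrow> (f has_derivative frechet_derivative f (at x)) (at x)"
  unfolding smooth_on_altdef using C_inf_derivative by blast

lemma smooth_on_continuous: "smooth_on S f \<Longrightarrow> continuous_on S f"
  unfolding smooth_on_altdef using C_inf_continuous continuous_on_subset by blast

lemma smooth_on_compose:
  assumes "smooth_on T g" "smooth_on S f" "f ` S \<subseteq> T"
  shows "smooth_on S (\<lambda>x. g (f x))"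
proof -
  obtain U V where U: "S \<subseteq> U" "C_inf U f" and V: "T \<subseteq> V" "C_inf V g"
    using assms(1,2) by (auto simp: smooth_on_altdef)
  have "open (U \<inter> f -` V)"
    using C_inf_continuous[OF U(2)] C_inf_open[OF U(2)] C_inf_open[OF V(2)]
    by (rule continuous_open_preimage)
  then have "C_inf (U \<inter> f -` V) (\<lambda>x. g (f x))"
    by (intro C_inf_compose[OF V(2)] C_inf_subset[OF U(2)]) auto
  then show ?thesis
    by (rule smooth_onI) (use U V assms(3) in blast)
qed

lemma frechet_derivative_compose_smooth:
  assumes "smooth_on T g" "smooth_on S f" "x \<in> S" "f x \<in> T"
  shows "frechet_derivative (\<lambda>x. g (f x)) (at x) v =
    frechet_derivative g (at (f x)) (frechet_derivative f (at x) v)"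
proof -
  have "(g \<circ> f has_derivative frechet_derivative g (at (f x)) \<circ> frechet_derivative f (at x)) (at x)"
    by (intro diff_chain_at smooth_on_derivative[OF assms(2,3)] smooth_on_derivative[OF assms(1,4)])
  from frechet_derivative_at[OF this] show ?thesis by (simp add: fun_eq_iff o_def)
qed

text \<open>Pushing a curve forward along \<open>f\<close> pushes its velocity forward; the curve may first be
  shortened so that it stays where \<open>f\<close> is defined.\<close>

lemma tangent_space_push:
  assumes f: "C_inf U f" and p: "p \<in> U" and v: "v \<in> tangent_space M p" and sub: "f ` (M \<inter> U) \<subseteq> N"
  shows "frechet_derivative f (at p) v \<in> tangent_space N (f p)"
proof -
  obtain \<gamma> e where e: "e > 0" "smooth_on {-e<..<e} \<gamma>" "\<gamma> ` {-e<..<e} \<subseteq> M" "\<gamma> 0 = p"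
    and d: "(\<gamma> has_vector_derivative v) (at (0::real))"
    using v by (auto simp: tangent_space_def)
  have \<gamma>: "C_inf {-e<..<e} \<gamma>" using e(2) by (simp add: smooth_on_open)
  have "open ({-e<..<e} \<inter> \<gamma> -` U)"
    using C_inf_continuous[OF \<gamma>] C_inf_open[OF f] by (intro continuous_open_preimage) auto
  moreover have "0 \<in> {-e<..<e} \<inter> \<gamma> -` U" using e p by simp
  ultimately obtain d where d0: "d > 0" and ball: "ball 0 d \<subseteq> {-e<..<e} \<inter> \<gamma> -` U"
    by (meson open_contains_ball)
  have I: "{-d<..<d} = ball (0::real) d" by (auto simp: dist_real_def)
  have "C_inf {-d<..<d} (\<lambda>x. f (\<gamma> x))"
    by (intro C_inf_compose[OF f] C_inf_subset[OF \<gamma>]) (use ball I in auto)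
  then have "smooth_on {-d<..<d} (\<lambda>x. f (\<gamma> x))" by (simp add: smooth_on_open)
  moreover have "(\<lambda>x. f (\<gamma> x)) ` {-d<..<d} \<subseteq> N"
    unfolding I using ball e(3) sub by blast
  moreover have "((\<lambda>x. f (\<gamma> x)) has_vector_derivative frechet_derivative f (at p) v) (at 0)"
  proof -
    have f': "(f has_derivative frechet_derivative f (at p)) (at (\<gamma> 0))"
      using C_inf_derivative[OF f p] e(4) by simp
    from diff_chain_at[OF d[unfolded has_vector_derivative_def] f'] show ?thesis
      by (simp add: has_vector_derivative_def o_def linear_scale[OF has_derivative_linear[OF f']])
  qed
  ultimately show ?thesis
    unfolding tangent_space_def using d0 e(4)
    by (intro CollectI exI[of _ "\<lambda>x. f (\<gamma> x)"] exI[of _ d]) simp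
qed

lemma tangent_space_open:
  assumes "open V" "x \<in> V"
  shows "tangent_space V x = UNIV"
proof -
  have "v \<in> tangent_space V x" for v
  proof -
    have "C_inf UNIV (\<lambda>r::real. x + r *\<^sub>R v)" by (intro C_inf_intros open_UNIV)
    moreover have "open ((\<lambda>r::real. x + r *\<^sub>R v) -` V)"
      by (intro open_vimage assms(1) continuous_intros)
    then obtain d where "d > 0" "ball 0 d \<subseteq> (\<lambda>r::real. x + r *\<^sub>R v) -` V"
      using assms(2) openE[of "(\<lambda>r::real. x + r *\<^sub>R v) -` V" 0] by auto
    moreover have "{-d<..<d} = ball (0::real) d" by (auto simp: dist_real_def)
    moreover have "((\<lambda>r::real. x + r *\<^sub>R v) has_vector_derivative v) (at 0)"
      by (auto intro!: derivative_eq_intros)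
    ultimately show ?thesis
      unfolding tangent_space_def
      by (intro CollectI exI[of _ "\<lambda>r. x + r *\<^sub>R v"] exI[of _ d]) (auto intro: smooth_onI)
  qed
  then show ?thesis by auto
qed

lemma tangent_space_Times:
  assumes "v \<in> tangent_space M p" "w \<in> tangent_space N q"
  shows "(v, w) \<in> tangent_space (M \<times> N) (p, q)"
proof -
  obtain \<gamma> e \<delta> d where e: "e > 0" "smooth_on {-e<..<e} \<gamma>" "\<gamma> ` {-e<..<e} \<subseteq> M" "\<gamma> 0 = p"
      "(\<gamma> has_vector_derivative v) (at (0::real))"
    and d: "d > 0" "smooth_on {-d<..<d} \<delta>" "\<delta> ` {-d<..<d} \<subseteq> N" "\<delta> 0 = q"
      "(\<delta> has_vector_derivative w) (at (0::real))"
    using assms by (auto simp: tangent_space_def)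
  define m where "m = min e d"
  have m: "m > 0" "{-m<..<m} \<subseteq> {-e<..<e}" "{-m<..<m} \<subseteq> {-d<..<d}" using e d by (auto simp: m_def)
  have "C_inf {-m<..<m} \<gamma>" "C_inf {-m<..<m} \<delta>"
    using smooth_on_subset[OF e(2) m(2)] smooth_on_subset[OF d(2) m(3)] by (auto simp: smooth_on_open)
  then have "smooth_on {-m<..<m} (\<lambda>t. (\<gamma> t, \<delta> t))"
    by (auto simp: smooth_on_open intro: C_inf_intros)
  moreover have "((\<lambda>t. (\<gamma> t, \<delta> t)) has_vector_derivative (v, w)) (at 0)"
    using e(5) d(5) by (rule has_vector_derivative_Pair)
  moreover have "(\<lambda>t. (\<gamma> t, \<delta> t)) ` {-m<..<m} \<subseteq> M \<times> N"
    using m(2,3) e(3) d(3) by blast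
  ultimately show ?thesis
    unfolding tangent_space_def using m(1) e(4) d(4)
    by (intro CollectI exI[of _ "\<lambda>t. (\<gamma> t, \<delta> t)"] exI[of _ m]) auto
qed

text \<open>Every \<open>v\<close> orthogonal to \<open>x\<close> is the velocity of the curve obtained by projecting the line
  through \<open>x\<close> in direction \<open>v\<close> radially to the sphere.\<close>

lemma tangent_space_sphere:
  fixes x :: "'a::euclidean_space"
  assumes x: "x \<in> sphere 0 1"
  shows "tangent_space (sphere 0 1) x = {v. x \<bullet> v = 0}"
proof (intro equalityI subsetI CollectI)
  fix v assume "v \<in> tangent_space (sphere 0 1) x"
  then obtain \<gamma> e where e: "e > 0" "\<gamma> ` {-e<..<e} \<subseteq> sphere 0 1" "\<gamma> 0 = x"
    and d: "(\<gamma> has_vector_derivative v) (at (0::real))"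
    by (auto simp: tangent_space_def)
  have "((\<lambda>t. \<gamma> t \<bullet> \<gamma> t) has_derivative (\<lambda>h. \<gamma> 0 \<bullet> (h *\<^sub>R v) + (h *\<^sub>R v) \<bullet> \<gamma> 0)) (at 0)"
    using d unfolding has_vector_derivative_def by (intro has_derivative_inner) auto
  moreover have "((\<lambda>t. \<gamma> t \<bullet> \<gamma> t) has_derivative (\<lambda>h. 0)) (at 0)"
  proof (rule has_derivative_transform_within_open[of "\<lambda>t. 1" _ _ _ "{-e<..<e}"])
    show "1 = \<gamma> t \<bullet> \<gamma> t" if "t \<in> {-e<..<e}" for t
    proof -
      have "norm (\<gamma> t) = 1" using e(2) that by (auto simp: image_subset_iff)
      then show ?thesis by (simp add: dot_square_norm)
    qed
  qed (use e(1) in auto)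
  ultimately have "\<gamma> 0 \<bullet> (1 *\<^sub>R v) + (1 *\<^sub>R v) \<bullet> \<gamma> 0 = 0"
    using has_derivative_unique by metis
  then show "x \<bullet> v = 0" using e(3) by (simp add: inner_commute)
next
  fix v assume "v \<in> {v. x \<bullet> v = 0}"
  then have v: "x \<bullet> v = 0" by simp
  have xx: "x \<bullet> x = 1" using x by (simp add: dot_square_norm)
  define \<gamma> where "\<gamma> t = (1 / sqrt (1 + t\<^sup>2 * (v \<bullet> v))) *\<^sub>R (x + t *\<^sub>R v)" for t :: real
  have pos: "1 + t\<^sup>2 * (v \<bullet> v) > 0" for t by (simp add: add_pos_nonneg)
  have "C_inf UNIV \<gamma>"
    unfolding \<gamma>_def by (intro C_inf_intros open_UNIV pos) (use pos in \<open>simp add: less_imp_neq[symmetric]\<close>)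
  moreover have "norm (\<gamma> t) = 1" for t
  proof -
    have "(norm (x + t *\<^sub>R v))\<^sup>2 = 1 + t\<^sup>2 * (v \<bullet> v)"
      unfolding power2_norm_eq_inner
      by (simp add: inner_add_left inner_add_right xx v inner_commute[of v x] power2_eq_square)
    then have "norm (x + t *\<^sub>R v) = sqrt (1 + t\<^sup>2 * (v \<bullet> v))"
      by (metis norm_ge_zero real_sqrt_unique)
    then show ?thesis using pos[of t] by (simp add: \<gamma>_def)
  qed
  moreover have "(\<gamma> has_vector_derivative v) (at 0)"
  proof -
    have "((\<lambda>t. 1 / sqrt (1 + t\<^sup>2 * (v \<bullet> v))) has_real_derivative 0) (at 0)"
      by (auto intro!: derivative_eq_intros)
    moreover have "((\<lambda>t. x + t *\<^sub>R v) has_vector_derivative v) (at 0)"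
      by (auto intro!: derivative_eq_intros)
    ultimately have "(\<gamma> has_vector_derivative (1 / sqrt (1 + 0\<^sup>2 * (v \<bullet> v))) *\<^sub>R v + 0 *\<^sub>R (x + 0 *\<^sub>R v)) (at 0)"
      unfolding \<gamma>_def by (rule has_vector_derivative_scaleR)
    then show ?thesis by simp
  qed
  moreover have "\<gamma> 0 = x" by (simp add: \<gamma>_def)
  ultimately show "v \<in> tangent_space (sphere 0 1) x"
    unfolding tangent_space_def
    by (intro CollectI exI[of _ \<gamma>] exI[of _ 1]) (auto intro: smooth_onI)
qed

subsection \<open>Criteria for embeddings\<close>

text \<open>A smooth left inverse on a neighbourhood is how all embeddings below are recognized: it yields
  injectivity, injectivity of the derivative by the chain rule, and continuity of the inverse at
  one stroke.\<close>

lemma left_inverse_derivative: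
  assumes f: "(f has_derivative f') (at x)" and g: "g differentiable (at (f x))"
    and "open U" "x \<in> U" "\<And>y. y \<in> U \<Longrightarrow> g (f y) = y"
  shows "frechet_derivative g (at (f x)) (f' v) = v"
proof -
  have g': "(g has_derivative frechet_derivative g (at (f x))) (at (f x))"
    using g by (simp add: frechet_derivative_works)
  have "((\<lambda>y. y) has_derivative frechet_derivative g (at (f x)) \<circ> f') (at x)"
    by (rule has_derivative_transform_within_open[OF diff_chain_at[OF f g'] assms(3,4)])
      (simp add: assms(5))
  from has_derivative_unique[OF this has_derivative_ident] show ?thesis
    by (metis comp_apply)
qed

lemma smooth_embedding_left_inverse:
  assumes "C_inf U f" "S \<subseteq> U" "C_inf W g" "f ` U \<subseteq> W" "\<And>y. y \<in> U \<Longrightarrow> g (f y) = y"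
  shows "smooth_embedding T S f"
proof -
  have "inj_on f S" using assms(2,5) by (metis inj_on_def subsetD)
  moreover have "inj_on (frechet_derivative f (at x)) (T x)" if "x \<in> S" for x
  proof -
    have x: "x \<in> U" using that assms(2) by auto
    have "g differentiable (at (f x))"
      using C_inf_derivative[OF assms(3)] assms(4) x by (auto simp: differentiable_def)
    from left_inverse_derivative[OF C_inf_derivative[OF assms(1) x] this C_inf_open[OF assms(1)] x assms(5)]
    show ?thesis by (metis inj_onI)
  qed
  moreover have "homeomorphism S (f ` S) f g"
    using C_inf_continuous[OF assms(1)] C_inf_continuous[OF assms(3)] assms(2,4,5)
    by (auto simp: homeomorphism_def image_image subset_iff intro: continuous_on_subset)
  ultimately show ?thesis
    using assms(1,2) by (auto simp: smooth_embedding_def injective_immersion_def intro: smooth_onI)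
qed

text \<open>If moreover \<open>\<psi> \<circ> g\<close> is the identity on \<open>M\<close>, then the image of \<open>\<psi>\<close> is the trace on \<open>M\<close> of an open
  preimage under \<open>g\<close>.\<close>

lemma local_param_left_inverse:
  fixes \<psi> :: "real^'k \<Rightarrow> 'a::euclidean_space"
  assumes \<psi>: "C_inf V \<psi>" and g: "C_inf W g" and VW: "\<psi> ` V \<subseteq> M \<inter> W"
    and left: "\<And>y. y \<in> V \<Longrightarrow> g (\<psi> y) = y"
    and right: "\<And>x. x \<in> M \<inter> W \<Longrightarrow> g x \<in> V \<Longrightarrow> \<psi> (g x) = x"
  shows "local_param M V \<psi>"
proof -
  have "\<psi> ` V = M \<inter> (W \<inter> g -` V)"
  proof (intro equalityI subsetI)
    fix x assume "x \<in> M \<inter> (W \<inter> g -` V)"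
    then have "x = \<psi> (g x)" "g x \<in> V" using right by auto
    then show "x \<in> \<psi> ` V" by (rule image_eqI)
  qed (use VW left in auto)
  moreover have "open (W \<inter> g -` V)"
    using continuous_open_preimage[OF C_inf_continuous[OF g] C_inf_open[OF g] C_inf_open[OF \<psi>]] .
  ultimately have "openin (top_of_set M) (\<psi> ` V)" by (metis openin_open)
  moreover have "smooth_embedding (\<lambda>_. UNIV) V \<psi>"
    by (rule smooth_embedding_left_inverse[OF \<psi> order.refl g]) (use VW left in auto)
  ultimately show ?thesis using C_inf_open[OF \<psi>] by (simp add: local_param_def)
qed

lemma local_param_range_derivative:
  assumes "local_param M V \<psi>" "y \<in> V"
  shows "frechet_derivative \<psi> (at y) a \<in> tangent_space M (\<psi> y)"
proof -
  have "C_inf V \<psi>" "\<psi> ` V \<subseteq> M"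
    using assms(1) openin_imp_subset[of euclidean M "\<psi> ` V"]
    by (auto simp add: local_param_def smooth_embedding_def injective_immersion_def smooth_on_open)
  then show ?thesis
    using tangent_space_push[of V \<psi> y a V M] assms tangent_space_open[of V y]
    by (auto simp: local_param_def)
qed

lemma smooth_embedding_compose:
  assumes f: "smooth_embedding T S f" and g: "smooth_embedding T' S' g"
    and sub: "f ` S \<subseteq> S'" and T: "\<And>x v. x \<in> S \<Longrightarrow> v \<in> T x \<Longrightarrow> frechet_derivative f (at x) v \<in> T' (f x)"
  shows "smooth_embedding T S (\<lambda>x. g (f x))"
proof -
  have sm: "smooth_on S f" "smooth_on S' g" and inj: "inj_on f S" "inj_on g S'"
    and D: "\<And>x. x \<in> S \<Longrightarrow> inj_on (frechet_derivative f (at x)) (T x)"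
      "\<And>x. x \<in> S' \<Longrightarrow> inj_on (frechet_derivative g (at x)) (T' x)"
    using f g by (auto simp: smooth_embedding_def injective_immersion_def)
  obtain f' g' where h: "homeomorphism S (f ` S) f f'" "homeomorphism S' (g ` S') g g'"
    using f g by (auto simp: smooth_embedding_def)
  have "homeomorphism (f ` S) (g ` f ` S) g g'"
    using h(2) sub by (rule homeomorphism_of_subsets) auto
  from homeomorphism_compose[OF h(1) this]
  have "homeomorphism S ((\<lambda>x. g (f x)) ` S) (\<lambda>x. g (f x)) (\<lambda>x. f' (g' x))"
    by (simp add: o_def image_image)
  moreover have "smooth_on S (\<lambda>x. g (f x))"
    by (rule smooth_on_compose[OF sm(2,1) sub])
  moreover have "inj_on (\<lambda>x. g (f x)) S"
    using inj sub by (auto simp: inj_on_def image_subset_iff)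
  moreover have "inj_on (frechet_derivative (\<lambda>x. g (f x)) (at x)) (T x)" if x: "x \<in> S" for x
  proof (rule inj_onI)
    fix v w assume vw: "v \<in> T x" "w \<in> T x"
      "frechet_derivative (\<lambda>x. g (f x)) (at x) v = frechet_derivative (\<lambda>x. g (f x)) (at x) w"
    have fx: "f x \<in> S'" using sub x by auto
    have "frechet_derivative f (at x) v = frechet_derivative f (at x) w"
      using vw(3) D(2)[OF fx] T[OF x vw(1)] T[OF x vw(2)]
      by (simp add: frechet_derivative_compose_smooth[OF sm(2,1) x fx] inj_on_eq_iff)
    then show "v = w" using D(1)[OF x] vw(1,2) by (simp add: inj_on_eq_iff)
  qed
  ultimately show ?thesis by (auto simp: smooth_embedding_def injective_immersion_def)
qed

lemma local_param_embed:
  assumes \<psi>: "local_param M V \<psi>" and F: "smooth_embedding (tangent_space M) M F"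
  shows "local_param (F ` M) V (\<lambda>y. F (\<psi> y))"
proof -
  have \<psi>': "open V" "smooth_embedding (\<lambda>_. UNIV) V \<psi>" "openin (top_of_set M) (\<psi> ` V)"
    using \<psi> by (auto simp: local_param_def)
  obtain F' where "homeomorphism M (F ` M) F F'" using F by (auto simp: smooth_embedding_def)
  from homeomorphism_imp_open_map[OF this \<psi>'(3)]
  have "openin (top_of_set (F ` M)) ((\<lambda>y. F (\<psi> y)) ` V)" by (simp add: image_image)
  moreover have "smooth_embedding (\<lambda>_. UNIV) V (\<lambda>y. F (\<psi> y))"
    by (rule smooth_embedding_compose[OF \<psi>'(2) F])
      (use local_param_range_derivative[OF \<psi>] openin_imp_subset[OF \<psi>'(3)] in auto)
  ultimately show ?thesis using \<psi>'(1) by (simp add: local_param_def)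
qed

text \<open>Precomposing a chart with a reflection of \<open>\<real>\<^sup>3\<close> interchanges the two classes of frames.\<close>

lemma oriented_submanifold3_reverse:
  assumes "oriented_submanifold3 M Or"
  shows "oriented_submanifold3 M (reverse_orientation Or)"
  unfolding oriented_submanifold3_def
proof
  fix p assume "p \<in> M"
  then obtain V and \<psi> :: "real^3 \<Rightarrow> 'a" where \<psi>: "local_param M V \<psi>" "p \<in> \<psi> ` V"
    and Or: "\<And>y. y \<in> V \<Longrightarrow> Or (\<psi> y) = push_frames (frechet_derivative \<psi> (at y))
       {(a, b, c). det (vector [a, b, c] :: real^3^3) > 0}"
    using assms by (auto simp: oriented_submanifold3_def)
  define r :: "real^3 \<Rightarrow> real^3" where "r y = vector [- y$1, y$2, y$3]" for y
  have r2: "r (r y) = y" for y by (simp add: r_def vec_eq_iff forall_3)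
  have lin: "linear r" by (intro linearI) (auto simp: r_def vec_eq_iff forall_3)
  then have r': "(r has_derivative r) (at y)" for y
    by (simp add: linear_conv_bounded_linear bounded_linear_imp_has_derivative)
  have Cr: "C_inf UNIV r"
    using C_inf_linear[OF _ C_inf_id[OF open_UNIV], of r] lin by (simp add: linear_conv_bounded_linear)
  have V: "open V" "smooth_embedding (\<lambda>_. UNIV) V \<psi>" "openin (top_of_set M) (\<psi> ` V)"
    using \<psi> by (auto simp: local_param_def)
  have rV: "r ` (r -` V) = V" using r2 by (auto simp: image_iff) (metis r2)
  have r_emb: "smooth_embedding (\<lambda>_. UNIV) (r -` V) r"
    by (rule smooth_embedding_left_inverse[OF Cr _ Cr]) (auto simp: r2)
  have "open (r -` V)"
    using continuous_open_preimage[OF C_inf_continuous[OF Cr] open_UNIV V(1)] by simp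
  moreover have "smooth_embedding (\<lambda>_. UNIV) (r -` V) (\<lambda>y. \<psi> (r y))"
    by (rule smooth_embedding_compose[OF r_emb V(2)]) auto
  moreover have image: "(\<lambda>y. \<psi> (r y)) ` (r -` V) = \<psi> ` V"
    using rV by (metis image_image)
  ultimately have "local_param M (r -` V) (\<lambda>y. \<psi> (r y))"
    using V(3) by (simp add: local_param_def)
  moreover have "reverse_orientation Or (\<psi> (r y)) = push_frames (frechet_derivative (\<lambda>y. \<psi> (r y)) (at y))
     {(a, b, c). det (vector [a, b, c] :: real^3^3) > 0}" if y: "y \<in> r -` V" for y
  proof -
    have "smooth_on V \<psi>" "smooth_on UNIV r"
      using V(2) Cr by (auto simp: smooth_embedding_def injective_immersion_def intro: smooth_onI)
    then have D: "frechet_derivative (\<lambda>y. \<psi> (r y)) (at y) a = frechet_derivative \<psi> (at (r y)) (r a)" for a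
      using y frechet_derivative_compose_smooth[of V \<psi> UNIV r y a]
      by (simp add: frechet_derivative_at[OF r', symmetric])
    have det: "det (vector [r a, r b, r c] :: real^3^3) = det (vector [b, a, c] :: real^3^3)" for a b c
      by (simp add: det_3 r_def)
    show ?thesis (is "?L = ?R")
    proof (intro equalityI subsetI)
      fix z assume "z \<in> ?L"
      then obtain a b c where "z = (frechet_derivative \<psi> (at (r y)) b, frechet_derivative \<psi> (at (r y)) a,
          frechet_derivative \<psi> (at (r y)) c)" "det (vector [a, b, c] :: real^3^3) > 0"
        using Or[of "r y"] y by (auto simp: reverse_orientation_def push_frames_def)
      then have "z = (\<lambda>(u, v, w). (frechet_derivative (\<lambda>y. \<psi> (r y)) (at y) u,
          frechet_derivative (\<lambda>y. \<psi> (r y)) (at y) v, frechet_derivative (\<lambda>y. \<psi> (r y)) (at y) w)) (r b, r a, r c)"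
        "(r b, r a, r c) \<in> {(a, b, c). det (vector [a, b, c] :: real^3^3) > 0}"
        by (simp_all add: D r2 det)
      then show "z \<in> ?R" unfolding push_frames_def by blast
    next
      fix z assume "z \<in> ?R"
      then obtain a b c where z: "z = (frechet_derivative \<psi> (at (r y)) (r a), frechet_derivative \<psi> (at (r y)) (r b),
          frechet_derivative \<psi> (at (r y)) (r c))" and "det (vector [a, b, c] :: real^3^3) > 0"
        by (auto simp: push_frames_def D)
      then have "(r b, r a, r c) \<in> {(a, b, c). det (vector [a, b, c] :: real^3^3) > 0}"
        by (simp add: det)
      then have "(\<lambda>(u, v, w). (frechet_derivative \<psi> (at (r y)) u, frechet_derivative \<psi> (at (r y)) v,
          frechet_derivative \<psi> (at (r y)) w)) (r b, r a, r c) \<in> Or (\<psi> (r y))"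
        using Or[of "r y"] y unfolding push_frames_def by blast
      then show "z \<in> ?L" by (simp add: reverse_orientation_def z)
    qed
  qed
  ultimately show "\<exists>V (\<psi> :: real^3 \<Rightarrow> 'a). local_param M V \<psi> \<and> p \<in> \<psi> ` V \<and>
        (\<forall>y\<in>V. reverse_orientation Or (\<psi> y) = push_frames (frechet_derivative \<psi> (at y))
                             {(a, b, c). det (vector [a, b, c] :: real^3^3) > 0})"
    using \<psi>(2) image by (intro exI[of _ "r -` V"] exI[of _ "\<lambda>y. \<psi> (r y)"]) auto
qed

text \<open>Two maps that agree on \<open>M\<close> agree along every curve in \<open>M\<close>. Applied to an equation that holds on
  \<open>M\<close>, this differentiates the equation in the directions tangent to \<open>M\<close>.\<close>

lemma tangent_space_agree:
  assumes f: "C_inf U f" and h: "C_inf U h" and p: "p \<in> U" and v: "v \<in> tangent_space M p"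
    and eq: "\<And>x. x \<in> M \<inter> U \<Longrightarrow> f x = h x"
  shows "frechet_derivative f (at p) v = frechet_derivative h (at p) v"
proof -
  obtain \<gamma> e where e: "e > 0" "smooth_on {-e<..<e} \<gamma>" "\<gamma> ` {-e<..<e} \<subseteq> M" "\<gamma> 0 = p"
    and d: "(\<gamma> has_vector_derivative v) (at (0::real))"
    using v by (auto simp: tangent_space_def)
  have \<gamma>: "C_inf {-e<..<e} \<gamma>" using e(2) by (simp add: smooth_on_open)
  have O: "open ({-e<..<e} \<inter> \<gamma> -` U)" (is "open ?O")
    using C_inf_continuous[OF \<gamma>] C_inf_open[OF f] by (intro continuous_open_preimage) auto
  have 0: "0 \<in> ?O" using e p by simp
  have D: "((\<lambda>t. k (\<gamma> t)) has_derivative (\<lambda>t. frechet_derivative k (at p) (t *\<^sub>R v))) (at 0)" if k: "C_inf U k" for k :: "'a \<Rightarrow> 'b"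
  proof -
    have "(k has_derivative frechet_derivative k (at p)) (at (\<gamma> 0))"
      using C_inf_derivative[OF k p] e(4) by simp
    from diff_chain_at[OF d[unfolded has_vector_derivative_def] this] show ?thesis by (simp add: o_def)
  qed
  have "f (\<gamma> t) = h (\<gamma> t)" if "t \<in> ?O" for t
    using that e(3) by (intro eq) blast
  then have "((\<lambda>t. h (\<gamma> t)) has_derivative (\<lambda>t. frechet_derivative f (at p) (t *\<^sub>R v))) (at 0)"
    by (rule has_derivative_transform_within_open[OF D[OF f] O 0])
  from has_derivative_unique[OF this D[OF h]] show ?thesis by (metis scaleR_one)
qed

lemma tangent_space_chart:
  assumes \<psi>: "C_inf V \<psi>" and g: "C_inf W g" and VW: "\<psi> ` V \<subseteq> M \<inter> W"
    and left: "\<And>y. y \<in> V \<Longrightarrow> g (\<psi> y) = y"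
    and right: "\<And>x. x \<in> M \<inter> W \<Longrightarrow> g x \<in> V \<Longrightarrow> \<psi> (g x) = x"
    and y: "y \<in> V" and v: "v \<in> tangent_space M (\<psi> y)"
  shows "v \<in> range (frechet_derivative \<psi> (at y))"
proof -
  let ?U = "W \<inter> g -` V"
  have y': "\<psi> y \<in> ?U" using VW y left by auto
  have U: "open ?U"
    using C_inf_continuous[OF g] C_inf_open[OF g] C_inf_open[OF \<psi>] by (rule continuous_open_preimage)
  have gU: "C_inf ?U g" using U by (rule C_inf_subset[OF g]) auto
  have "C_inf ?U (\<lambda>x. \<psi> (g x))" by (rule C_inf_compose[OF \<psi> gU]) auto
  moreover have "C_inf ?U (\<lambda>x. x)" by (rule C_inf_id[OF U])
  ultimately have "frechet_derivative (\<lambda>x. \<psi> (g x)) (at (\<psi> y)) v = frechet_derivative (\<lambda>x. x) (at (\<psi> y)) v"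
    using y' v by (rule tangent_space_agree) (use right in auto)
  moreover have "frechet_derivative (\<lambda>x. \<psi> (g x)) (at (\<psi> y)) v =
      frechet_derivative \<psi> (at (g (\<psi> y))) (frechet_derivative g (at (\<psi> y)) v)"
    by (rule frechet_derivative_compose_smooth[OF smooth_onI[OF \<psi> order.refl] smooth_onI[OF gU order.refl] y'])
      (use y left in auto)
  ultimately show ?thesis using left[OF y] by (metis frechet_derivative_ident rangeI)
qed

section \<open>The oriented 3-sphere\<close>

lemma inner_complex_vec2: "(x :: complex^2) \<bullet> y = Re (cnj (x$1) * y$1) + Re (cnj (x$2) * y$2)"
  by (simp add: inner_vec_def sum_2 inner_complex_def)

lemma complex_vec2_eq_iff: "(x :: complex^2) = y \<longleftrightarrow>
    Re (x$1) = Re (y$1) \<and> Im (x$1) = Im (y$1) \<and> Re (x$2) = Re (y$2) \<and> Im (x$2) = Im (y$2)"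
  by (auto simp: vec_eq_iff forall_2 complex_eq_iff)

lemma S3_iff: "z \<in> S3 \<longleftrightarrow> (cmod (z$1))\<^sup>2 + (cmod (z$2))\<^sup>2 = 1"
proof -
  have "z \<in> S3 \<longleftrightarrow> z \<bullet> z = 1" by (simp add: norm_eq_1)
  then show ?thesis unfolding cmod_power2 by (simp add: inner_complex_vec2 power2_eq_square)
qed

lemma S3_real: "z \<in> S3 \<longleftrightarrow> Re (z$1) * Re (z$1) + Im (z$1) * Im (z$1) + Re (z$2) * Re (z$2) + Im (z$2) * Im (z$2) = 1"
  unfolding S3_iff cmod_power2 by (simp add: power2_eq_square algebra_simps)

text \<open>The three vectors are the products of \<open>z\<close> with the quaternions \<open>i\<close>, \<open>j\<close>, \<open>k\<close>. They form a global
  orthonormal frame of the tangent bundle of the 3-sphere, which is positively oriented; hence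
  conditions on all positive frames reduce to this one.\<close>

definition S3_frame :: "complex^2 \<Rightarrow> real^3 \<Rightarrow> complex^2" where
  "S3_frame z a = a$1 *\<^sub>R vector [\<i> * z$1, \<i> * z$2] + a$2 *\<^sub>R vector [- cnj (z$2), cnj (z$1)] +
     a$3 *\<^sub>R vector [- \<i> * cnj (z$2), \<i> * cnj (z$1)]"

definition S3_coframe :: "complex^2 \<Rightarrow> complex^2 \<Rightarrow> real^3" where
  "S3_coframe z x = vector [vector [\<i> * z$1, \<i> * z$2] \<bullet> x, vector [- cnj (z$2), cnj (z$1)] \<bullet> x,
     vector [- \<i> * cnj (z$2), \<i> * cnj (z$1)] \<bullet> x]"

lemma linear_S3_frame: "bounded_linear (S3_frame z)"
  unfolding S3_frame_def
  by (intro bounded_linear_intros bounded_linear_compose[OF bounded_linear_scaleR_left bounded_linear_vec_nth])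

lemma linear_S3_coframe: "bounded_linear (S3_coframe z)"
  by (intro linear_conv_bounded_linear[THEN iffD1] linearI)
    (auto simp: S3_coframe_def vec_eq_iff forall_3 inner_add_right)

lemmas S3_frame_linear =
  linear_add[OF bounded_linear.linear[OF linear_S3_frame]] linear_scale[OF bounded_linear.linear[OF linear_S3_frame]]
lemmas S3_coframe_linear =
  linear_add[OF bounded_linear.linear[OF linear_S3_coframe]] linear_scale[OF bounded_linear.linear[OF linear_S3_coframe]]

lemma S3_frame_nth: "S3_frame z a $ 1 = a$1 *\<^sub>R (\<i> * z$1) - a$2 *\<^sub>R cnj (z$2) - a$3 *\<^sub>R (\<i> * cnj (z$2))"
  "S3_frame z a $ 2 = a$1 *\<^sub>R (\<i> * z$2) + a$2 *\<^sub>R cnj (z$1) + a$3 *\<^sub>R (\<i> * cnj (z$1))"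
  by (simp_all add: S3_frame_def)

lemma inner_S3_frame: "z \<bullet> S3_frame z a = 0"
  by (simp add: inner_complex_vec2 S3_frame_nth algebra_simps)

lemma S3_coframe_self: "S3_coframe z z = 0"
  by (simp add: S3_coframe_def vec_eq_iff forall_3 inner_complex_vec2 algebra_simps)

lemma S3_coframe_frame:
  assumes "z \<in> S3"
  shows "S3_coframe z (S3_frame z a) = a"
proof -
  have "S3_coframe z (S3_frame z a) = (Re (z$1) * Re (z$1) + Im (z$1) * Im (z$1) + Re (z$2) * Re (z$2) + Im (z$2) * Im (z$2)) *\<^sub>R a"
    by (simp add: vec_eq_iff forall_3 S3_coframe_def S3_frame_nth inner_complex_vec2 algebra_simps)
  then show ?thesis using assms by (simp only: S3_real scaleR_one)
qed

lemma S3_frame_coframe: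
  assumes "z \<in> S3"
  shows "S3_frame z (S3_coframe z x) = x - (z \<bullet> x) *\<^sub>R z"
proof -
  have "S3_frame z (S3_coframe z x) + (z \<bullet> x) *\<^sub>R z =
      (Re (z$1) * Re (z$1) + Im (z$1) * Im (z$1) + Re (z$2) * Re (z$2) + Im (z$2) * Im (z$2)) *\<^sub>R x"
    by (simp add: complex_vec2_eq_iff S3_coframe_def S3_frame_nth inner_complex_vec2 algebra_simps)
  then show ?thesis using assms unfolding S3_real by (simp add: eq_diff_eq)
qed

lemma inner_S3_frame_S3_frame:
  assumes "z \<in> S3"
  shows "S3_frame z a \<bullet> S3_frame z a = a \<bullet> a"
proof -
  have "S3_frame z a \<bullet> S3_frame z a = (Re (z$1) * Re (z$1) + Im (z$1) * Im (z$1) + Re (z$2) * Re (z$2) + Im (z$2) * Im (z$2)) * (a \<bullet> a)"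
    by (simp add: S3_frame_nth inner_complex_vec2 inner_vec_def[of a] sum_3 algebra_simps)
  then show ?thesis using assms by (simp only: S3_real mult_1)
qed

lemma tangent_space_S3: "z \<in> S3 \<Longrightarrow> tangent_space S3 z = range (S3_frame z)"
proof -
  assume z: "z \<in> S3"
  show ?thesis
  proof (intro equalityI subsetI)
    fix v assume "v \<in> tangent_space S3 z"
    then have "z \<bullet> v = 0" using tangent_space_sphere[OF z] by simp
    then have "v = S3_frame z (S3_coframe z v)" by (simp add: S3_frame_coframe[OF z])
    then show "v \<in> range (S3_frame z)" by (rule range_eqI)
  qed (auto simp: tangent_space_sphere[OF z] inner_S3_frame)
qed

subsection \<open>Determinants\<close>

lemma vector_4 [simp]:
  "(vector [a, b, c, d] :: 'a::zero^4) $ 1 = a" "(vector [a, b, c, d] :: 'a::zero^4) $ 2 = b"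
  "(vector [a, b, c, d] :: 'a::zero^4) $ 3 = c" "(vector [a, b, c, d] :: 'a::zero^4) $ 4 = d"
  by (simp_all add: vector_def)

lemma det_4:
  "det (A :: real^4^4) =
    A$1$1 * (A$2$2 * (A$3$3 * A$4$4 - A$3$4 * A$4$3) - A$2$3 * (A$3$2 * A$4$4 - A$3$4 * A$4$2) + A$2$4 * (A$3$2 * A$4$3 - A$3$3 * A$4$2))
  - A$1$2 * (A$2$1 * (A$3$3 * A$4$4 - A$3$4 * A$4$3) - A$2$3 * (A$3$1 * A$4$4 - A$3$4 * A$4$1) + A$2$4 * (A$3$1 * A$4$3 - A$3$3 * A$4$1))
  + A$1$3 * (A$2$1 * (A$3$2 * A$4$4 - A$3$4 * A$4$2) - A$2$2 * (A$3$1 * A$4$4 - A$3$4 * A$4$1) + A$2$4 * (A$3$1 * A$4$2 - A$3$2 * A$4$1))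
  - A$1$4 * (A$2$1 * (A$3$2 * A$4$3 - A$3$3 * A$4$2) - A$2$2 * (A$3$1 * A$4$3 - A$3$3 * A$4$1) + A$2$3 * (A$3$1 * A$4$2 - A$3$2 * A$4$1))"
proof -
  have f: "finite {2::4, 3, 4}" "1 \<notin> {2::4, 3, 4}" "finite {3::4, 4}" "2 \<notin> {3::4, 4}" "finite {4::4}" "3 \<notin> {4::4}"
    by auto
  show ?thesis
    unfolding det_def UNIV_4
    unfolding sum_over_permutations_insert[OF f(1,2)]
    unfolding sum_over_permutations_insert[OF f(3,4)]
    unfolding sum_over_permutations_insert[OF f(5,6)]
    unfolding permutes_sing
    by (simp add: sign_swap_id permutation_swap_id permutation_compose sign_compose sign_id swap_id_eq algebra_simps)
qed

text \<open>The matrix with rows \<open>q\<close>, \<open>i q\<close>, \<open>j q\<close>, \<open>k q\<close> has determinant \<open>(q \<bullet> q)\<^sup>2\<close>, so determinants can be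
  computed from the coordinates with respect to this basis.\<close>

lemma det_S3_frame:
  assumes q: "q \<in> S3"
  shows "det (vector [real_coords (s0 *\<^sub>R q + S3_frame q a0), real_coords (s1 *\<^sub>R q + S3_frame q a1),
      real_coords (s2 *\<^sub>R q + S3_frame q a2), real_coords (s3 *\<^sub>R q + S3_frame q a3)] :: real^4^4) =
    det (vector [vector [s0, a0$1, a0$2, a0$3], vector [s1, a1$1, a1$2, a1$3],
      vector [s2, a2$1, a2$2, a2$3], vector [s3, a3$1, a3$2, a3$3]] :: real^4^4)"
    (is "det ?L = det ?C")
proof -
  define Q :: "real^4^4" where "Q = vector [real_coords q, real_coords (vector [\<i> * q$1, \<i> * q$2]),
     real_coords (vector [- cnj (q$2), cnj (q$1)]), real_coords (vector [- \<i> * cnj (q$2), \<i> * cnj (q$1)])]"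
  have "?L = ?C ** Q"
    by (simp add: vec_eq_iff forall_4 matrix_matrix_mult_def sum_4 Q_def real_coords_def S3_frame_nth algebra_simps)
  moreover have "det Q = (Re (q$1) * Re (q$1) + Im (q$1) * Im (q$1) + Re (q$2) * Re (q$2) + Im (q$2) * Im (q$2))\<^sup>2"
    unfolding det_4 by (simp add: Q_def real_coords_def power2_eq_square algebra_simps)
  ultimately show ?thesis using q unfolding S3_real by (simp add: det_mul)
qed

lemma det_S3_frame_unit:
  assumes "q \<in> S3"
  shows "det (vector [real_coords q, real_coords (S3_frame q a), real_coords (S3_frame q b), real_coords (S3_frame q c)] :: real^4^4)
    = det (vector [a, b, c] :: real^3^3)"
proof -
  have "S3_frame q 0 = 0" by (simp add: S3_frame_def)
  then show ?thesis
    using det_S3_frame[OF assms, of 1 0 0 a 0 b 0 c] by (simp add: det_4 det_3 algebra_simps)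
qed

lemma S3_orientation_eq:
  assumes z: "z \<in> S3"
  shows "S3_orientation z = push_frames (S3_frame z) {(a, b, c). det (vector [a, b, c] :: real^3^3) > 0}"
proof (intro equalityI subsetI)
  fix f assume "f \<in> S3_orientation z"
  then obtain a b c where f: "f = (S3_frame z a, S3_frame z b, S3_frame z c)"
    and "det (vector [real_coords z, real_coords (S3_frame z a), real_coords (S3_frame z b), real_coords (S3_frame z c)] :: real^4^4) > 0"
    by (auto simp: S3_orientation_def tangent_space_S3[OF z])
  then have "(a, b, c) \<in> {(a, b, c). det (vector [a, b, c] :: real^3^3) > 0}"
    by (simp add: det_S3_frame_unit[OF z])
  then show "f \<in> push_frames (S3_frame z) {(a, b, c). det (vector [a, b, c] :: real^3^3) > 0}"
    unfolding push_frames_def f by (rule rev_image_eqI) simp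
next
  fix f assume "f \<in> push_frames (S3_frame z) {(a, b, c). det (vector [a, b, c] :: real^3^3) > 0}"
  then show "f \<in> S3_orientation z"
    by (auto simp: push_frames_def S3_orientation_def tangent_space_S3[OF z] det_S3_frame_unit[OF z])
qed

subsection \<open>Central projection charts\<close>

text \<open>This projects the affine tangent space at \<open>q\<close> from the origin to the open half sphere about
  \<open>q\<close>. The inverse is rational, and orientations can be compared by row operations.\<close>

definition central_chart :: "complex^2 \<Rightarrow> real^3 \<Rightarrow> complex^2" where
  "central_chart q y = (1 / sqrt (1 + y \<bullet> y)) *\<^sub>R (q + S3_frame q y)"

lemma central_chart_pos: "1 + (y::real^3) \<bullet> y > 0"
  by (simp add: add_pos_nonneg)

lemma C_inf_central_chart: "C_inf UNIV (central_chart q)"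
proof -
  have "sqrt (1 + y \<bullet> y) \<noteq> 0" for y :: "real^3" using central_chart_pos[of y] by simp
  then show ?thesis
    unfolding central_chart_def
    by (intro C_inf_intros open_UNIV central_chart_pos C_inf_linear[OF linear_S3_frame])
qed

lemma norm_q_frame:
  assumes q: "q \<in> S3"
  shows "(q + S3_frame q y) \<bullet> (q + S3_frame q y) = 1 + y \<bullet> y"
proof -
  have "q \<bullet> q = 1" using q by (simp add: dot_square_norm)
  then show ?thesis
    using inner_S3_frame[of q y] inner_S3_frame_S3_frame[OF q, of y]
    by (simp add: inner_add_left inner_add_right inner_commute)
qed

lemma central_chart_S3:
  assumes q: "q \<in> S3"
  shows "central_chart q y \<in> S3"
proof -
  have "central_chart q y \<bullet> central_chart q y = 1"
    using central_chart_pos[of y]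
    by (simp add: central_chart_def norm_q_frame[OF q])
  then show ?thesis by (metis mem_sphere_0 norm_eq_1)
qed

lemma central_chart_inverse:
  assumes q: "q \<in> S3"
  defines "W \<equiv> {x. q \<bullet> x > 0}" and "g \<equiv> \<lambda>x. (1 / (q \<bullet> x)) *\<^sub>R S3_coframe q x"
  shows "C_inf W g" "central_chart q ` UNIV \<subseteq> S3 \<inter> W" "g (central_chart q y) = y"
    "x \<in> S3 \<inter> W \<Longrightarrow> central_chart q (g x) = x"
proof -
  have qq: "q \<bullet> q = 1" using q by (simp add: dot_square_norm)
  have W: "open W" unfolding W_def by (intro open_Collect_less continuous_intros)
  show "C_inf W g" unfolding g_def
    by (intro C_inf_intros C_inf_linear[OF linear_S3_coframe] W) (simp add: W_def)
  have i: "q \<bullet> central_chart q y = 1 / sqrt (1 + y \<bullet> y)" for y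
    by (simp add: central_chart_def inner_add_right qq inner_S3_frame)
  have pos: "sqrt (1 + y \<bullet> y) > 0" for y :: "real^3" using central_chart_pos[of y] by simp
  show "central_chart q ` UNIV \<subseteq> S3 \<inter> W"
    using central_chart_S3[OF q] i pos by (auto simp: W_def)
  show "g (central_chart q y) = y"
  proof -
    have "S3_coframe q (central_chart q y) = (1 / sqrt (1 + y \<bullet> y)) *\<^sub>R y"
      unfolding central_chart_def S3_coframe_linear
      by (simp add: S3_coframe_self S3_coframe_frame[OF q])
    then show ?thesis using pos[of y] by (simp add: i g_def)
  qed
  assume x: "x \<in> S3 \<inter> W"
  let ?c = "q \<bullet> x"
  have c: "?c > 0" using x by (simp add: W_def)
  have *: "q + S3_frame q (g x) = (1 / ?c) *\<^sub>R x"
    using c by (simp add: g_def S3_frame_linear S3_frame_coframe[OF q] scaleR_diff_right)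
  have "1 + g x \<bullet> g x = ((1 / ?c) *\<^sub>R x) \<bullet> ((1 / ?c) *\<^sub>R x)"
    using norm_q_frame[OF q, of "g x"] unfolding * by simp
  also have "\<dots> = (1 / ?c)\<^sup>2"
    using x by (simp add: dot_square_norm power2_eq_square)
  finally have "sqrt (1 + g x \<bullet> g x) = 1 / ?c" using c by simp
  then show "central_chart q (g x) = x" unfolding central_chart_def * using c by simp
qed

lemma local_param_central_chart:
  assumes q: "q \<in> S3"
  shows "local_param S3 UNIV (central_chart q)"
  by (rule local_param_left_inverse[OF C_inf_central_chart central_chart_inverse(1-3)[OF q]])
    (rule central_chart_inverse(4)[OF q])

lemma central_chart_derivative:
  assumes q: "q \<in> S3"
  obtains m where "\<And>a. frechet_derivative (central_chart q) (at y) a =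
      m a *\<^sub>R (q + S3_frame q y) + (1 / sqrt (1 + y \<bullet> y)) *\<^sub>R S3_frame q a"
proof -
  have "C_inf UNIV (\<lambda>y::real^3. 1 / sqrt (1 + y \<bullet> y))"
    using central_chart_pos by (intro C_inf_intros open_UNIV) (auto simp: less_imp_neq[symmetric])
  from C_inf_derivative[OF this] obtain m where m: "((\<lambda>y::real^3. 1 / sqrt (1 + y \<bullet> y)) has_derivative m) (at y)"
    by blast
  have "((\<lambda>y. q + S3_frame q y) has_derivative S3_frame q) (at y)"
    by (auto intro!: derivative_eq_intros bounded_linear_imp_has_derivative linear_S3_frame)
  from has_derivative_scaleR[OF m this]
  have "(central_chart q has_derivative (\<lambda>a. (1 / sqrt (1 + y \<bullet> y)) *\<^sub>R S3_frame q a + m a *\<^sub>R (q + S3_frame q y))) (at y)"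
    unfolding central_chart_def .
  then have "frechet_derivative (central_chart q) (at y) a =
      m a *\<^sub>R (q + S3_frame q y) + (1 / sqrt (1 + y \<bullet> y)) *\<^sub>R S3_frame q a" for a
    by (simp add: frechet_derivative_at[symmetric])
  then show ?thesis by (rule that)
qed

text \<open>Row operations with the first row remove the terms with \<open>k\<close>, \<open>l\<close>, \<open>m\<close>, which come from the
  derivative of the normalizing factor.\<close>

lemma det_central_projection:
  fixes y a b c :: "real^3"
  shows "det (vector [vector [r, (r *\<^sub>R y)$1, (r *\<^sub>R y)$2, (r *\<^sub>R y)$3],
      vector [k, (k *\<^sub>R y + r *\<^sub>R a)$1, (k *\<^sub>R y + r *\<^sub>R a)$2, (k *\<^sub>R y + r *\<^sub>R a)$3],
      vector [l, (l *\<^sub>R y + r *\<^sub>R b)$1, (l *\<^sub>R y + r *\<^sub>R b)$2, (l *\<^sub>R y + r *\<^sub>R b)$3],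
      vector [m, (m *\<^sub>R y + r *\<^sub>R c)$1, (m *\<^sub>R y + r *\<^sub>R c)$2, (m *\<^sub>R y + r *\<^sub>R c)$3]] :: real^4^4)
    = r ^ 4 * det (vector [a, b, c] :: real^3^3)"
  unfolding det_4 det_3 vector_4 vector_3 vector_add_component vector_scaleR_component real_scaleR_def
  by algebra

lemma det_central_chart:
  assumes q: "q \<in> S3"
  defines "D \<equiv> \<lambda>y. frechet_derivative (central_chart q) (at y)"
  shows "det (vector [real_coords (central_chart q y), real_coords (D y a), real_coords (D y b), real_coords (D y c)] :: real^4^4)
    = (1 / sqrt (1 + y \<bullet> y)) ^ 4 * det (vector [a, b, c] :: real^3^3)"
proof -
  obtain m where m: "\<And>a. D y a = m a *\<^sub>R (q + S3_frame q y) + (1 / sqrt (1 + y \<bullet> y)) *\<^sub>R S3_frame q a"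
    using central_chart_derivative[OF q] unfolding D_def by metis
  let ?r = "1 / sqrt (1 + y \<bullet> y)"
  have D: "D y a = m a *\<^sub>R q + S3_frame q (m a *\<^sub>R y + ?r *\<^sub>R a)" for a
    unfolding m S3_frame_linear by (simp only: scaleR_add_right add.assoc)
  have c: "central_chart q y = ?r *\<^sub>R q + S3_frame q (?r *\<^sub>R y)"
    unfolding central_chart_def S3_frame_linear by (simp add: scaleR_add_right)
  show ?thesis
    unfolding D c det_S3_frame[OF q] by (rule det_central_projection)
qed

lemma push_frames_central_chart:
  assumes q: "q \<in> S3"
  shows "push_frames (frechet_derivative (central_chart q) (at y)) {(a, b, c). det (vector [a, b, c] :: real^3^3) > 0}
    = S3_orientation (central_chart q y)" (is "?L = ?R")
proof -
  let ?D = "frechet_derivative (central_chart q) (at y)"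
  have pos: "(1 / sqrt (1 + y \<bullet> y)) ^ 4 > 0" using central_chart_pos[of y] by simp
  have T: "?D a \<in> tangent_space S3 (central_chart q y)" for a
    by (rule local_param_range_derivative[OF local_param_central_chart[OF q] UNIV_I])
  have surj: "v \<in> range ?D" if "v \<in> tangent_space S3 (central_chart q y)" for v
    by (rule tangent_space_chart[OF C_inf_central_chart central_chart_inverse(1-3)[OF q]
          central_chart_inverse(4)[OF q] UNIV_I that])
  show ?thesis
  proof (intro equalityI subsetI)
    fix f assume "f \<in> ?L"
    then show "f \<in> ?R"
      using T pos by (auto simp: push_frames_def S3_orientation_def det_central_chart[OF q])
  next
    fix f assume "f \<in> ?R"
    then obtain a b c where f: "f = (?D a, ?D b, ?D c)"
      and "det (vector [real_coords (central_chart q y), real_coords (?D a), real_coords (?D b), real_coords (?D c)] :: real^4^4) > 0"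
      using surj by (clarsimp simp: S3_orientation_def) (metis (no_types) imageE)
    then have "(a, b, c) \<in> {(a, b, c). det (vector [a, b, c] :: real^3^3) > 0}"
      using pos by (simp add: det_central_chart[OF q] zero_less_mult_iff)
    then show "f \<in> ?L" unfolding push_frames_def f by (rule rev_image_eqI) simp
  qed
qed

section \<open>The contact condition for an embedded sphere\<close>

lemma push_frames_compose: "push_frames (\<lambda>v. D (E v)) B = push_frames D (push_frames E B)"
  by (auto simp: push_frames_def image_image case_prod_unfold)

lemma oriented_submanifold3_image:
  fixes F :: "complex^2 \<Rightarrow> complex^3"
  assumes F: "smooth_embedding (tangent_space S3) S3 F"
    and Or: "\<And>x. x \<in> S3 \<Longrightarrow> Or (F x) = push_frames (frechet_derivative F (at x)) (S3_orientation x)"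
  shows "oriented_submanifold3 (F ` S3) Or"
  unfolding oriented_submanifold3_def
proof
  fix p assume "p \<in> F ` S3"
  then obtain q where q: "q \<in> S3" and p: "p = F q" by blast
  have "smooth_on S3 F" using F by (simp add: smooth_embedding_def injective_immersion_def)
  then have D: "frechet_derivative (\<lambda>y. F (central_chart q y)) (at y) =
      (\<lambda>v. frechet_derivative F (at (central_chart q y)) (frechet_derivative (central_chart q) (at y) v))" for y
    by (intro ext frechet_derivative_compose_smooth[OF _ smooth_onI[OF C_inf_central_chart order.refl] UNIV_I central_chart_S3[OF q]])
  have 1: "local_param (F ` S3) UNIV (\<lambda>y. F (central_chart q y))"
    by (rule local_param_embed[OF local_param_central_chart[OF q] F])
  have "central_chart q 0 = q" by (simp add: central_chart_def S3_frame_def)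
  then have 2: "p \<in> range (\<lambda>y. F (central_chart q y))"
    by (intro range_eqI[of _ _ 0]) (simp only: p)
  have 3: "Or (F (central_chart q y)) = push_frames (frechet_derivative (\<lambda>y. F (central_chart q y)) (at y))
      {(a, b, c). det (vector [a, b, c] :: real^3^3) > 0}" for y
  proof -
    have "push_frames (frechet_derivative (\<lambda>y. F (central_chart q y)) (at y)) B =
        push_frames (frechet_derivative F (at (central_chart q y))) (push_frames (frechet_derivative (central_chart q) (at y)) B)" for B
      unfolding D by (rule push_frames_compose)
    from this[of "{(a, b, c). det (vector [a, b, c] :: real^3^3) > 0}", unfolded push_frames_central_chart[OF q]]
    show ?thesis using Or[OF central_chart_S3[OF q]] by (rule trans[rotated, OF sym])
  qed
  show "\<exists>V (\<psi> :: real^3 \<Rightarrow> complex^3). local_param (F ` S3) V \<psi> \<and> p \<in> \<psi> ` V \<and>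
        (\<forall>y\<in>V. Or (\<psi> y) = push_frames (frechet_derivative \<psi> (at y))
                             {(a, b, c). det (vector [a, b, c] :: real^3^3) > 0})"
    using 1 2 3 by (intro exI[of _ UNIV] exI[of _ "\<lambda>y. F (central_chart q y)"]) blast
qed

lemma alpha_eq: "alpha z v = Im (cnj (z$1) * v$1) + Im (cnj (z$2) * v$2) + Im (cnj (z$3) * v$3)"
  by (simp add: alpha_def sum_3)

lemma alpha_linear: "alpha z (u + v) = alpha z u + alpha z v" "alpha z (c *\<^sub>R v) = c * alpha z v"
  and alpha_skew: "alpha v z = - alpha z v"
  by (simp_all add: alpha_eq algebra_simps)

lemma alpha_linear_left: "alpha (u + v) z = alpha u z + alpha v z" "alpha (c *\<^sub>R v) z = c * alpha v z"
  by (simp_all add: alpha_eq algebra_simps)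

text \<open>The form \<open>\<alpha>\<close> is linear in the base point and skew, hence its two partial derivatives coincide.\<close>

lemma ext_deriv1_alpha: "ext_deriv1 alpha p = (\<lambda>u v. 2 * alpha u v)"
proof -
  have "linear (\<lambda>q. alpha q v)" for v by (intro linearI) (simp_all add: alpha_linear_left)
  then have "((\<lambda>q. alpha q v) has_derivative (\<lambda>q. alpha q v)) (at p)" for v
    by (simp add: linear_conv_bounded_linear bounded_linear_imp_has_derivative)
  note d = frechet_derivative_at[OF this, symmetric]
  have "alpha u v - alpha v u = 2 * alpha u v" for u v using alpha_skew[of v u] by simp
  then show ?thesis unfolding ext_deriv1_def d by (intro ext)
qed

text \<open>The value of \<open>\<alpha> \<and> d\<alpha>\<close>, pulled back by \<open>F\<close>, on the global frame of the 3-sphere.\<close>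

definition contact_volume :: "(complex^2 \<Rightarrow> complex^3) \<Rightarrow> complex^2 \<Rightarrow> real" where
  "contact_volume F x = (let D = \<lambda>i. frechet_derivative F (at x) (S3_frame x (axis i 1)) in
     wedge12 (alpha (F x)) (ext_deriv1 alpha (F x)) (D 1) (D 2) (D 3))"

text \<open>An alternating trilinear form on a 3-dimensional space is a multiple of the determinant.\<close>

lemma wedge12_S3_frame:
  assumes D: "linear D"
  shows "wedge12 (alpha p) (ext_deriv1 alpha p) (D (S3_frame x a)) (D (S3_frame x b)) (D (S3_frame x c)) =
    det (vector [a, b, c] :: real^3^3) *
    wedge12 (alpha p) (ext_deriv1 alpha p) (D (S3_frame x (axis 1 1))) (D (S3_frame x (axis 2 1))) (D (S3_frame x (axis 3 1)))"
proof -
  let ?e = "\<lambda>i. D (S3_frame x (axis i 1))"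
  have *: "D (S3_frame x a) = a$1 *\<^sub>R ?e 1 + a$2 *\<^sub>R ?e 2 + a$3 *\<^sub>R ?e 3" for a
  proof -
    have "a = a$1 *\<^sub>R axis 1 1 + a$2 *\<^sub>R axis 2 1 + a$3 *\<^sub>R axis 3 1"
      by (simp add: vec_eq_iff forall_3 axis_def)
    then show ?thesis
      by (metis (no_types) S3_frame_linear linear_add[OF D] linear_scale[OF D])
  qed
  have 0: "alpha v v = 0" for v using alpha_skew[of v v] by simp
  show ?thesis
    unfolding *[of a] *[of b] *[of c] wedge12_def ext_deriv1_alpha alpha_linear alpha_linear_left 0
      alpha_skew[of "?e 2" "?e 1"] alpha_skew[of "?e 3" "?e 1"] alpha_skew[of "?e 3" "?e 2"] det_3 vector_3
    by algebra
qed

lemma contact_submanifold_image: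
  assumes F: "smooth_embedding (tangent_space S3) S3 F" and S5: "F ` S3 \<subseteq> S5"
    and Or: "\<And>x. x \<in> S3 \<Longrightarrow> Or (F x) = push_frames (frechet_derivative F (at x)) (S3_orientation x)"
  shows "(\<And>x. x \<in> S3 \<Longrightarrow> contact_volume F x > 0) \<Longrightarrow> contact_submanifold (F ` S3) Or"
    and "(\<And>x. x \<in> S3 \<Longrightarrow> contact_volume F x < 0) \<Longrightarrow> contact_submanifold (F ` S3) (reverse_orientation Or)"
proof -
  have lin: "linear (frechet_derivative F (at x))" if "x \<in> S3" for x
  proof -
    have "smooth_on S3 F" using F by (simp add: smooth_embedding_def injective_immersion_def)
    from has_derivative_linear[OF smooth_on_derivative[OF this that]] show ?thesis.
  qed
  have vol: "\<exists>d>0. wedge12 (alpha (F x)) (ext_deriv1 alpha (F x)) u v w = d * contact_volume F x"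
    if x: "x \<in> S3" and f: "(u, v, w) \<in> Or (F x)" for x u v w
  proof -
    let ?D = "frechet_derivative F (at x)"
    obtain a b c where "det (vector [a, b, c] :: real^3^3) > 0"
        "u = ?D (S3_frame x a)" "v = ?D (S3_frame x b)" "w = ?D (S3_frame x c)"
      using f unfolding Or[OF x] S3_orientation_eq[OF x] push_frames_def by auto
    then show ?thesis
      using wedge12_S3_frame[OF lin[OF x], of "F x" x a b c] by (auto simp: contact_volume_def Let_def)
  qed
  have or: "oriented_submanifold3 (F ` S3) Or" using F Or by (rule oriented_submanifold3_image)
  show "contact_submanifold (F ` S3) Or" if "\<And>x. x \<in> S3 \<Longrightarrow> contact_volume F x > 0"
    unfolding contact_submanifold_def using S5 or
  proof (intro conjI ballI, goal_cases)
    case (3 p f)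
    obtain u v w where f: "f = (u, v, w)" by (rule prod_cases3)
    from 3 obtain x where x: "x \<in> S3" "p = F x" by blast
    from vol[OF x(1), of u v w] 3 f x obtain d where "d > 0"
      "wedge12 (alpha p) (ext_deriv1 alpha p) u v w = d * contact_volume F x" by auto
    then show ?case using that[OF x(1)] f by simp
  qed
  have skew: "wedge12 (alpha p) (ext_deriv1 alpha p) u v w = - wedge12 (alpha p) (ext_deriv1 alpha p) v u w" for p u v w
    unfolding wedge12_def ext_deriv1_alpha by (simp add: alpha_skew[of v u] algebra_simps)
  have "wedge12 (alpha (F x)) (ext_deriv1 alpha (F x)) u v w > 0"
    if neg: "\<And>x. x \<in> S3 \<Longrightarrow> contact_volume F x < 0" and x: "x \<in> S3"
      and f: "(u, v, w) \<in> reverse_orientation Or (F x)" for x u v w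
  proof -
    have "(v, u, w) \<in> Or (F x)" using f by (simp add: reverse_orientation_def)
    from vol[OF x this] obtain d where "d > 0" "wedge12 (alpha (F x)) (ext_deriv1 alpha (F x)) v u w = d * contact_volume F x"
      by blast
    then show ?thesis using neg[OF x] skew[of "F x" u v w] by (simp add: mult_pos_neg)
  qed
  then show "contact_submanifold (F ` S3) (reverse_orientation Or)" if "\<And>x. x \<in> S3 \<Longrightarrow> contact_volume F x < 0"
    unfolding contact_submanifold_def using S5 oriented_submanifold3_reverse[OF or] that by (auto simp: image_iff)
qed

section \<open>Torus-equivariant maps from the 3-sphere\<close>

definition height :: "complex^2 \<Rightarrow> real" where
  "height z = (cmod (z$1))\<^sup>2 - (cmod (z$2))\<^sup>2"

text \<open>These maps are equivariant: the rotation of \<open>(z\<^sub>1, z\<^sub>2)\<close> by angles \<open>(\<theta>\<^sub>1, \<theta>\<^sub>2)\<close> corresponds to the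
  rotation by \<open>(\<theta>\<^sub>1, \<theta>\<^sub>2, - \<theta>\<^sub>1 - \<theta>\<^sub>2)\<close>. The factor \<open>cis (height z)\<close> keeps the map an immersion where
  the three moduli have vanishing derivative, and it gives the pulled back contact form a component
  that survives on an invariant torus that is Legendrian.\<close>

definition twist :: "(real \<Rightarrow> real) \<Rightarrow> (real \<Rightarrow> real) \<Rightarrow> (real \<Rightarrow> real) \<Rightarrow> complex^2 \<Rightarrow> complex^3" where
  "twist p q r z = vector [p (height z) *\<^sub>R z$1, q (height z) *\<^sub>R z$2,
     cis (height z) * (r (height z) *\<^sub>R cnj (z$1 * z$2))]"

definition dheight :: "complex^2 \<Rightarrow> complex^2 \<Rightarrow> real" where
  "dheight z v = 2 * Re (cnj (z$1) * v$1) - 2 * Re (cnj (z$2) * v$2)"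

lemma has_derivative_height: "(height has_derivative dheight z) (at z)"
proof -
  have "height = (\<lambda>z. z$1 \<bullet> z$1 - z$2 \<bullet> z$2)"
    by (auto simp: height_def power2_norm_eq_inner)
  moreover have "((\<lambda>z::complex^2. z$1 \<bullet> z$1 - z$2 \<bullet> z$2) has_derivative
      (\<lambda>v. (z$1 \<bullet> v$1 + v$1 \<bullet> z$1) - (z$2 \<bullet> v$2 + v$2 \<bullet> z$2))) (at z)"
    by (intro has_derivative_diff has_derivative_inner bounded_linear_imp_has_derivative bounded_linear_vec_nth)
  moreover have "(\<lambda>v. (z$1 \<bullet> v$1 + v$1 \<bullet> z$1) - (z$2 \<bullet> v$2 + v$2 \<bullet> z$2)) = dheight z"
    by (auto simp: dheight_def inner_complex_def)
  ultimately show ?thesis by simp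
qed

lemma has_derivative_vector3:
  assumes "(f has_derivative f') (at x)" "(g has_derivative g') (at x)" "(h has_derivative h') (at x)"
  shows "((\<lambda>x. vector [f x, g x, h x] :: 'b::euclidean_space^3) has_derivative (\<lambda>v. vector [f' v, g' v, h' v])) (at x)"
proof -
  have *: "(vector [a, b, c] :: 'b^3) = axis 1 a + axis 2 b + axis 3 c" for a b c
    by (simp add: vec_eq_iff forall_3 axis_def)
  show ?thesis unfolding *
    by (intro has_derivative_add bounded_linear.has_derivative[OF bounded_linear_axis] assms)
qed

text \<open>The derivative of \<open>twist p q r\<close>, with \<open>p'\<close>, \<open>q'\<close>, \<open>r'\<close> in place of the derivatives of the
  coefficients.\<close>

definition dtwist where
  "dtwist p q r p' q' r' z v = (let s = height z; \<sigma> = dheight z v in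
     vector [(\<sigma> * p') *\<^sub>R z$1 + p s *\<^sub>R v$1, (\<sigma> * q') *\<^sub>R z$2 + q s *\<^sub>R v$2,
       cis s * (Complex (\<sigma> * r') (\<sigma> * r s) * cnj (z$1 * z$2) + r s *\<^sub>R cnj (v$1 * z$2 + z$1 * v$2))] :: complex^3)"

lemma has_derivative_twist:
  assumes "(p has_real_derivative p') (at (height z))" "(q has_real_derivative q') (at (height z))"
    "(r has_real_derivative r') (at (height z))"
  shows "(twist p q r has_derivative dtwist p q r p' q' r' z) (at z)"
proof -
  have R: "((\<lambda>z. f (height z)) has_derivative (\<lambda>v. dheight z v * f')) (at z)"
    if "(f has_real_derivative f') (at (height z))" for f f'
    using diff_chain_at[OF has_derivative_height that[unfolded has_field_derivative_def]]
    by (simp add: o_def mult.commute)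
  have nth: "((\<lambda>z::complex^2. z$i) has_derivative (\<lambda>v. v$i)) (at z)" for i
    by (intro bounded_linear_imp_has_derivative bounded_linear_vec_nth)
  have m: "((\<lambda>z::complex^2. cnj (z$1 * z$2)) has_derivative (\<lambda>v. cnj (v$1 * z$2 + z$1 * v$2))) (at z)"
    using bounded_linear.has_derivative[OF bounded_linear_cnj has_derivative_mult[OF nth[of 1] nth[of 2]]]
    by (simp add: algebra_simps)
  have c: "((\<lambda>z. cis (height z)) has_derivative (\<lambda>v. dheight z v *\<^sub>R (\<i> * cis (height z)))) (at z)"
    by (rule has_derivative_cis[OF has_derivative_height])
  have "(twist p q r has_derivative (\<lambda>v. vector [p (height z) *\<^sub>R v$1 + (dheight z v * p') *\<^sub>R z$1,
      q (height z) *\<^sub>R v$2 + (dheight z v * q') *\<^sub>R z$2,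
      cis (height z) * (r (height z) *\<^sub>R cnj (v$1 * z$2 + z$1 * v$2) + (dheight z v * r') *\<^sub>R cnj (z$1 * z$2))
        + (dheight z v *\<^sub>R (\<i> * cis (height z))) * (r (height z) *\<^sub>R cnj (z$1 * z$2))])) (at z)"
    unfolding twist_def
    by (intro has_derivative_vector3 has_derivative_scaleR has_derivative_mult R assms nth m c)
  also have "(\<lambda>v. vector [p (height z) *\<^sub>R v$1 + (dheight z v * p') *\<^sub>R z$1,
      q (height z) *\<^sub>R v$2 + (dheight z v * q') *\<^sub>R z$2,
      cis (height z) * (r (height z) *\<^sub>R cnj (v$1 * z$2 + z$1 * v$2) + (dheight z v * r') *\<^sub>R cnj (z$1 * z$2))
        + (dheight z v *\<^sub>R (\<i> * cis (height z))) * (r (height z) *\<^sub>R cnj (z$1 * z$2))]) = dtwist p q r p' q' r' z"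
    by (auto simp: dtwist_def Let_def fun_eq_iff vec_eq_iff forall_3 Complex_eq scaleR_conv_of_real algebra_simps)
  finally show ?thesis .
qed

lemma cis_cancel: "cnj (cis s * a) * (cis s * b) = cnj a * b"
proof -
  have "cnj (cis s) * cis s = 1" by (simp add: cis_cnj cis_mult)
  then show ?thesis by (metis (no_types, lifting) complex_cnj_mult mult.assoc mult.commute mult_1)
qed

text \<open>In polar coordinates the pulled back contact form is
  \<open>p\<^sup>2 r\<^sub>1\<^sup>2 d\<theta>\<^sub>1 + q\<^sup>2 r\<^sub>2\<^sup>2 d\<theta>\<^sub>2 + r\<^sup>2 r\<^sub>1\<^sup>2 r\<^sub>2\<^sup>2 (ds - d\<theta>\<^sub>1 - d\<theta>\<^sub>2)\<close> with \<open>s = height z\<close>.\<close>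

lemma alpha_dtwist:
  "alpha (twist p q r z) (dtwist p q r p' q' r' z v) =
     ((p (height z))\<^sup>2 - (r (height z))\<^sup>2 * (cmod (z$2))\<^sup>2) * Im (cnj (z$1) * v$1) +
     ((q (height z))\<^sup>2 - (r (height z))\<^sup>2 * (cmod (z$1))\<^sup>2) * Im (cnj (z$2) * v$2) +
     (r (height z))\<^sup>2 * (cmod (z$1))\<^sup>2 * (cmod (z$2))\<^sup>2 * dheight z v"
  unfolding alpha_eq twist_def dtwist_def Let_def vector_3 cis_cancel cmod_power2
  by (simp add: power2_eq_square algebra_simps)


lemma dheight_tangent: "z \<bullet> v = 0 \<Longrightarrow> dheight z v = 4 * Re (cnj (z$1) * v$1)"
  by (simp add: dheight_def inner_complex_vec2 algebra_simps)

text \<open>Here \<open>a'\<close> and \<open>b'\<close> stand for twice the derivatives of \<open>a\<close> and \<open>b\<close> with respect to \<open>height z = x - y\<close>,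
  if \<open>x + y = 1\<close>; the last term of each comes from \<open>y\<close> and \<open>x\<close> as functions of the height. The
  identities are polynomial and hold at every point.\<close>

lemma alpha_dtwist_frame:
  fixes x1 y1 x2 y2 p q r p' q' r' s :: real
  assumes z: "z = vector [Complex x1 y1, Complex x2 y2]"
    and s: "P (height z) = p" "Q (height z) = q" "R (height z) = r"
  defines "D \<equiv> dtwist P Q R p' q' r' z"
  defines "x \<equiv> x1 * x1 + y1 * y1" and "y \<equiv> x2 * x2 + y2 * y2"
    and "B \<equiv> x1 * y2 + y1 * x2" and "C \<equiv> x1 * x2 - y1 * y2"
  defines "a \<equiv> p * p - r * r * y" and "b \<equiv> q * q - r * r * x"
  defines "a' \<equiv> 4 * p * p' - 4 * r * r' * y + r * r" and "b' \<equiv> 4 * q * q' - 4 * r * r' * x - r * r"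
  shows "alpha (twist P Q R z) (D (S3_frame z (axis 1 1))) = a * x + b * y"
    "alpha (twist P Q R z) (D (S3_frame z (axis 2 1))) = (a - b) * B - 4 * (r * r * x * y) * C"
    "alpha (twist P Q R z) (D (S3_frame z (axis 3 1))) = - (a - b) * C - 4 * (r * r * x * y) * B"
    "alpha (D (S3_frame z (axis 2 1))) (D (S3_frame z (axis 3 1))) = x * y * (a' - b') + a * y + b * x"
    "alpha (D (S3_frame z (axis 1 1))) (D (S3_frame z (axis 3 1))) = B * (x * a' + y * b') + B * (a - b)"
    "alpha (D (S3_frame z (axis 1 1))) (D (S3_frame z (axis 2 1))) = C * (x * a' + y * b') + C * (a - b)"
proof -
  have ax: "axis 1 1 $ 1 = (1::real)" "axis 1 1 $ (2::3) = (0::real)" "axis 1 1 $ (3::3) = (0::real)"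
    "axis 2 1 $ (1::3) = (0::real)" "axis 2 1 $ (2::3) = (1::real)" "axis 2 1 $ (3::3) = (0::real)"
    "axis 3 1 $ (1::3) = (0::real)" "axis 3 1 $ (2::3) = (0::real)" "axis 3 1 $ (3::3) = (1::real)"
    by (simp_all add: axis_def)
  note S = alpha_eq twist_def D_def dtwist_def Let_def vector_3 cis_cancel s
  note T = dheight_def S3_frame_nth z vector_2 ax scaleR_zero_left scaleR_one diff_0 add_0_left add_0_right diff_0_right
  note Simp = x_def y_def B_def C_def a_def b_def a'_def b'_def complex.sel complex_cnj
    times_complex.sel plus_complex.sel minus_complex.sel uminus_complex.sel scaleR_complex.sel cnj.sel imaginary_unit.sel
    zero_complex.sel
  show "alpha (twist P Q R z) (D (S3_frame z (axis 1 1))) = a * x + b * y"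
    unfolding S unfolding T unfolding Simp by (simp add: algebra_simps)
  show "alpha (twist P Q R z) (D (S3_frame z (axis 2 1))) = (a - b) * B - 4 * (r * r * x * y) * C"
    unfolding S unfolding T unfolding Simp by (simp add: algebra_simps)
  show "alpha (twist P Q R z) (D (S3_frame z (axis 3 1))) = - (a - b) * C - 4 * (r * r * x * y) * B"
    unfolding S unfolding T unfolding Simp by (simp add: algebra_simps)
  show "alpha (D (S3_frame z (axis 2 1))) (D (S3_frame z (axis 3 1))) = x * y * (a' - b') + a * y + b * x"
    unfolding S unfolding T unfolding Simp by algebra
  show "alpha (D (S3_frame z (axis 1 1))) (D (S3_frame z (axis 3 1))) = B * (x * a' + y * b') + B * (a - b)"
    unfolding S unfolding T unfolding Simp by (simp add: algebra_simps)
  show "alpha (D (S3_frame z (axis 1 1))) (D (S3_frame z (axis 2 1))) = C * (x * a' + y * b') + C * (a - b)"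
    unfolding S unfolding T unfolding Simp by (simp add: algebra_simps)
qed


text \<open>With \<open>u = (1 + s) a / 2\<close> and \<open>v = (1 - s) b / 2\<close>, the coefficients of \<open>d\<theta>\<^sub>1\<close> and \<open>d\<theta>\<^sub>2\<close> in the pulled
  back form, the right-hand side is \<open>4 (v u' - u v')\<close>. So the contact condition says that the
  plane curve \<open>(u, v)\<close> turns strictly around the origin. The component along \<open>ds\<close> drops out.\<close>

lemma twist_contact_volume:
  fixes p q r :: "real \<Rightarrow> real"
  defines "a \<equiv> \<lambda>u. (p u)\<^sup>2 - (r u)\<^sup>2 * (1 - u) / 2" and "b \<equiv> \<lambda>u. (q u)\<^sup>2 - (r u)\<^sup>2 * (1 + u) / 2"
  assumes z: "z \<in> S3" and s: "s = height z"
    and p: "(p has_real_derivative p') (at s)" and q: "(q has_real_derivative q') (at s)"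
    and r: "(r has_real_derivative r') (at s)"
    and a': "(a has_real_derivative a') (at s)" and b': "(b has_real_derivative b') (at s)"
  shows "contact_volume (twist p q r) z = 2 * a s * b s + (1 - s\<^sup>2) * (b s * a' - a s * b')"
proof -
  define x1 y1 x2 y2 where xy: "x1 = Re (z$1)" "y1 = Im (z$1)" "x2 = Re (z$2)" "y2 = Im (z$2)"
  have zv: "z = vector [Complex x1 y1, Complex x2 y2]"
    by (simp add: xy vec_eq_iff forall_2)
  define x y where x: "x = x1 * x1 + y1 * y1" and y: "y = x2 * x2 + y2 * y2"
  have 1: "x + y = 1" using z unfolding S3_real x y xy by simp
  have sxy: "s = x - y" unfolding s height_def cmod_power2 x y xy by (simp add: power2_eq_square)
  define B C where B: "B = x1 * y2 + y1 * x2" and C: "C = x1 * x2 - y1 * y2"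
  have BC: "B * B + C * C = x * y" by (simp add: B C x y algebra_simps)
  define A2 B2 where A2: "A2 = 4 * p s * p' - 4 * r s * r' * y + r s * r s"
    and B2: "B2 = 4 * q s * q' - 4 * r s * r' * x - r s * r s"
  have y': "(1 - s) / 2 = y" and x': "(1 + s) / 2 = x" using 1 sxy by auto
  have A: "a s = p s * p s - r s * r s * y" "b s = q s * q s - r s * r s * x"
    by (simp_all add: a_def b_def power2_eq_square flip: x' y')
  have "(a has_real_derivative (2 * p s * p' - (2 * r s * r' * ((1 - s) / 2) - (r s)\<^sup>2 / 2))) (at s)"
    unfolding a_def by (rule derivative_eq_intros p r refl | simp add: power2_eq_square field_simps)+
  from DERIV_unique[OF this a'] have "A2 = 2 * a'"
    unfolding y' A2 by (simp add: power2_eq_square)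
  have "(b has_real_derivative (2 * q s * q' - (2 * r s * r' * ((1 + s) / 2) + (r s)\<^sup>2 / 2))) (at s)"
    unfolding b_def by (rule derivative_eq_intros q r refl | simp add: power2_eq_square field_simps)+
  from DERIV_unique[OF this b'] have "B2 = 2 * b'"
    unfolding x' B2 by (simp add: power2_eq_square)
  have D: "frechet_derivative (twist p q r) (at z) = dtwist p q r p' q' r' z"
    using has_derivative_twist[of p p' z q q' r r'] p q r unfolding s
    by (simp add: frechet_derivative_at[symmetric])
  let ?K = "x * A2 + y * B2 + (a s - b s)" and ?g = "r s * r s * x * y"
  note aux = alpha_dtwist_frame[where P = p and Q = q and R = r and p = "p s" and q = "q s" and r = "r s"
      and p' = p' and q' = q' and r' = r', OF zv, unfolded s[symmetric], OF refl refl refl,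
      folded x y B C, folded A2 B2 A]
  have "contact_volume (twist p q r) z = 2 * ((a s * x + b s * y) * (x * y * (A2 - B2) + a s * y + b s * x)
      - ((a s - b s) * B - 4 * ?g * C) * (B * ?K) + (- (a s - b s) * C - 4 * ?g * B) * (C * ?K))"
    unfolding contact_volume_def Let_def wedge12_def ext_deriv1_alpha D aux by algebra
  also have "\<dots> = 2 * ((a s * x + b s * y) * (x * y * (A2 - B2) + a s * y + b s * x) - (a s - b s) * (B * B + C * C) * ?K)"
    by algebra
  also have "\<dots> = 2 * a s * b s + 2 * x * y * (b s * A2 - a s * B2)"
  proof -
    have y1: "y = 1 - x" using 1 by simp
    show ?thesis unfolding BC unfolding y1 by algebra
  qed
  also have "2 * x * y * (b s * A2 - a s * B2) = (1 - s\<^sup>2) * (b s * a' - a s * b')"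
  proof -
    have "1 - s\<^sup>2 = 4 * (x * y)" unfolding x'[symmetric] y'[symmetric] by (simp add: power2_eq_square algebra_simps)
    then show ?thesis unfolding \<open>A2 = 2 * a'\<close> \<open>B2 = 2 * b'\<close> by algebra
  qed
  finally show ?thesis .
qed

lemma height_S3:
  assumes "z \<in> S3"
  shows "(cmod (z$1))\<^sup>2 = (1 + height z) / 2" "(cmod (z$2))\<^sup>2 = (1 - height z) / 2" "height z \<in> {-1..1}"
proof -
  show "(cmod (z$1))\<^sup>2 = (1 + height z) / 2" "(cmod (z$2))\<^sup>2 = (1 - height z) / 2"
    using assms unfolding S3_iff height_def by simp_all
  then have "(1 + height z) / 2 \<ge> 0" "(1 - height z) / 2 \<ge> 0" by (metis zero_le_power2)+
  then show "height z \<in> {-1..1}" by simp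
qed

lemma twist_product:
  "twist p q r z $ 1 * twist p q r z $ 2 * twist p q r z $ 3 =
    (p (height z) * q (height z) * r (height z) * (cmod (z$1 * z$2))\<^sup>2) *\<^sub>R cis (height z)"
proof -
  have "twist p q r z $ 1 * twist p q r z $ 2 * twist p q r z $ 3 =
    (p (height z) * q (height z) * r (height z)) *\<^sub>R cis (height z) * ((z$1 * z$2) * cnj (z$1 * z$2))"
    by (simp add: twist_def scaleR_conv_of_real algebra_simps)
  then show ?thesis by (simp only: complex_norm_square[symmetric]) (simp add: scaleR_conv_of_real)
qed

text \<open>The product of the three coordinates of \<open>twist p q r z\<close> has argument \<open>height z\<close>, unless it
  vanishes. As \<open>[-1, 1]\<close> is shorter than a full turn, the image point determines the height, and
  then the first two coordinates determine \<open>z\<close>.\<close>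

lemma cis_inj_height:
  assumes "c *\<^sub>R cis s = d *\<^sub>R cis t" "c > 0" "d > 0" "s \<in> {-1..1}" "t \<in> {-1..1}"
  shows "s = t"
proof -
  have "norm (c *\<^sub>R cis s) = norm (d *\<^sub>R cis t)" using assms(1) by simp
  then have "c = d" using assms(2,3) by simp
  then have "sin s = sin t" using assms(1,2) by (auto simp: complex_eq_iff)
  moreover have "\<bar>s\<bar> \<le> pi / 2" "\<bar>t\<bar> \<le> pi / 2" using assms(4,5) pi_gt3 by auto
  ultimately show ?thesis using sin_inj_pi[of s t] by (simp add: abs_le_iff)
qed

lemma inj_on_twist:
  assumes pos: "\<And>s. s \<in> {-1..1} \<Longrightarrow> p s > 0 \<and> q s > 0 \<and> r s > 0"
  shows "inj_on (twist p q r) S3"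
proof (rule inj_onI)
  fix z w assume z: "z \<in> S3" and w: "w \<in> S3" and eq: "twist p q r z = twist p q r w"
  note hz = height_S3[OF z] and hw = height_S3[OF w]
  have e1: "p (height z) *\<^sub>R z$1 = p (height w) *\<^sub>R w$1" and e2: "q (height z) *\<^sub>R z$2 = q (height w) *\<^sub>R w$2"
    using arg_cong[OF eq, of "\<lambda>x. x$1"] arg_cong[OF eq, of "\<lambda>x. x$2"] by (simp_all add: twist_def)
  note pz = pos[OF hz(3)] and pw = pos[OF hw(3)]
  have "height z = height w"
  proof (cases "z$1 * z$2 = 0")
    case True
    then consider "z$1 = 0" | "z$2 = 0" by auto
    then show ?thesis
    proof cases
      case 1
      then have "w$1 = 0" using e1 pw by auto
      then show ?thesis using hz(1) hw(1) 1 by simp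
    next
      case 2
      then have "w$2 = 0" using e2 pw by auto
      then show ?thesis using hz(2) hw(2) 2 by simp
    qed
  next
    case False
    then have "w$1 * w$2 \<noteq> 0" using e1 e2 pz by auto
    with False show ?thesis
      using pz pw hz(3) hw(3)
      by (intro cis_inj_height[OF trans[OF twist_product[of p q r z, symmetric, unfolded eq] twist_product]])
        (simp_all add: mult_pos_pos)
  qed
  then show "z = w" using e1 e2 pz by (simp add: vec_eq_iff forall_2)
qed

lemma dtwist_diff: "dtwist p q r p' q' r' z (v - w) = dtwist p q r p' q' r' z v - dtwist p q r p' q' r' z w"
  by (simp add: dtwist_def Let_def dheight_def vec_eq_iff forall_3 Complex_eq scaleR_conv_of_real algebra_simps)

text \<open>The infinitesimal version of the injectivity argument: the argument of the product of the three
  coordinates forces \<open>dheight z v = 0\<close>, except on the core circles \<open>z\<^sub>1 = 0\<close> and \<open>z\<^sub>2 = 0\<close>, where the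
  height is extremal.\<close>

lemma inj_on_dtwist:
  assumes z: "z \<in> S3" and pos: "p (height z) > 0" "q (height z) > 0" "r (height z) > 0"
  shows "inj_on (dtwist p q r p' q' r' z) (tangent_space S3 z)"
proof (rule inj_onI)
  fix v' w' assume vw: "v' \<in> tangent_space S3 z" "w' \<in> tangent_space S3 z"
    and eq: "dtwist p q r p' q' r' z v' = dtwist p q r p' q' r' z w'"
  define v where "v = v' - w'"
  let ?s = "height z" and ?\<sigma> = "dheight z v"
  have v: "z \<bullet> v = 0" using vw by (simp add: v_def tangent_space_sphere[OF z] inner_diff_right)
  have D0: "dtwist p q r p' q' r' z v = 0" using eq by (simp add: v_def dtwist_diff)
  have e1: "(?\<sigma> * p') *\<^sub>R z$1 + p ?s *\<^sub>R v$1 = 0"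
    and e2: "(?\<sigma> * q') *\<^sub>R z$2 + q ?s *\<^sub>R v$2 = 0"
    and e3: "Complex (?\<sigma> * r') (?\<sigma> * r ?s) * cnj (z$1 * z$2) + r ?s *\<^sub>R cnj (v$1 * z$2 + z$1 * v$2) = 0"
    using arg_cong[OF D0, of "\<lambda>x. x$1"] arg_cong[OF D0, of "\<lambda>x. x$2"] arg_cong[OF D0, of "\<lambda>x. x$3"]
    by (simp_all add: dtwist_def Let_def cis_neq_zero del: complex_cnj_mult complex_cnj_add)
  have "?\<sigma> = 0"
  proof (rule ccontr)
    assume \<sigma>: "?\<sigma> \<noteq> 0"
    have v1: "v$1 = (- (?\<sigma> * p' / p ?s)) *\<^sub>R z$1" and v2: "v$2 = (- (?\<sigma> * q' / q ?s)) *\<^sub>R z$2"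
      using e1 e2 pos by (simp_all add: add_eq_0_iff2 field_simps scaleR_conv_of_real)
    define k where "k = - (?\<sigma> * p' / p ?s) - ?\<sigma> * q' / q ?s"
    have "v$1 * z$2 + z$1 * v$2 = k *\<^sub>R (z$1 * z$2)"
      unfolding v1 v2 k_def by (simp add: scaleR_conv_of_real algebra_simps)
    with e3 have "(Complex (?\<sigma> * r') (?\<sigma> * r ?s) + of_real (r ?s * k)) * cnj (z$1 * z$2) = 0"
      by (simp add: scaleR_conv_of_real algebra_simps)
    moreover have "Im (Complex (?\<sigma> * r') (?\<sigma> * r ?s) + of_real (r ?s * k)) \<noteq> 0" using \<sigma> pos by simp
    ultimately have "z$1 = 0 \<or> z$2 = 0"
      by (metis complex_cnj_zero_iff mult_eq_0_iff zero_complex.simps(2))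
    then show False
    proof
      assume "z$1 = 0"
      then show False using dheight_tangent[OF v] \<sigma> by simp
    next
      assume "z$2 = 0"
      then have "v$2 = 0" using v2 by simp
      then show False using \<open>z$2 = 0\<close> v \<sigma> by (simp add: dheight_def inner_complex_vec2)
    qed
  qed
  then have "v = 0" using e1 e2 pos by (simp add: vec_eq_iff forall_2)
  then show "v' = w'" by (simp add: v_def)
qed

section \<open>The deformation of the standard 3-sphere\<close>

text \<open>With \<open>v = s (2 - s)\<close> this is \<open>v\<^sup>2 exp (- 1 / v)\<close> for \<open>s > 0\<close>. It is flat at \<open>0\<close>, so that
  \<open>(ramp s, ramp (- s))\<close> runs smoothly around the corner of the two positive half axes; it is
  positive at \<open>1\<close>; and \<open>2 (1 - s) / ramp s\<close> has the elementary primitive \<open>- exp (1 / v)\<close>, which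
  makes the leaves explicit at \<open>t = 1\<close>.\<close>

definition ramp :: "real \<Rightarrow> real" where
  "ramp s = (s * (2 - s))\<^sup>2 * flat (s * (2 - s))"

definition dramp :: "real \<Rightarrow> real" where
  "dramp s = 2 * (1 - s) * (2 * (s * (2 - s)) * flat (s * (2 - s)) + (s * (2 - s))\<^sup>2 * flat_pow 2 (s * (2 - s)))"

lemma ramp_derivative: "(ramp has_real_derivative dramp s) (at s)"
proof -
  have f: "(flat has_real_derivative flat_pow 2 v) (at v)" for v
    using flat_pow_derivative[of 0 v] by (simp add: flat_eq numeral_2_eq_2)
  have v: "((\<lambda>s. s * (2 - s)) has_real_derivative 2 * (1 - s)) (at s)"
    by (auto intro!: derivative_eq_intros simp: algebra_simps)
  have "((\<lambda>v. v\<^sup>2 * flat v) has_real_derivative 2 * w * flat w + w\<^sup>2 * flat_pow 2 w) (at w)" for w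
    by (auto intro!: derivative_eq_intros f)
  from DERIV_chain2[OF this v] show ?thesis
    by (simp add: ramp_def[abs_def] dramp_def mult.commute)
qed

lemma flat_pow_nonneg: "flat_pow m x \<ge> 0"
  by (simp add: flat_pow_def)

lemma ramp_nonneg: "ramp s \<ge> 0"
  by (simp add: ramp_def flat_nonneg)

lemma ramp_nonpos_eq_0: "s \<le> 0 \<Longrightarrow> ramp s = 0" "s \<le> 0 \<Longrightarrow> dramp s = 0"
proof -
  assume "s \<le> 0"
  then have "s * (2 - s) \<le> 0" by (simp add: mult_nonpos_nonneg)
  then show "ramp s = 0" "dramp s = 0" by (auto simp: ramp_def dramp_def flat_def flat_pow_def)
qed

lemma ramp_pos: "s > 0 \<Longrightarrow> s < 2 \<Longrightarrow> ramp s > 0"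
  by (simp add: ramp_def flat_pos)

lemma dramp_nonneg: "s \<le> 1 \<Longrightarrow> dramp s \<ge> 0"
proof -
  have "v * flat v \<ge> 0" for v by (cases "v > 0") (auto simp: flat_def)
  then have "(s * (2 - s)) * flat (s * (2 - s)) \<ge> 0" .
  then have "0 \<le> 2 * ((s * (2 - s)) * flat (s * (2 - s))) + (s * (2 - s))\<^sup>2 * flat_pow 2 (s * (2 - s))"
    by (simp only: add_nonneg_nonneg mult_nonneg_nonneg flat_pow_nonneg zero_le_power2 zero_le_numeral)
  moreover assume "s \<le> 1"
  ultimately show ?thesis unfolding dramp_def mult.assoc[of 2 "s * (2 - s)"] by (simp del: mult_le_0_iff)
qed

lemma C_inf_ramp [C_inf_intros]: "C_inf U f \<Longrightarrow> C_inf U (\<lambda>x. ramp (f x))"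
  unfolding ramp_def using C_inf_open by (intro C_inf_intros) auto

text \<open>Up to a positive factor, \<open>coef t s\<close> and \<open>coef t (- s)\<close> are the coefficients \<open>a\<close> and \<open>b\<close> of the contact
  form pulled back to the 3-sphere. The term \<open>flat (1 - t)\<close> moves the curve \<open>(a, b)\<close> off the corner
  into the first quadrant for \<open>t < 1\<close>, the last term moves it to the other side of the origin for
  \<open>t > 1\<close>, and both are flat at \<open>t = 1\<close>. The summand with \<open>2 s\<close> makes the curve turn in the right
  direction at \<open>s = 0\<close>, where \<open>ramp\<close> is constant to all orders.\<close>

definition coef :: "real \<Rightarrow> real \<Rightarrow> real" where
  "coef t s = t * ramp s + flat (1 - t) - flat (t - 1) * (1 - 2 * s)"

text \<open>The square of \<open>p\<close> before normalization, solved from \<open>a = p\<^sup>2 - r\<^sup>2 (1 - s) / 2\<close> with \<open>r = 2 t\<close>. For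
  \<open>t > 1\<close> this \<open>r\<close> is large enough to compensate the negative values of \<open>a\<close>.\<close>

definition coef_sum :: "real \<Rightarrow> real \<Rightarrow> real" where
  "coef_sum t s = 2 * t\<^sup>2 * (1 - s) + coef t s"

text \<open>The squared norm of the image point before normalization.\<close>

definition fnorm :: "real \<Rightarrow> real \<Rightarrow> real" where
  "fnorm t s = coef_sum t s * (1 + s) / 2 + coef_sum t (- s) * (1 - s) / 2 + t\<^sup>2 * (1 - s\<^sup>2)"

definition fam_p :: "real \<Rightarrow> real \<Rightarrow> real" where
  "fam_p t s = sqrt (coef_sum t s / fnorm t s)"

definition fam_r :: "real \<Rightarrow> real \<Rightarrow> real" where
  "fam_r t s = 2 * t / sqrt (fnorm t s)"

definition fam :: "real \<Rightarrow> complex^2 \<Rightarrow> complex^3" where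
  "fam t = twist (fam_p t) (\<lambda>s. fam_p t (- s)) (fam_r t)"

lemma coef_sum_pos:
  assumes "t \<ge> 0" "s \<in> {-1..1}"
  shows "coef_sum t s > 0"
proof -
  have s: "1 - s \<ge> 0" using assms by simp
  have tr: "t * ramp s \<ge> 0" using assms ramp_nonneg by simp
  consider "t < 1" | "t = 1" | "t > 1" by linarith
  then show ?thesis
  proof cases
    case 1
    then have "flat (1 - t) > 0" "flat (t - 1) = 0" by (auto intro: flat_pos flat_nonpos)
    moreover have "2 * t\<^sup>2 * (1 - s) \<ge> 0" using s by simp
    moreover have "coef_sum t s = 2 * t\<^sup>2 * (1 - s) + t * ramp s + flat (1 - t)"
      using \<open>flat (t - 1) = 0\<close> by (simp add: coef_sum_def coef_def)
    ultimately show ?thesis using tr by linarith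
  next
    case 2
    show ?thesis
    proof (cases "s = 1")
      case True
      then show ?thesis using ramp_pos[of 1] by (simp add: 2 coef_sum_def coef_def flat_nonpos)
    next
      case False
      then have "1 - s > 0" using s by simp
      then show ?thesis using tr by (simp add: 2 coef_sum_def coef_def flat_nonpos)
    qed
  next
    case 3
    define e where "e = flat (t - 1)"
    have e: "e > 0" "e < 1" using 3 flat_pos[of "t - 1"] flat_less_1 by (auto simp: e_def)
    have "t\<^sup>2 \<ge> 1" using 3 by simp
    \<comment> \<open>the third coefficient outweighs the negative part of \<open>coef t s\<close>\<close>
    then have "2 * t\<^sup>2 - 2 * e > 0" using e by linarith
    then have "(2 * t\<^sup>2 - 2 * e) * (1 - s) + e > 0" using s e by (simp add: add_nonneg_pos)
    moreover have "coef_sum t s = (2 * t\<^sup>2 - 2 * e) * (1 - s) + e + t * ramp s"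
      using 3 by (simp add: coef_sum_def coef_def e_def flat_nonpos algebra_simps)
    ultimately show ?thesis using tr by linarith
  qed
qed

lemma fnorm_pos:
  assumes "t \<ge> 0" "s \<in> {-1..1}"
  shows "fnorm t s > 0"
proof -
  have "coef_sum t s > 0" "coef_sum t (- s) > 0" using assms coef_sum_pos by auto
  moreover have "s\<^sup>2 \<le> 1" using assms(2) by (simp add: abs_square_le_1 abs_le_iff)
  then have "t\<^sup>2 * (1 - s\<^sup>2) \<ge> 0" by simp
  moreover have "1 + s > 0 \<or> 1 - s > 0" "1 + s \<ge> 0" "1 - s \<ge> 0" using assms(2) by auto
  ultimately show ?thesis unfolding fnorm_def
    by (smt (verit) divide_pos_pos mult_nonneg_nonneg mult_pos_pos divide_nonneg_pos)
qed

lemma fnorm_minus: "fnorm t (- s) = fnorm t s"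
  by (simp add: fnorm_def)

lemma fam_p_pos: "t \<ge> 0 \<Longrightarrow> s \<in> {-1..1} \<Longrightarrow> fam_p t s > 0"
  and fam_r_pos: "t > 0 \<Longrightarrow> s \<in> {-1..1} \<Longrightarrow> fam_r t s > 0"
  by (simp_all add: fam_p_def fam_r_def coef_sum_pos fnorm_pos)

subsection \<open>Smoothness\<close>

lemma C_inf_coef_sum:
  "C_inf U f \<Longrightarrow> C_inf U g \<Longrightarrow> C_inf U (\<lambda>x. coef_sum (f x) (g x))"
  unfolding coef_sum_def coef_def using C_inf_open by (intro C_inf_intros) auto

lemma C_inf_fnorm:
  "C_inf U f \<Longrightarrow> C_inf U g \<Longrightarrow> C_inf U (\<lambda>x. fnorm (f x) (g x))"
  unfolding fnorm_def using C_inf_open by (intro C_inf_intros C_inf_coef_sum) auto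

definition fam_dom :: "(real \<times> real) set" where
  "fam_dom = {(t, s). coef_sum t s > 0 \<and> coef_sum t (- s) > 0 \<and> fnorm t s > 0}"

lemma open_fam_dom: "open fam_dom"
proof -
  have "continuous_on UNIV (\<lambda>x::real \<times> real. coef_sum (fst x) (snd x))"
    "continuous_on UNIV (\<lambda>x::real \<times> real. coef_sum (fst x) (- snd x))"
    "continuous_on UNIV (\<lambda>x::real \<times> real. fnorm (fst x) (snd x))"
    by (intro C_inf_continuous C_inf_coef_sum C_inf_fnorm C_inf_intros open_UNIV)+
  then have "open {x. coef_sum (fst x) (snd x) > 0 \<and> coef_sum (fst x) (- snd x) > 0 \<and> fnorm (fst x) (snd x) > 0}"
    by (intro open_Collect_conj open_Collect_less continuous_on_const)
  moreover have "fam_dom = {x. coef_sum (fst x) (snd x) > 0 \<and> coef_sum (fst x) (- snd x) > 0 \<and> fnorm (fst x) (snd x) > 0}"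
    by (auto simp: fam_dom_def)
  ultimately show ?thesis by simp
qed

lemma C_inf_fam_p:
  assumes "C_inf U f" "C_inf U g" "\<And>x. x \<in> U \<Longrightarrow> (f x, g x) \<in> fam_dom"
  shows "C_inf U (\<lambda>x. fam_p (f x) (g x))" "C_inf U (\<lambda>x. fam_p (f x) (- g x))" "C_inf U (\<lambda>x. fam_r (f x) (g x))"
proof -
  have *: "coef_sum (f x) (g x) > 0" "coef_sum (f x) (- g x) > 0" "fnorm (f x) (g x) > 0" if "x \<in> U" for x
    using assms(3)[OF that] by (auto simp: fam_dom_def)
  show "C_inf U (\<lambda>x. fam_p (f x) (g x))" unfolding fam_p_def
    by (intro C_inf_intros C_inf_coef_sum C_inf_fnorm assms(1,2) divide_pos_pos *) (use *(3) in force)+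
  show "C_inf U (\<lambda>x. fam_p (f x) (- g x))" unfolding fam_p_def fnorm_minus
    by (intro C_inf_intros C_inf_coef_sum C_inf_fnorm assms(1,2) divide_pos_pos *) (use *(3) in force)+
  show "C_inf U (\<lambda>x. fam_r (f x) (g x))" unfolding fam_r_def
    by (intro C_inf_intros C_inf_fnorm assms(1,2) C_inf_open[OF assms(1)] *) (use *(3) in force)+
qed

lemma C_inf_height: "C_inf U f \<Longrightarrow> C_inf U (\<lambda>x. height (f x))"
  unfolding height_def by (intro C_inf_intros)

lemma C_inf_fam:
  assumes f: "C_inf U f" and g: "C_inf U g" and "\<And>x. x \<in> U \<Longrightarrow> (f x, height (g x)) \<in> fam_dom"
  shows "C_inf U (\<lambda>x. fam (f x) (g x))"
  unfolding fam_def twist_def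
  by (intro C_inf_intros C_inf_fam_p C_inf_height assms C_inf_open[OF f])

lemma fam_dom_S3: "t \<ge> 0 \<Longrightarrow> z \<in> S3 \<Longrightarrow> (t, height z) \<in> fam_dom"
  using height_S3(3)[of z] coef_sum_pos fnorm_pos by (auto simp: fam_dom_def)

lemma smooth_on_fam: "smooth_on ({0..<3/2} \<times> S3) (\<lambda>(t, z). fam t z)"
proof -
  let ?g = "\<lambda>x :: real \<times> (complex^2). (fst x, height (snd x))"
  have g: "C_inf UNIV ?g" by (intro C_inf_intros C_inf_height open_UNIV)
  then have "open (?g -` fam_dom)"
    using continuous_open_preimage[OF C_inf_continuous open_UNIV open_fam_dom] by fastforce
  then have "C_inf (?g -` fam_dom) (\<lambda>x. fam (fst x) (snd x))"
    by (intro C_inf_fam C_inf_intros) auto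
  then show ?thesis
    unfolding case_prod_unfold by (rule smooth_onI) (use fam_dom_S3 in auto)
qed

lemma smooth_on_fam_t: "t \<ge> 0 \<Longrightarrow> smooth_on S3 (fam t)"
proof -
  assume t: "t \<ge> 0"
  have g: "C_inf UNIV (\<lambda>z. (t, height z))" by (intro C_inf_intros C_inf_height open_UNIV)
  then have "open ((\<lambda>z. (t, height z)) -` fam_dom)"
    using continuous_open_preimage[OF C_inf_continuous open_UNIV open_fam_dom] by fastforce
  then have "C_inf ((\<lambda>z. (t, height z)) -` fam_dom) (fam t)"
    by (intro C_inf_fam C_inf_intros) auto
  then show ?thesis by (rule smooth_onI) (use fam_dom_S3[OF t] in auto)
qed

subsection \<open>Embeddedness\<close>

lemma fam_coef_derivatives:
  assumes "(t, s) \<in> fam_dom"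
  obtains p' q' r' where "(fam_p t has_real_derivative p') (at s)"
    "((\<lambda>s. fam_p t (- s)) has_real_derivative q') (at s)" "(fam_r t has_real_derivative r') (at s)"
proof -
  have "C_inf UNIV (\<lambda>s::real. (t, s))" by (intro C_inf_intros open_UNIV)
  then have O: "open ((\<lambda>s. (t, s)) -` fam_dom)"
    using continuous_open_preimage[OF C_inf_continuous open_UNIV open_fam_dom] by fastforce
  have "C_inf ((\<lambda>s. (t, s)) -` fam_dom) (\<lambda>s. fam_p t s)" "C_inf ((\<lambda>s. (t, s)) -` fam_dom) (\<lambda>s. fam_p t (- s))"
    "C_inf ((\<lambda>s. (t, s)) -` fam_dom) (\<lambda>s. fam_r t s)"
    by (intro C_inf_fam_p C_inf_intros O; simp)+
  from this[THEN C_inf_derivative, of s] show ?thesis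
    using assms that by (metis has_real_derivative vimageI)
qed

lemma fam_derivative:
  assumes "t \<ge> 0" "z \<in> S3"
  obtains p' q' r' where "frechet_derivative (fam t) (at z) = dtwist (fam_p t) (\<lambda>s. fam_p t (- s)) (fam_r t) p' q' r' z"
  using fam_coef_derivatives[OF fam_dom_S3[OF assms]] has_derivative_twist frechet_derivative_at
  unfolding fam_def by metis

text \<open>At \<open>t = 0\<close> the third coefficient vanishes, and so does the ramp because of the factor \<open>t\<close>. The first
  two are equal constants, which the normalization makes \<open>1\<close>.\<close>

lemma fam_0: "fam 0 = incl"
proof -
  have "flat 1 > 0" "flat (-1) = 0" by (auto intro: flat_pos flat_nonpos)
  then show ?thesis
    by (auto simp: fun_eq_iff fam_def twist_def incl_def fam_p_def fam_r_def fnorm_def coef_sum_def coef_def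
        field_simps vec_eq_iff forall_3)
qed

lemma C_inf_incl: "C_inf UNIV incl"
  unfolding incl_def by (intro C_inf_intros open_UNIV)

lemma smooth_embedding_fam:
  assumes t: "t \<ge> 0"
  shows "smooth_embedding (tangent_space S3) S3 (fam t)"
proof (cases "t = 0")
  case True
  have "C_inf UNIV (\<lambda>w::complex^3. vector [w$1, w$2] :: complex^2)" by (intro C_inf_intros open_UNIV)
  then show ?thesis unfolding True fam_0
    by (rule smooth_embedding_left_inverse[OF C_inf_incl subset_UNIV])
      (auto simp: incl_def vec_eq_iff forall_2)
next
  case False
  then have t0: "t > 0" using t by simp
  have pos: "fam_p t s > 0 \<and> fam_p t (- s) > 0 \<and> fam_r t s > 0" if "s \<in> {-1..1}" for s
    using that t0 by (simp add: fam_p_pos fam_r_pos)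
  have inj: "inj_on (fam t) S3" unfolding fam_def by (rule inj_on_twist) (use pos in auto)
  have "inj_on (frechet_derivative (fam t) (at z)) (tangent_space S3 z)" if z: "z \<in> S3" for z
    using inj_on_dtwist[OF z, of "fam_p t" "\<lambda>s. fam_p t (- s)" "fam_r t"] pos[OF height_S3(3)[OF z]]
    by (metis fam_derivative[OF t z])
  moreover have "\<exists>g. homeomorphism S3 (fam t ` S3) (fam t) g"
    by (rule homeomorphism_compact[OF compact_sphere smooth_on_continuous[OF smooth_on_fam_t[OF t]] refl inj])
  ultimately show ?thesis
    using smooth_on_fam_t[OF t] inj by (simp add: smooth_embedding_def injective_immersion_def)
qed

lemma fam_S5:
  assumes t: "t \<ge> 0" and z: "z \<in> S3"
  shows "fam t z \<in> S5"
proof -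
  let ?s = "height z"
  note h = height_S3[OF z]
  note pos = coef_sum_pos[OF t h(3)] fnorm_pos[OF t h(3)]
  have pos': "coef_sum t (- ?s) > 0" using coef_sum_pos[OF t, of "- ?s"] h(3) by simp
  have "(norm (fam t z))\<^sup>2 = (fam_p t ?s)\<^sup>2 * (cmod (z$1))\<^sup>2 + (fam_p t (- ?s))\<^sup>2 * (cmod (z$2))\<^sup>2
      + (fam_r t ?s)\<^sup>2 * ((cmod (z$1))\<^sup>2 * (cmod (z$2))\<^sup>2)"
    by (simp add: norm_vec_def L2_set_def sum_3 fam_def twist_def)
      (simp add: norm_mult power_mult_distrib)
  also have "\<dots> = (coef_sum t ?s * ((1 + ?s) / 2) + coef_sum t (- ?s) * ((1 - ?s) / 2)
      + 4 * t\<^sup>2 * ((1 + ?s) / 2 * ((1 - ?s) / 2))) / fnorm t ?s"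
    unfolding h(1,2) using pos pos'
    by (simp add: fam_p_def fam_r_def fnorm_minus power_divide power_mult_distrib add_divide_distrib)
  also have "coef_sum t ?s * ((1 + ?s) / 2) + coef_sum t (- ?s) * ((1 - ?s) / 2)
      + 4 * t\<^sup>2 * ((1 + ?s) / 2 * ((1 - ?s) / 2)) = fnorm t ?s"
    by (simp add: fnorm_def power2_eq_square field_simps)
  also have "fnorm t ?s / fnorm t ?s = 1" using pos(2) by simp
  finally show ?thesis by (simp add: power2_eq_1_iff) (smt (verit) norm_ge_zero)
qed


subsection \<open>The contact condition\<close>

definition dcoef :: "real \<Rightarrow> real \<Rightarrow> real" where
  "dcoef t s = t * dramp s + 2 * flat (t - 1)"

lemma coef_derivative: "(coef t has_real_derivative dcoef t s) (at s)"
  unfolding coef_def[abs_def] dcoef_def by (auto intro!: derivative_eq_intros ramp_derivative)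

text \<open>The sign of \<open>v u' - u v'\<close> does not change when the plane curve is multiplied by a positive
  function, so the normalization by \<open>fnorm\<close> only contributes the factor \<open>d\<close>.\<close>

lemma fam_contact_volume:
  assumes t: "t \<ge> 0" and z: "z \<in> S3" and s: "s = height z"
  obtains d where "d > 0" "contact_volume (fam t) z =
    d * (2 * coef t s * coef t (- s) + (1 - s\<^sup>2) * (coef t (- s) * dcoef t s + coef t s * dcoef t (- s)))"
proof -
  have dom: "(t, s) \<in> fam_dom" using fam_dom_S3[OF t z] s by simp
  obtain p' q' r' where d: "(fam_p t has_real_derivative p') (at s)"
    "((\<lambda>s. fam_p t (- s)) has_real_derivative q') (at s)" "(fam_r t has_real_derivative r') (at s)"
    using fam_coef_derivatives[OF dom] by blast
  let ?n = "fnorm t"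
  have "C_inf UNIV ?n" by (intro C_inf_fnorm C_inf_intros open_UNIV)
  from C_inf_derivative[OF this UNIV_I] obtain n' where n': "(?n has_real_derivative n') (at s)"
    by (metis has_real_derivative)
  have n: "?n s > 0" using dom by (simp add: fam_dom_def)
  have dm: "((\<lambda>s. coef t (- s)) has_real_derivative - dcoef t (- s)) (at s)"
    using DERIV_chain2[OF coef_derivative DERIV_minus[OF DERIV_ident], of t s UNIV] by simp
  define Om where "Om = (\<lambda>u. (t, u)) -` fam_dom"
  have "C_inf UNIV (\<lambda>s::real. (t, s))" by (intro C_inf_intros open_UNIV)
  then have Om: "open Om" "s \<in> Om"
    using continuous_open_preimage[OF C_inf_continuous open_UNIV open_fam_dom] dom by (fastforce simp: Om_def)+
  have a: "(fam_p t u)\<^sup>2 - (fam_r t u)\<^sup>2 * (1 - u) / 2 = coef t u / ?n u"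
    and b: "(fam_p t (- u))\<^sup>2 - (fam_r t u)\<^sup>2 * (1 + u) / 2 = coef t (- u) / ?n u" if "u \<in> Om" for u
    using that by (auto simp: Om_def fam_dom_def fam_p_def fam_r_def fnorm_minus power_divide power_mult_distrib
        coef_sum_def divide_simps) 
  have a': "((\<lambda>u. (fam_p t u)\<^sup>2 - (fam_r t u)\<^sup>2 * (1 - u) / 2) has_real_derivative
      (dcoef t s * ?n s - coef t s * n') / (?n s * ?n s)) (at s)"
    by (rule has_field_derivative_transform_within_open[OF DERIV_divide[OF coef_derivative n'] Om])
      (use n a in auto)
  have b': "((\<lambda>u. (fam_p t (- u))\<^sup>2 - (fam_r t u)\<^sup>2 * (1 + u) / 2) has_real_derivative
      (- dcoef t (- s) * ?n s - coef t (- s) * n') / (?n s * ?n s)) (at s)"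
    by (rule has_field_derivative_transform_within_open[OF DERIV_divide[OF dm n'] Om])
      (use n b in auto)
  have "contact_volume (fam t) z = 2 * (coef t s / ?n s) * (coef t (- s) / ?n s)
      + (1 - s\<^sup>2) * ((coef t (- s) / ?n s) * ((dcoef t s * ?n s - coef t s * n') / (?n s * ?n s))
        - (coef t s / ?n s) * ((- dcoef t (- s) * ?n s - coef t (- s) * n') / (?n s * ?n s)))"
    using twist_contact_volume[OF z s d a' b'] unfolding a[OF Om(2)] b[OF Om(2)] fam_def .
  also have "\<dots> = (1 / (?n s)\<^sup>2) * (2 * coef t s * coef t (- s)
      + (1 - s\<^sup>2) * (coef t (- s) * dcoef t s + coef t s * dcoef t (- s)))"
    using n by (simp add: power2_eq_square divide_simps) (simp add: algebra_simps)
  finally show ?thesis using n by (intro that[of "1 / (?n s)\<^sup>2"]) auto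
qed

text \<open>For \<open>t < 1\<close> both coefficients are positive, and they are monotone in opposite directions.\<close>

lemma contact_sign_pos:
  assumes t: "0 \<le> t" "t < 1" and s: "s \<in> {-1..1}"
  shows "2 * coef t s * coef t (- s) + (1 - s\<^sup>2) * (coef t (- s) * dcoef t s + coef t s * dcoef t (- s)) > 0"
proof -
  have 0: "flat (t - 1) = 0" "flat (1 - t) > 0" using t by (auto intro: flat_nonpos flat_pos)
  have c: "coef t u > 0" for u using 0 t(1) ramp_nonneg[of u] by (simp add: coef_def add_nonneg_pos)
  have "dcoef t s \<ge> 0" "dcoef t (- s) \<ge> 0" using 0 t s dramp_nonneg by (auto simp: dcoef_def)
  moreover have "1 - s\<^sup>2 \<ge> 0" using s by (simp add: abs_square_le_1 abs_le_iff)
  ultimately have "(1 - s\<^sup>2) * (coef t (- s) * dcoef t s + coef t s * dcoef t (- s)) \<ge> 0"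
    using c[of s] c[of "- s"] by simp
  then show ?thesis using c[of s] c[of "- s"] by (simp add: add_pos_nonneg)
qed

text \<open>The expression is even in \<open>s\<close>. For \<open>s \<ge> 0\<close> the ramp does not contribute to the second coefficient, which
  is \<open>- e (1 + 2 s)\<close> with \<open>e = flat (t - 1)\<close>. Then \<open>- e\<close> can be factored out; what remains is positive because the
  terms of the ramp enter with nonnegative coefficients.\<close>

lemma contact_sign_neg:
  assumes t: "1 < t" and s: "s \<in> {-1..1}"
  shows "2 * coef t s * coef t (- s) + (1 - s\<^sup>2) * (coef t (- s) * dcoef t s + coef t s * dcoef t (- s)) < 0"
proof -
  have *: "2 * coef t s * coef t (- s) + (1 - s\<^sup>2) * (coef t (- s) * dcoef t s + coef t s * dcoef t (- s)) < 0"
    if s: "0 \<le> s" "s \<le> 1" for s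
  proof -
    define e where "e = flat (t - 1)"
    have e: "e > 0" using t by (simp add: e_def flat_pos)
    have f1: "flat (1 - t) = 0" using t by (simp add: flat_nonpos)
    define A D where "A = t * ramp s" and "D = t * dramp s"
    have A: "A \<ge> 0" "D \<ge> 0" using t s ramp_nonneg dramp_nonneg by (auto simp: A_def D_def)
    have c: "coef t s = A - e * (1 - 2 * s)" "coef t (- s) = - e * (1 + 2 * s)"
      "dcoef t s = D + 2 * e" "dcoef t (- s) = 2 * e"
      using s ramp_nonpos_eq_0[of "- s"] by (simp_all add: coef_def dcoef_def f1 e_def A_def D_def)
    have ss: "1 - s\<^sup>2 \<ge> 0" using s by (simp add: abs_square_le_1)
    have "2 * coef t s * coef t (- s) + (1 - s\<^sup>2) * (coef t (- s) * dcoef t s + coef t s * dcoef t (- s))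
      = - e * (2 * A * (2 * s + s\<^sup>2) + (1 - s\<^sup>2) * (1 + 2 * s) * D + 2 * e * (1 + 2 * s\<^sup>2))"
      unfolding c by algebra
    moreover have "2 * A * (2 * s + s\<^sup>2) + (1 - s\<^sup>2) * (1 + 2 * s) * D + 2 * e * (1 + 2 * s\<^sup>2) > 0"
    proof -
      have "2 * A * (2 * s + s\<^sup>2) \<ge> 0" "(1 - s\<^sup>2) * (1 + 2 * s) * D \<ge> 0" using A ss s by simp_all
      moreover have "2 * e * (1 + 2 * s\<^sup>2) > 0" using e by (simp add: add_pos_nonneg)
      ultimately show ?thesis by linarith
    qed
    ultimately show ?thesis using e by (simp add: mult_pos_pos)
  qed
  show ?thesis
  proof (cases "s \<ge> 0")
    case True
    then show ?thesis using * s by auto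
  next
    case False
    then show ?thesis using *[of "- s"] s by (simp add: algebra_simps)
  qed
qed

subsection \<open>The family of oriented submanifolds\<close>

definition fam_M :: "real \<Rightarrow> (complex^3) set" where
  "fam_M t = fam t ` S3"

definition fam_Or :: "real \<Rightarrow> (complex^3) orientation" where
  "fam_Or t p = (let x = inv_into S3 (fam t) p in push_frames (frechet_derivative (fam t) (at x)) (S3_orientation x))"

lemma inj_on_fam: "t \<ge> 0 \<Longrightarrow> inj_on (fam t) S3"
  using smooth_embedding_fam by (simp add: smooth_embedding_def injective_immersion_def)

lemma fam_Or_fam:
  "t \<ge> 0 \<Longrightarrow> x \<in> S3 \<Longrightarrow> fam_Or t (fam t x) = push_frames (frechet_derivative (fam t) (at x)) (S3_orientation x)"
  by (simp add: fam_Or_def Let_def inv_into_f_f[OF inj_on_fam])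

lemma smooth_S3_family_fam: "smooth_S3_family {0..<3/2} fam_M fam_Or"
  unfolding smooth_S3_family_def
  by (intro exI[of _ fam] conjI ballI smooth_on_fam)
    (auto simp: smooth_embedding_fam fam_M_def fam_S5[unfolded mem_sphere_0] fam_Or_fam)

lemma fam_M_0: "fam_M 0 = {z \<in> S5. z$3 = 0}"
proof (intro equalityI subsetI)
  fix w assume "w \<in> fam_M 0"
  then show "w \<in> {z \<in> S5. z$3 = 0}"
    using fam_S5[of 0] by (auto simp: fam_M_def fam_0 incl_def)
next
  fix w :: "complex^3" assume w: "w \<in> {z \<in> S5. z$3 = 0}"
  then have "w = incl (vector [w$1, w$2])" by (auto simp: incl_def vec_eq_iff forall_3)
  moreover have "vector [w$1, w$2] \<in> S3"
    using w by (auto simp add: S3_iff norm_vec_def L2_set_def sum_3 sum_2)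
  ultimately show "w \<in> fam_M 0" unfolding fam_M_def fam_0 by blast
qed

lemma fam_Or_0: "x \<in> S3 \<Longrightarrow> fam_Or 0 (incl x) = push_frames incl (S3_orientation x)"
proof -
  assume x: "x \<in> S3"
  have "linear incl" by (intro linearI) (auto simp: incl_def vec_eq_iff forall_3)
  then have "(incl has_derivative incl) (at x)"
    by (simp add: linear_conv_bounded_linear bounded_linear_imp_has_derivative)
  from frechet_derivative_at[OF this, symmetric] show ?thesis
    using fam_Or_fam[of 0 x] x by (simp add: fam_0)
qed

lemma contact_fam_less_1:
  assumes "0 \<le> t" "t < 1"
  shows "contact_submanifold (fam_M t) (fam_Or t)"
  unfolding fam_M_def
proof (rule contact_submanifold_image(1)[OF smooth_embedding_fam])
  fix x assume "x \<in> S3"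
  then show "contact_volume (fam t) x > 0"
    using fam_contact_volume[OF assms(1) _ refl, of x] contact_sign_pos[OF assms height_S3(3)[of x]]
    by (metis mult_pos_pos)
qed (use assms fam_S5[of t] fam_Or_fam[of t] in auto)

lemma contact_fam_greater_1:
  assumes "1 < t"
  shows "contact_submanifold (fam_M t) (reverse_orientation (fam_Or t))"
  unfolding fam_M_def
proof (rule contact_submanifold_image(2)[OF smooth_embedding_fam])
  fix x assume "x \<in> S3"
  then show "contact_volume (fam t) x < 0"
    using fam_contact_volume[of t, OF _ _ refl, of x] contact_sign_neg[OF assms height_S3(3)[of x]] assms
    by (metis less_eq_real_def less_trans mult_pos_neg zero_less_one)
qed (use assms fam_S5[of t] fam_Or_fam[of t] in auto)

section \<open>Overtwistedness\<close>

text \<open>The contact form pulled back to the 3-sphere; compared with the form of a general twist,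
  \<open>coef_sum\<close> is eliminated in favour of \<open>coef\<close>.\<close>

lemma fam_alpha:
  assumes t: "t \<ge> 0" and z: "z \<in> S3" and s: "s = height z"
  shows "alpha (fam t z) (frechet_derivative (fam t) (at z) v) =
    (coef t s * Im (cnj (z$1) * v$1) + coef t (- s) * Im (cnj (z$2) * v$2) + t\<^sup>2 * (1 - s\<^sup>2) * dheight z v) / fnorm t s"
proof -
  obtain p' q' r' where D: "frechet_derivative (fam t) (at z) = dtwist (fam_p t) (\<lambda>s. fam_p t (- s)) (fam_r t) p' q' r' z"
    using fam_derivative[OF t z] .
  note h = height_S3[OF z, folded s]
  have pos: "coef_sum t s > 0" "coef_sum t (- s) > 0" "fnorm t s > 0"
    using fam_dom_S3[OF t z] by (auto simp: fam_dom_def s)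
  have e: "(fam_p t s)\<^sup>2 = coef_sum t s / fnorm t s" "(fam_p t (- s))\<^sup>2 = coef_sum t (- s) / fnorm t s"
    "(fam_r t s)\<^sup>2 = 4 * t\<^sup>2 / fnorm t s"
    using pos by (auto simp: fam_p_def fam_r_def fnorm_minus power_divide power_mult_distrib)
  have c: "coef_sum t s / fnorm t s - 4 * t\<^sup>2 / fnorm t s * ((1 - s) / 2) = coef t s / fnorm t s"
    "coef_sum t (- s) / fnorm t s - 4 * t\<^sup>2 / fnorm t s * ((1 + s) / 2) = coef t (- s) / fnorm t s"
    "4 * t\<^sup>2 / fnorm t s * ((1 + s) / 2) * ((1 - s) / 2) = t\<^sup>2 * (1 - s\<^sup>2) / fnorm t s"
    using pos(3) by (simp_all add: coef_sum_def divide_simps) (simp add: power2_eq_square algebra_simps)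
  show ?thesis
    unfolding D using alpha_dtwist[of "fam_p t" "\<lambda>s. fam_p t (- s)" "fam_r t" z p' q' r' v, folded s, unfolded h(1,2) e c]
    unfolding fam_def by (simp add: add_divide_distrib)
qed

text \<open>A smooth local left inverse turns curves in the image into curves in \<open>M\<close>.\<close>

lemma tangent_space_image:
  assumes F: "C_inf U F" and G: "C_inf W G" and z: "z \<in> U \<inter> M" "F z \<in> W" and MU: "M \<subseteq> U"
    and left: "\<And>x. x \<in> M \<Longrightarrow> F x \<in> W \<Longrightarrow> G (F x) = x"
    and v: "v \<in> tangent_space (F ` M) (F z)"
  obtains u where "u \<in> tangent_space M z" "v = frechet_derivative F (at z) u"
proof -
  let ?W = "W \<inter> G -` U"
  have W: "open ?W"
    using C_inf_continuous[OF G] C_inf_open[OF G] C_inf_open[OF F] by (rule continuous_open_preimage)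
  have G': "C_inf ?W G" using W by (rule C_inf_subset[OF G]) auto
  have Gz: "G (F z) = z" using left z by auto
  have Fz: "F z \<in> ?W" using z Gz by auto
  have "C_inf ?W (\<lambda>w. F (G w))" by (rule C_inf_compose[OF F G']) auto
  moreover have "F (G x) = x" if "x \<in> F ` M \<inter> ?W" for x using that left by auto
  ultimately have "frechet_derivative (\<lambda>w. F (G w)) (at (F z)) v = frechet_derivative (\<lambda>w. w) (at (F z)) v"
    by (rule tangent_space_agree[OF _ C_inf_id[OF W] Fz v])
  then have "frechet_derivative (\<lambda>w. F (G w)) (at (F z)) v = v"
    by (simp only: frechet_derivative_ident)
  moreover have "frechet_derivative (\<lambda>w. F (G w)) (at (F z)) v =
      frechet_derivative F (at (G (F z))) (frechet_derivative G (at (F z)) v)"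
    by (rule frechet_derivative_compose_smooth[OF smooth_onI[OF F order.refl] smooth_onI[OF G' order.refl] Fz])
      (use Gz z in auto)
  moreover have "frechet_derivative G (at (F z)) v \<in> tangent_space M (G (F z))"
    by (rule tangent_space_push[OF G' Fz v]) (use left in auto)
  ultimately show ?thesis using that[of "frechet_derivative G (at (F z)) v"] unfolding Gz by simp
qed

definition fam_slice :: "real \<Rightarrow> (complex^2) set" where
  "fam_slice t = {z. (t, height z) \<in> fam_dom}"

lemma C_inf_fam_t: "C_inf (fam_slice t) (fam t)"
proof -
  have g: "C_inf UNIV (\<lambda>z. (t, height z))" by (intro C_inf_intros C_inf_height open_UNIV)
  then have "open ((\<lambda>z. (t, height z)) -` fam_dom)"
    using continuous_open_preimage[OF C_inf_continuous open_UNIV open_fam_dom] by fastforce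
  moreover have "(\<lambda>z. (t, height z)) -` fam_dom = fam_slice t" by (auto simp: fam_slice_def)
  ultimately show ?thesis
    by (intro C_inf_fam C_inf_intros) (auto simp: fam_slice_def)
qed

lemma S3_fam_slice: "t \<ge> 0 \<Longrightarrow> S3 \<subseteq> fam_slice t"
  using fam_dom_S3 by (auto simp: fam_slice_def simp del: mem_sphere_0)

text \<open>Off the two core circles, the height can be read off from the argument of the product of the
  three coordinates, by a formula that makes sense on an open subset of \<open>\<complex>\<^sup>3\<close>.\<close>

lemma fam_local_inverse:
  assumes t: "t > 0" and z: "z \<in> S3" "z$1 \<noteq> 0" "z$2 \<noteq> 0"
  shows "\<exists>W G. C_inf W G \<and> fam t z \<in> W \<and> (\<forall>x\<in>S3. fam t x \<in> W \<longrightarrow> G (fam t x) = x)"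
proof -
  define m :: "complex^3 \<Rightarrow> complex" where "m w = w$1 * w$2 * w$3" for w
  define h where "h w = arctan (Im (m w) / Re (m w))" for w
  define W0 where "W0 = {w. Re (m w) > 0}"
  define W where "W = W0 \<inter> (\<lambda>w. (t, h w)) -` fam_dom"
  define G :: "complex^3 \<Rightarrow> complex^2" where
    "G w = vector [(1 / fam_p t (h w)) *\<^sub>R w$1, (1 / fam_p t (- h w)) *\<^sub>R w$2]" for w
  have "open W0" unfolding W0_def m_def by (intro open_Collect_less continuous_intros)
  then have h: "C_inf W0 h" unfolding h_def m_def
    by (intro C_inf_intros) (auto simp: W0_def m_def)
  have "C_inf W0 (\<lambda>w. (t, h w))" by (intro C_inf_intros h C_inf_open[OF h])
  from continuous_open_preimage[OF C_inf_continuous[OF this] C_inf_open[OF h] open_fam_dom]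
  have W: "open W" by (simp add: W_def)
  have hW: "C_inf W h" using W by (rule C_inf_subset[OF h]) (auto simp: W_def)
  have pos: "fam_p t (h w) > 0" "fam_p t (- h w) > 0" if "w \<in> W" for w
    using that by (auto simp: W_def fam_dom_def fam_p_def fnorm_minus)
  have G: "C_inf W G" unfolding G_def
    by (intro C_inf_intros C_inf_fam_p hW W) (use pos in \<open>force simp: W_def\<close>)+
  have m: "m (fam t x) = (fam_p t (height x) * fam_p t (- height x) * fam_r t (height x) * (cmod (x$1 * x$2))\<^sup>2) *\<^sub>R cis (height x)" for x
    unfolding m_def fam_def by (rule twist_product)
  have hh: "h (fam t x) = height x" if x: "x \<in> S3" "Re (m (fam t x)) > 0" for x
  proof -
    have s: "height x \<in> {-1..1}" by (rule height_S3(3)[OF x(1)])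
    then have c: "cos (height x) > 0" using pi_gt3 by (intro cos_gt_zero_pi) auto
    have "Im (m (fam t x)) / Re (m (fam t x)) = tan (height x)"
      using x(2) unfolding m by (auto simp: tan_def)
    then show ?thesis unfolding h_def using s pi_gt3 by (simp add: arctan_tan)
  qed
  have "Re (m (fam t z)) > 0"
  proof -
    have s: "height z \<in> {-1..1}" by (rule height_S3(3)[OF z(1)])
    then have c: "cos (height z) > 0" using pi_gt3 by (intro cos_gt_zero_pi) auto
    then show ?thesis using s z t fam_p_pos[of t "height z"] fam_p_pos[of t "- height z"] fam_r_pos[of t "height z"]
      unfolding m by (simp add: mult_pos_pos)
  qed
  then have "fam t z \<in> W" using hh[OF z(1)] fam_dom_S3[of t z] z t by (simp add: W_def W0_def del: mem_sphere_0)
  moreover have "G (fam t x) = x" if "x \<in> S3" "fam t x \<in> W" for x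
    using hh[OF that(1)] that(2) pos[OF that(2)]
    by (simp add: G_def W_def W0_def vec_eq_iff forall_2) (simp add: fam_def twist_def)
  ultimately show ?thesis using G by blast
qed

lemma tangent_space_fam_M:
  assumes t: "t > 0" and z: "z \<in> S3" "z$1 \<noteq> 0" "z$2 \<noteq> 0" and v: "v \<in> tangent_space (fam_M t) (fam t z)"
  obtains u where "u \<in> tangent_space S3 z" "v = frechet_derivative (fam t) (at z) u"
proof -
  obtain W G where G: "C_inf W G" "fam t z \<in> W" "\<And>x. x \<in> S3 \<Longrightarrow> fam t x \<in> W \<Longrightarrow> G (fam t x) = x"
    using fam_local_inverse[OF t z] by blast
  have sl: "S3 \<subseteq> fam_slice t" using S3_fam_slice[of t] t by simp
  show ?thesis
    by (rule tangent_space_image[OF C_inf_fam_t G(1) _ G(2) sl G(3) v[unfolded fam_M_def]])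
      (use z sl that in blast)+
qed

lemma fam_tangent:
  assumes t: "t \<ge> 0" and z: "z \<in> S3" and u: "u \<in> tangent_space S3 z"
  shows "frechet_derivative (fam t) (at z) u \<in> tangent_space (fam_M t) (fam t z)"
  by (rule tangent_space_push[OF C_inf_fam_t _ u]) (use S3_fam_slice[OF t] z in \<open>auto simp: fam_M_def simp del: mem_sphere_0\<close>)

text \<open>A meridian disc of the core circle \<open>z\<^sub>2 = 0\<close>, whose boundary is the circle of height \<open>1 - 2 \<mu>\<^sup>2\<close>.
  It winds along the core with slope \<open>k\<close> as a function of the height. The slope does not change the
  boundary circle up to rotation, but it allows the tangent plane there to be adjusted.\<close>

definition meridian_disc :: "real \<Rightarrow> real \<Rightarrow> complex \<Rightarrow> complex^2" where
  "meridian_disc \<mu> k w = vector [sqrt (1 - \<mu>\<^sup>2 * (cmod w)\<^sup>2) *\<^sub>R cis (k * (1 - 2 * \<mu>\<^sup>2 * (cmod w)\<^sup>2)), \<mu> *\<^sub>R w]"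

definition meridian_dom :: "real \<Rightarrow> complex set" where
  "meridian_dom \<mu> = {w. \<mu>\<^sup>2 * (cmod w)\<^sup>2 < 1}"

lemma open_meridian_dom: "open (meridian_dom \<mu>)"
  unfolding meridian_dom_def by (intro open_Collect_less continuous_intros)

lemma C_inf_meridian_disc: "C_inf (meridian_dom \<mu>) (meridian_disc \<mu> k)"
  unfolding meridian_disc_def
  by (intro C_inf_intros open_meridian_dom) (auto simp: meridian_dom_def)

lemma meridian_disc_S3: "w \<in> meridian_dom \<mu> \<Longrightarrow> meridian_disc \<mu> k w \<in> S3"
  and height_meridian_disc: "w \<in> meridian_dom \<mu> \<Longrightarrow> height (meridian_disc \<mu> k w) = 1 - 2 * \<mu>\<^sup>2 * (cmod w)\<^sup>2"
  by (simp_all add: meridian_dom_def S3_iff height_def meridian_disc_def power_mult_distrib del: mem_sphere_0 mem_sphere)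

lemma meridian_disc_derivative:
  fixes \<mu> k :: real and w v :: complex
  defines "z \<equiv> meridian_disc \<mu> k w" and "u \<equiv> frechet_derivative (meridian_disc \<mu> k) (at w) v"
  assumes w: "w \<in> meridian_dom \<mu>"
  shows "u \<in> tangent_space S3 z" "u$2 = \<mu> *\<^sub>R v" "Im (cnj (z$1) * u$1) = (cmod (z$1))\<^sup>2 * k * dheight z u"
proof -
  note C = C_inf_meridian_disc[of \<mu> k]
  note O = open_meridian_dom[of \<mu>]
  have D: "(meridian_disc \<mu> k has_derivative frechet_derivative (meridian_disc \<mu> k) (at w)) (at w)"
    by (rule C_inf_derivative[OF C w])
  show "u \<in> tangent_space S3 z" unfolding u_def z_def
    by (rule tangent_space_push[OF C w, of _ "meridian_dom \<mu>"])
      (use tangent_space_open[OF O w] meridian_disc_S3 in \<open>auto simp del: mem_sphere_0\<close>)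
  have nth: "((\<lambda>w. meridian_disc \<mu> k w $ i) has_derivative (\<lambda>v. frechet_derivative (meridian_disc \<mu> k) (at w) v $ i)) (at w)" for i
    by (rule bounded_linear.has_derivative[OF bounded_linear_vec_nth D])
  have "((\<lambda>w. meridian_disc \<mu> k w $ 2) has_derivative (\<lambda>v. \<mu> *\<^sub>R v)) (at w)"
    unfolding meridian_disc_def by (auto intro!: derivative_eq_intros)
  from has_derivative_unique[OF nth this] show "u$2 = \<mu> *\<^sub>R v"
    unfolding u_def by metis
  let ?h = "\<lambda>w. 1 - 2 * \<mu>\<^sup>2 * (cmod w)\<^sup>2"
  have "((\<lambda>w. height (meridian_disc \<mu> k w)) has_derivative (\<lambda>v. dheight z (frechet_derivative (meridian_disc \<mu> k) (at w) v))) (at w)"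
    using diff_chain_at[OF D has_derivative_height] by (simp add: o_def z_def)
  then have h: "(?h has_derivative (\<lambda>v. dheight z (frechet_derivative (meridian_disc \<mu> k) (at w) v))) (at w)"
    by (rule has_derivative_transform_within_open[OF _ O w]) (rule height_meridian_disc)
  let ?g = "\<lambda>w. sqrt (1 - \<mu>\<^sup>2 * (cmod w)\<^sup>2)"
  have "C_inf (meridian_dom \<mu>) ?g" by (intro C_inf_intros O) (auto simp: meridian_dom_def)
  then obtain g' where g: "(?g has_derivative g') (at w)" using C_inf_derivative w by blast
  have kh: "((\<lambda>w. k * ?h w) has_derivative (\<lambda>v. k * dheight z (frechet_derivative (meridian_disc \<mu> k) (at w) v))) (at w)"
    by (rule has_derivative_mult_right[OF h])
  have "((\<lambda>w. meridian_disc \<mu> k w $ 1) has_derivative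
      (\<lambda>v. ?g w *\<^sub>R ((k * dheight z (frechet_derivative (meridian_disc \<mu> k) (at w) v)) *\<^sub>R (\<i> * cis (k * ?h w))) + g' v *\<^sub>R cis (k * ?h w))) (at w)"
    unfolding meridian_disc_def vector_2
    by (rule has_derivative_scaleR[OF g has_derivative_cis[OF kh[unfolded meridian_disc_def]]])
  from has_derivative_unique[OF nth this]
  have u1: "u$1 = ?g w *\<^sub>R ((k * dheight z u) *\<^sub>R (\<i> * cis (k * ?h w))) + g' v *\<^sub>R cis (k * ?h w)"
    unfolding u_def by metis
  have z1: "z$1 = ?g w *\<^sub>R cis (k * ?h w)" by (simp add: z_def meridian_disc_def)
  have cc: "cos x * cos x + sin x * sin x = 1" for x :: real
    using sin_cos_squared_add2[of x] by (simp add: power2_eq_square)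
  have "Im (cnj (z$1) * u$1) = (?g w * ?g w) * (k * dheight z u) * (cos (k * ?h w) * cos (k * ?h w) + sin (k * ?h w) * sin (k * ?h w))"
    unfolding u1 z1 by (simp add: algebra_simps)
  also have "?g w * ?g w = (cmod (z$1))\<^sup>2" unfolding z1 by (simp add: power_mult_distrib flip: power2_eq_square)
  finally show "Im (cnj (z$1) * u$1) = (cmod (z$1))\<^sup>2 * k * dheight z u" unfolding cc by simp
qed

text \<open>For \<open>t > 1\<close> the curve of coefficients passes through the negative first axis: the second
  coefficient vanishes at some height \<open>s\<^sub>0\<close>, where the first is negative. The circles in direction
  \<open>\<theta>\<^sub>2\<close> at this height are Legendrian and bound meridian discs, and with the right slope
  such a disc is tangent to the contact structure along its boundary.\<close>

lemma overtwisted_fam: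
  assumes t: "1 < t"
  shows "overtwisted (fam_M t)"
proof -
  define e where "e = flat (t - 1)"
  have e: "e > 0" using t by (simp add: e_def flat_pos)
  have f1: "flat (1 - t) = 0" using t by (simp add: flat_nonpos)
  have t0: "t > 0" "t \<ge> 0" using t by auto
  \<comment> \<open>at \<open>-1/2\<close> the factor \<open>1 + 2 s\<close> vanishes and the ramp dominates; at \<open>0\<close> the ramp vanishes\<close>
  have "\<exists>s\<ge>-1/2. s \<le> 0 \<and> coef t (- s) = 0"
  proof (rule IVT2')
    have "ramp (1/2) > 0" by (rule ramp_pos) auto
    then show "0 \<le> coef t (- (-1/2))" using t0 by (simp add: coef_def f1)
    show "coef t (- 0) \<le> 0" using e by (simp add: coef_def f1 ramp_nonpos_eq_0 flip: e_def)
    have "C_inf UNIV (\<lambda>s. coef t (- s))" unfolding coef_def by (intro C_inf_intros open_UNIV)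
    then show "continuous_on {-1/2..0} (\<lambda>s. coef t (- s))"
      using C_inf_continuous continuous_on_subset by blast
  qed simp
  then obtain s0 where s0: "-1/2 \<le> s0" "s0 \<le> 0" and b0: "coef t (- s0) = 0" by blast
  have "coef t s0 = - (e * (1 - 2 * s0))" using s0 by (simp add: coef_def f1 ramp_nonpos_eq_0 e_def)
  moreover have "e * (1 - 2 * s0) > 0" using e s0 by simp
  ultimately have a0: "coef t s0 \<noteq> 0" by linarith
  \<comment> \<open>\<open>\<mu>\<close> puts the boundary of the disc at height \<open>s0\<close>, and \<open>k\<close> solves \<open>\<alpha> = 0\<close> there\<close>
  define \<mu> where "\<mu> = sqrt ((1 - s0) / 2)"
  have \<mu>2: "\<mu>\<^sup>2 = (1 - s0) / 2" and \<mu>: "\<mu> > 0" using s0 by (auto simp: \<mu>_def)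
  define k where "k = - 2 * t\<^sup>2 * (1 - s0) / coef t s0"
  have k: "coef t s0 * k = - 2 * t\<^sup>2 * (1 - s0)" using a0 by (simp add: k_def)
  let ?Z = "meridian_disc \<mu> k" and ?U = "meridian_dom \<mu>"
  let ?f = "\<lambda>w. fam t (?Z w)"
  have cball: "cball 0 1 \<subseteq> ?U"
  proof
    fix w :: complex assume "w \<in> cball 0 1"
    then have "(cmod w)\<^sup>2 \<le> 1" by (simp add: abs_square_le_1)
    then have "\<mu>\<^sup>2 * (cmod w)\<^sup>2 \<le> \<mu>\<^sup>2 * 1" by (intro mult_left_mono) auto
    also have "\<mu>\<^sup>2 * 1 < 1" using s0 by (simp add: \<mu>2)
    finally show "w \<in> ?U" by (simp add: meridian_dom_def)
  qed
  have Zemb: "smooth_embedding (\<lambda>_. UNIV) (cball 0 1) ?Z"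
    by (rule smooth_embedding_left_inverse[OF C_inf_meridian_disc cball, of UNIV "\<lambda>z. (1 / \<mu>) *\<^sub>R z$2"])
      (use \<mu> in \<open>auto intro!: C_inf_intros simp: meridian_disc_def\<close>)
  have emb: "smooth_embedding (\<lambda>_. UNIV) (cball 0 1) ?f"
    by (rule smooth_embedding_compose[OF Zemb smooth_embedding_fam[OF t0(2)]])
      (use cball meridian_disc_S3 meridian_disc_derivative(1) in \<open>auto simp del: mem_sphere_0 mem_cball_0\<close>)
  moreover have "?f ` cball 0 1 \<subseteq> fam_M t"
    using cball meridian_disc_S3 by (auto simp: fam_M_def simp del: mem_sphere_0 mem_cball_0)
  moreover have "range (frechet_derivative ?f (at x)) = contact_plane (fam_M t) (?f x)" if x: "x \<in> sphere 0 1" for x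
  proof -
    have xU: "x \<in> ?U" using cball x by auto
    define z where "z = ?Z x"
    have z: "z \<in> S3" unfolding z_def by (rule meridian_disc_S3[OF xU])
    have hz: "height z = s0" using x height_meridian_disc[OF xU] by (simp add: z_def \<mu>2 field_simps)
    note h = height_S3(1,2)[OF z, unfolded hz]
    have z0: "z$1 \<noteq> 0" "z$2 \<noteq> 0" using h s0 by auto
    let ?L = "\<lambda>u. coef t s0 * Im (cnj (z$1) * u$1) + t\<^sup>2 * (1 - s0\<^sup>2) * dheight z u"
    have al: "alpha (fam t z) (frechet_derivative (fam t) (at z) u) = ?L u / fnorm t s0" for u
      using fam_alpha[OF t0(2) z hz[symmetric]] by (simp add: b0)
    have n: "fnorm t s0 > 0" using fam_dom_S3[OF t0(2) z] by (simp add: fam_dom_def hz)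
    have Df: "frechet_derivative ?f (at x) v = frechet_derivative (fam t) (at z) (frechet_derivative ?Z (at x) v)" for v
      unfolding z_def
      by (rule frechet_derivative_compose_smooth[OF smooth_onI[OF C_inf_fam_t order.refl] smooth_onI[OF C_inf_meridian_disc order.refl] xU])
        (use S3_fam_slice[OF t0(2)] z z_def in blast)
    note dZ = meridian_disc_derivative[OF xU, of k, folded z_def]
    have L0: "?L (frechet_derivative ?Z (at x) v) = 0" for v
      unfolding dZ(3) h(1) using k by (simp add: power2_eq_square) algebra
    show ?thesis
    proof (intro equalityI subsetI)
      fix y assume "y \<in> range (frechet_derivative ?f (at x))"
      then obtain v where y: "y = frechet_derivative (fam t) (at z) (frechet_derivative ?Z (at x) v)"
        using Df by auto
      have "y \<in> tangent_space (fam_M t) (fam t z)" unfolding y by (rule fam_tangent[OF t0(2) z dZ(1)])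
      moreover have "alpha (fam t z) y = 0" unfolding y al L0 by simp
      ultimately show "y \<in> contact_plane (fam_M t) (?f x)" by (simp add: contact_plane_def z_def)
    next
      fix y assume "y \<in> contact_plane (fam_M t) (?f x)"
      then have yT: "y \<in> tangent_space (fam_M t) (fam t z)" and y0: "alpha (fam t z) y = 0"
        by (auto simp: contact_plane_def z_def)
      obtain u where u: "u \<in> tangent_space S3 z" and y: "y = frechet_derivative (fam t) (at z) u"
        using tangent_space_fam_M[OF t0(1) z z0 yT] .
      have Lu: "?L u = 0" using y0 n unfolding y al by simp
      \<comment> \<open>the difference \<open>d\<close> of \<open>u\<close> and the tangent vector of the disc with the same second component is 0\<close>
      define v where "v = (1 / \<mu>) *\<^sub>R u$2"
      define w where "w = frechet_derivative ?Z (at x) v"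
      have w2: "w$2 = u$2" using dZ(2)[of v] \<mu> by (simp add: v_def w_def)
      define d where "d = u - w"
      have d2: "d$2 = 0" by (simp add: d_def w2)
      have "z \<bullet> u = 0" "z \<bullet> w = 0" using u dZ(1)[of v] by (auto simp: w_def tangent_space_sphere[OF z])
      then have "z \<bullet> d = 0" by (simp add: d_def inner_diff_right)
      then have d1: "Re (cnj (z$1) * d$1) = 0" by (simp add: inner_complex_vec2 d2)
      then have dh: "dheight z d = 0" by (simp add: dheight_def d2)
      have "?L d = ?L u - ?L w" by (simp add: d_def dheight_def algebra_simps)
      also have "\<dots> = 0" using Lu L0[of v] by (simp add: w_def)
      finally have "Im (cnj (z$1) * d$1) = 0" using a0 by (simp add: dh)
      with d1 have "cnj (z$1) * d$1 = 0" by (simp add: complex_eq_iff)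
      then have "d = 0" using z0 d2 by (simp add: vec_eq_iff forall_2)
      then have "u = w" by (simp add: d_def)
      then have "y = frechet_derivative ?f (at x) v" using Df[of v] by (simp add: y w_def)
      then show "y \<in> range (frechet_derivative ?f (at x))" by (rule range_eqI)
    qed
  qed
  ultimately show ?thesis unfolding overtwisted_def by blast
qed

section \<open>The two solid tori\<close>

text \<open>The argument on the right half plane, in a form whose smoothness is immediate.\<close>

definition ang :: "complex \<Rightarrow> real" where
  "ang u = arctan (Im u / Re u)"

lemma C_inf_ang: "C_inf U f \<Longrightarrow> (\<And>x. x \<in> U \<Longrightarrow> Re (f x) > 0) \<Longrightarrow> C_inf U (\<lambda>x. ang (f x))"
  unfolding ang_def by (intro C_inf_intros) force+

lemma ang_polar: "Re u > 0 \<Longrightarrow> cmod u *\<^sub>R cis (ang u) = u"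
proof -
  assume u: "Re u > 0"
  have "cos (ang u) > 0" unfolding ang_def by (simp add: cos_arctan add_pos_nonneg)
  have n: "sqrt (1 + (Im u / Re u)\<^sup>2) = cmod u / Re u"
  proof -
    have "1 + (Im u / Re u)\<^sup>2 = (cmod u / Re u)\<^sup>2"
      using u by (simp add: power_divide cmod_power2 field_simps)
    then show ?thesis using u by simp
  qed
  have "cmod u > 0" using u by auto
  then show ?thesis
    using u by (simp add: complex_eq_iff ang_def cos_arctan sin_arctan n)
qed

lemma ang_cis: "r > 0 \<Longrightarrow> \<bar>\<theta>\<bar> \<le> 1 \<Longrightarrow> ang (r *\<^sub>R cis \<theta>) = \<theta>" "r > 0 \<Longrightarrow> \<bar>\<theta>\<bar> \<le> 1 \<Longrightarrow> Re (r *\<^sub>R cis \<theta>) > 0"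
proof -
  assume *: "r > 0" "\<bar>\<theta>\<bar> \<le> 1"
  then have "cos \<theta> > 0" using pi_gt3 by (intro cos_gt_zero_pi) auto
  then show "Re (r *\<^sub>R cis \<theta>) > 0" using * by simp
  have "Im (r *\<^sub>R cis \<theta>) / Re (r *\<^sub>R cis \<theta>) = tan \<theta>" using * by (simp add: tan_def)
  then show "ang (r *\<^sub>R cis \<theta>) = \<theta>" unfolding ang_def using * pi_gt3 by (simp add: arctan_tan)
qed

text \<open>Parametrizes the part of nonnegative height of the 3-sphere by the solid torus, with
  \<open>height = 1 - \<bar>w\<bar>\<^sup>2\<close>. The formula remains a diffeomorphism onto its image beyond the boundary \<open>\<bar>w\<bar> = 1\<close>, up to
  \<open>\<bar>w\<bar>\<^sup>2 < 2\<close>, and there it serves as the smooth extension.\<close>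

definition torus_map :: "complex \<times> complex \<Rightarrow> complex^2" where
  "torus_map x = vector [sqrt (1 - (cmod (snd x))\<^sup>2 / 2) *\<^sub>R fst x, (1 / sqrt 2) *\<^sub>R snd x]"

definition torus_inv :: "complex^2 \<Rightarrow> complex \<times> complex" where
  "torus_inv z = ((1 / sqrt (1 - (cmod (z$2))\<^sup>2)) *\<^sub>R z$1, sqrt 2 *\<^sub>R z$2)"

definition torus_dom :: "(complex \<times> complex) set" where
  "torus_dom = {x. (cmod (snd x))\<^sup>2 < 2}"

definition torus_cod :: "(complex^2) set" where
  "torus_cod = {z. (cmod (z$2))\<^sup>2 < 1}"

lemma C_inf_torus_map: "C_inf torus_dom torus_map"
proof -
  have "open torus_dom" unfolding torus_dom_def by (intro open_Collect_less continuous_intros)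
  then show ?thesis unfolding torus_map_def
    by (intro C_inf_intros) (auto simp: torus_dom_def)
qed

lemma C_inf_torus_inv: "C_inf torus_cod torus_inv"
proof -
  have "open torus_cod" unfolding torus_cod_def by (intro open_Collect_less continuous_intros)
  then show ?thesis unfolding torus_inv_def
    by (intro C_inf_intros) (auto simp: torus_cod_def)
qed

lemma cmod_torus_map_2: "(cmod (torus_map x $ 2))\<^sup>2 = (cmod (snd x))\<^sup>2 / 2"
  by (simp add: torus_map_def power_divide)

lemma torus_map_cod: "torus_map ` torus_dom \<subseteq> torus_cod"
  by (auto simp: torus_dom_def torus_cod_def cmod_torus_map_2)

lemma torus_inv_map: "x \<in> torus_dom \<Longrightarrow> torus_inv (torus_map x) = x"
  unfolding torus_inv_def cmod_torus_map_2 by (simp add: torus_dom_def torus_map_def prod_eq_iff)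

lemma torus_map_inv:
  assumes "z \<in> torus_cod"
  shows "torus_map (torus_inv z) = z"
proof -
  have *: "(cmod (snd (torus_inv z)))\<^sup>2 / 2 = (cmod (z$2))\<^sup>2"
    by (simp add: torus_inv_def power_mult_distrib)
  show ?thesis unfolding torus_map_def * using assms
    by (simp add: torus_inv_def torus_cod_def vec_eq_iff forall_2)
qed

lemma torus_map_S3:
  assumes "x \<in> torus_dom" "cmod (fst x) = 1"
  shows "torus_map x \<in> S3" "height (torus_map x) = 1 - (cmod (snd x))\<^sup>2"
  using assms by (simp_all add: S3_iff height_def torus_map_def torus_dom_def power_mult_distrib power_divide
      del: mem_sphere_0 mem_sphere)

lemma torus_inv_S3:
  assumes z: "z \<in> S3" and h: "height z > -1"
  shows "z \<in> torus_cod" "cmod (fst (torus_inv z)) = 1" "(cmod (snd (torus_inv z)))\<^sup>2 = 1 - height z"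
proof -
  note hh = height_S3[OF z]
  show "z \<in> torus_cod" using h hh(2) by (simp add: torus_cod_def)
  have "(cmod (fst (torus_inv z)))\<^sup>2 = 1"
    using h by (simp add: torus_inv_def power_divide hh field_simps)
  then show "cmod (fst (torus_inv z)) = 1" using power2_eq_1_iff[of "cmod (fst (torus_inv z))"] norm_ge_zero[of "fst (torus_inv z)"] by linarith
  show "(cmod (snd (torus_inv z)))\<^sup>2 = 1 - height z"
    by (simp add: torus_inv_def power_mult_distrib hh)
qed

lemma cmod_le_1_iff: "cmod w \<le> 1 \<longleftrightarrow> (cmod w)\<^sup>2 \<le> 1" "cmod w < 1 \<longleftrightarrow> (cmod w)\<^sup>2 < 1" "cmod w = 1 \<longleftrightarrow> (cmod w)\<^sup>2 = 1"
  using abs_square_le_1[of "cmod w"] abs_square_less_1[of "cmod w"] abs_square_eq_1[of "cmod w"] by simp_all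

lemma solid_torus_dom: "solid_torus \<subseteq> torus_dom"
proof
  fix x assume "x \<in> solid_torus"
  then have "cmod (snd x) \<le> 1" by (auto simp: solid_torus_def)
  then have "(cmod (snd x))\<^sup>2 \<le> 1" by (simp only: cmod_le_1_iff)
  then show "x \<in> torus_dom" by (simp add: torus_dom_def)
qed

lemma torus_map_solid_torus: "torus_map ` solid_torus = {z \<in> S3. height z \<ge> 0}"
proof (intro equalityI subsetI)
  fix z assume "z \<in> torus_map ` solid_torus"
  then obtain x where x: "x \<in> solid_torus" "z = torus_map x" by blast
  then have "cmod (fst x) = 1" "(cmod (snd x))\<^sup>2 \<le> 1"
    by (auto simp: solid_torus_def simp flip: cmod_le_1_iff)
  then show "z \<in> {z \<in> S3. height z \<ge> 0}"
    using torus_map_S3[of x] x solid_torus_dom by (auto simp del: mem_sphere_0 mem_sphere)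
next
  fix z assume "z \<in> {z \<in> S3. height z \<ge> 0}"
  then have z: "z \<in> S3" "height z \<ge> 0" "height z > -1" by auto
  note i = torus_inv_S3[OF z(1,3)]
  have "torus_inv z \<in> solid_torus"
    using i z(2) unfolding solid_torus_def by (auto simp: mem_Times_iff cmod_le_1_iff)
  then show "z \<in> torus_map ` solid_torus" using torus_map_inv[OF i(1)] by force
qed

lemma torus_map_boundary: "torus_map ` (sphere 0 1 \<times> sphere 0 1) = {z \<in> S3. height z = 0}"
proof (intro equalityI subsetI)
  fix z assume "z \<in> torus_map ` (sphere 0 1 \<times> sphere 0 1)"
  then obtain x where x: "x \<in> sphere 0 1 \<times> sphere 0 1" "z = torus_map x" by blast
  then have "cmod (fst x) = 1" "(cmod (snd x))\<^sup>2 = 1" by auto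
  moreover from this have "x \<in> torus_dom" by (simp add: torus_dom_def)
  ultimately show "z \<in> {z \<in> S3. height z = 0}"
    using torus_map_S3[of x] x by (auto simp del: mem_sphere_0 mem_sphere)
next
  fix z assume "z \<in> {z \<in> S3. height z = 0}"
  then have z: "z \<in> S3" "height z = 0" "height z > -1" by auto
  note i = torus_inv_S3[OF z(1,3)]
  have "torus_inv z \<in> sphere 0 1 \<times> sphere 0 1"
    using i z(2) by (auto simp: mem_Times_iff cmod_le_1_iff(3))
  then show "z \<in> torus_map ` (sphere 0 1 \<times> sphere 0 1)" using torus_map_inv[OF i(1)] by force
qed

lemma smooth_embedding_torus_map: "S \<subseteq> torus_dom \<Longrightarrow> smooth_embedding T S torus_map"
  by (rule smooth_embedding_left_inverse[OF C_inf_torus_map _ C_inf_torus_inv torus_map_cod torus_inv_map])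

lemma torus_map_tangent:
  assumes x: "x \<in> solid_torus" and v: "v \<in> solid_torus_tangent x"
  shows "frechet_derivative torus_map (at x) v \<in> tangent_space S3 (torus_map x)"
proof (rule tangent_space_push[OF C_inf_torus_map])
  show "x \<in> torus_dom" using x solid_torus_dom by auto
  have "open {w. (cmod w)\<^sup>2 < 2}" by (intro open_Collect_less continuous_intros)
  then have "tangent_space {w. (cmod w)\<^sup>2 < 2} (snd x) = UNIV"
    using \<open>x \<in> torus_dom\<close> by (intro tangent_space_open) (auto simp: torus_dom_def)
  then have "(fst v, snd v) \<in> tangent_space (sphere 0 1 \<times> {w. (cmod w)\<^sup>2 < 2}) (fst x, snd x)"
    using v by (intro tangent_space_Times) (auto simp: solid_torus_tangent_def)
  then show "v \<in> tangent_space (sphere 0 1 \<times> {w. (cmod w)\<^sup>2 < 2}) x" by simp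
  show "torus_map ` (sphere 0 1 \<times> {w. (cmod w)\<^sup>2 < 2} \<inter> torus_dom) \<subseteq> S3"
    using torus_map_S3(1) by (auto simp del: mem_sphere_0 mem_sphere) (auto simp: dist_norm)
qed

text \<open>Carries the part of nonnegative height to the part of nonpositive height.\<close>

definition S3_swap :: "complex^2 \<Rightarrow> complex^2" where
  "S3_swap z = vector [z$2, z$1]"

lemma S3_swap_simps [simp]: "S3_swap z $ 1 = z$2" "S3_swap z $ 2 = z$1" "S3_swap (S3_swap z) = z"
  by (simp_all add: S3_swap_def vec_eq_iff forall_2)

lemma S3_swap_S3: "S3_swap z \<in> S3 \<longleftrightarrow> z \<in> S3"
  by (simp add: S3_iff add.commute del: mem_sphere_0 mem_sphere)

lemma height_swap: "height (S3_swap z) = - height z"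
  by (simp add: height_def)

lemma swap_image_Collect: "S3_swap ` {z. P z} = {z. P (S3_swap z)}"
proof (intro equalityI subsetI)
  fix z assume "z \<in> {z. P (S3_swap z)}"
  then have "S3_swap z \<in> {z. P z}" "z = S3_swap (S3_swap z)" by auto
  then show "z \<in> S3_swap ` {z. P z}" by blast
qed auto

lemma C_inf_swap: "C_inf UNIV S3_swap"
  unfolding S3_swap_def by (intro C_inf_intros open_UNIV)

lemma smooth_embedding_swap: "smooth_embedding T S S3_swap"
  by (rule smooth_embedding_left_inverse[OF C_inf_swap subset_UNIV C_inf_swap]) auto

lemma swap_tangent:
  "v \<in> tangent_space M z \<Longrightarrow> frechet_derivative S3_swap (at z) v \<in> tangent_space (S3_swap ` M) (S3_swap z)"
  by (rule tangent_space_push[OF C_inf_swap UNIV_I]) auto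

lemma swap_image_S3: "S3_swap ` S3 = S3"
  using swap_image_Collect[of "\<lambda>z. z \<in> S3"] by (simp add: S3_swap_S3 del: mem_sphere_0 mem_sphere)

section \<open>Leaves\<close>

text \<open>Every leaf is the image of an embedded surface in \<open>\<complex> \<times> \<complex>\<close>; composing with the embeddings of the family
  then gives the immersed surface in the 5-sphere.\<close>

definition leaf_surface :: "(complex^2) set \<Rightarrow> bool" where
  "leaf_surface L \<longleftrightarrow> (\<exists>S J. connected S \<and> embedded_surface (S :: (complex \<times> complex) set) \<and>
     smooth_embedding (tangent_space S) S J \<and> J ` S = L)"

lemma smooth_embedding_tangent:
  assumes "smooth_embedding T S J" "x \<in> S" "v \<in> tangent_space S x"
  shows "frechet_derivative J (at x) v \<in> tangent_space (J ` S) (J x)"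
proof -
  obtain U where "S \<subseteq> U" "C_inf U J"
    using assms(1) by (auto simp: smooth_embedding_def injective_immersion_def smooth_on_altdef)
  then show ?thesis using assms by (intro tangent_space_push[of U J]) auto
qed

lemma tangent_space_mono: "M \<subseteq> N \<Longrightarrow> tangent_space M p \<subseteq> tangent_space N p"
  unfolding tangent_space_def by blast

lemma leaf_surface_swap: "leaf_surface L \<Longrightarrow> leaf_surface (S3_swap ` L)"
proof -
  assume "leaf_surface L"
  then obtain S J where S: "connected S" "embedded_surface (S :: (complex \<times> complex) set)"
    "smooth_embedding (tangent_space S) S J" "J ` S = L" by (auto simp: leaf_surface_def)
  have "smooth_embedding (tangent_space S) S (\<lambda>x. S3_swap (J x))"
    by (rule smooth_embedding_compose[OF S(3) smooth_embedding_swap[of "\<lambda>_. UNIV" UNIV]]) auto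
  moreover have "(\<lambda>x. S3_swap (J x)) ` S = S3_swap ` L" using S(4) by auto
  ultimately show ?thesis unfolding leaf_surface_def using S(1,2) by blast
qed

text \<open>The disc \<open>{0} \<times> ball 0 1\<close> parametrizes a plane leaf by a map that does not depend on the first
  coordinate \<open>x\<close>. The factor \<open>1 + x\<close>, which is \<open>1\<close> on the disc, turns it into a diffeomorphism of
  open sets, so that it has a smooth left inverse.\<close>

lemma leaf_surface_plane:
  assumes h: "C_inf (ball 0 1) (\<lambda>w. h (cmod w))"
  shows "leaf_surface (torus_map ` {(cis (c + h (cmod w)), w) | w. w \<in> ball 0 1})"
proof -
  let ?S = "{0} \<times> ball 0 1 :: (complex \<times> complex) set"
  let ?U = "UNIV \<times> ball 0 1 :: (complex \<times> complex) set"
  let ?k = "\<lambda>w. cis (c + h (cmod w))"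
  let ?J = "\<lambda>x. torus_map ((1 + fst x) * ?k (snd x), snd x)"
  let ?W = "{z. z \<in> torus_cod \<and> snd (torus_inv z) \<in> ball 0 1}"
  let ?g = "\<lambda>z. (fst (torus_inv z) * cnj (?k (snd (torus_inv z))) - 1, snd (torus_inv z))"
  have U: "open ?U" by (intro open_Times) auto
  have hU: "C_inf ?U (\<lambda>x. h (cmod (snd x)))"
    by (rule C_inf_compose[OF h]) (auto intro!: C_inf_intros U)
  have dom: "((1 + fst x) * ?k (snd x), snd x) \<in> torus_dom" if "x \<in> ?U" for x
  proof -
    have "(cmod (snd x))\<^sup>2 < 1" using that by (auto simp flip: cmod_le_1_iff)
    then show ?thesis by (simp add: torus_dom_def)
  qed
  have "C_inf ?U ?J"
    by (rule C_inf_compose[OF C_inf_torus_map]) (use dom in \<open>auto intro!: C_inf_intros U hU\<close>)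
  have "?W = torus_cod \<inter> (\<lambda>z. snd (torus_inv z)) -` ball 0 1" by auto
  moreover have "open \<dots>"
    using C_inf_continuous[OF C_inf_snd[OF C_inf_torus_inv]] C_inf_open[OF C_inf_torus_inv]
    by (intro continuous_open_preimage) auto
  ultimately have W: "open ?W" by simp
  have iW: "C_inf ?W torus_inv" using W by (rule C_inf_subset[OF C_inf_torus_inv]) auto
  have hW: "C_inf ?W (\<lambda>z. h (cmod (snd (torus_inv z))))"
    by (rule C_inf_compose[OF h C_inf_snd[OF iW]]) auto
  have "C_inf ?W ?g" by (intro C_inf_intros iW hW W)
  have cc: "cis a * cnj (cis a) = 1" for a by (simp add: cis_cnj cis_mult)
  have emb: "smooth_embedding (tangent_space ?S) ?S ?J"
  proof (rule smooth_embedding_left_inverse[OF \<open>C_inf ?U ?J\<close> _ \<open>C_inf ?W ?g\<close>])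
    show "?J ` ?U \<subseteq> ?W" using dom torus_inv_map torus_map_cod by auto
    show "?g (?J y) = y" if "y \<in> ?U" for y
      using torus_inv_map[OF dom[OF that]] cc[of "c + h (cmod (snd y))"]
      by (simp add: prod_eq_iff mult.assoc)
  qed auto
  have "embedded_surface ?S"
    unfolding embedded_surface_def
  proof
    fix p assume p: "p \<in> ?S"
    let ?V = "{y :: real^2. cmod (Complex (y$1) (y$2)) < 1}"
    let ?\<psi> = "\<lambda>y :: real^2. (0 :: complex, Complex (y$1) (y$2))"
    have eq: "Complex a b = of_real a + \<i> * of_real b" for a b by (simp add: complex_eq_iff)
    have V: "open ?V" unfolding eq by (intro open_Collect_less continuous_intros)
    have "local_param ?S ?V ?\<psi>"
    proof (rule local_param_left_inverse[of _ _ UNIV "\<lambda>x. vector [Re (snd x), Im (snd x)]"])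
      show "C_inf ?V ?\<psi>" unfolding eq by (intro C_inf_intros) (use V in \<open>simp_all add: eq\<close>)
      show "C_inf UNIV (\<lambda>x. vector [Re (snd x), Im (snd x)] :: real^2)"
        by (intro C_inf_intros open_UNIV)
    qed (auto simp: vec_eq_iff forall_2)
    moreover have "p = ?\<psi> (vector [Re (snd p), Im (snd p)])" "vector [Re (snd p), Im (snd p)] \<in> ?V"
      using p by (auto simp: prod_eq_iff)
    ultimately show "\<exists>V (\<psi> :: real^2 \<Rightarrow> complex \<times> complex). local_param ?S V \<psi> \<and> p \<in> \<psi> ` V" by blast
  qed
  moreover have "connected ?S" by (intro connected_Times) auto
  moreover have "?J ` ?S = torus_map ` {(?k w, w) | w. w \<in> ball 0 1}" by force
  ultimately show ?thesis using emb unfolding leaf_surface_def by blast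
qed

lemma unit_cis: "cmod u = 1 \<Longrightarrow> \<exists>a. u = cis a"
  by (metis cis_Arg div_by_1 norm_zero of_real_1 sgn_eq zero_neq_one)

text \<open>The product of two circles is already embedded in \<open>\<complex> \<times> \<complex>\<close>; angles give its charts.\<close>

lemma leaf_surface_torus: "leaf_surface {z \<in> S3. height z = 0}"
proof -
  let ?S = "sphere 0 1 \<times> sphere 0 1 :: (complex \<times> complex) set"
  have "embedded_surface ?S"
    unfolding embedded_surface_def
  proof
    fix p assume p: "p \<in> ?S"
    then obtain a b where ab: "p = (cis a, cis b)"
      using unit_cis[of "fst p"] unit_cis[of "snd p"] by (auto simp: dist_norm)
    let ?V = "{y :: real^2. \<bar>y$1\<bar> < 1 \<and> \<bar>y$2\<bar> < 1}"
    let ?\<psi> = "\<lambda>y :: real^2. (cis (a + y$1), cis (b + y$2))"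
    let ?W = "{x. Re (fst x * cis (- a)) > 0 \<and> Re (snd x * cis (- b)) > 0}"
    have V: "open ?V" by (intro open_Collect_conj open_Collect_less continuous_intros)
    have W: "open ?W" by (intro open_Collect_conj open_Collect_less continuous_intros)
    have r: "cis (c + x) * cis (- c) = 1 *\<^sub>R cis x" for c x by (simp add: cis_mult)
    have "local_param ?S ?V ?\<psi>"
    proof (rule local_param_left_inverse[of _ _ ?W "\<lambda>x. vector [ang (fst x * cis (- a)), ang (snd x * cis (- b))]"])
      show "C_inf ?V ?\<psi>" by (intro C_inf_intros V)
      show "C_inf ?W (\<lambda>x. vector [ang (fst x * cis (- a)), ang (snd x * cis (- b))] :: real^2)"
        by (intro C_inf_intros C_inf_ang W) auto
      show "?\<psi> ` ?V \<subseteq> ?S \<inter> ?W"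
      proof -
        have "Re (cis (c + x) * cis (- c)) > 0" if "\<bar>x\<bar> < 1" for c x
          unfolding r using that by (intro ang_cis(2)) auto
        then show ?thesis by (auto simp: dist_norm simp del: times_complex.sel)
      qed
      show "vector [ang (fst (?\<psi> y) * cis (- a)), ang (snd (?\<psi> y) * cis (- b))] = y" if "y \<in> ?V" for y
        using that by (simp add: r ang_cis[of 1, simplified] vec_eq_iff forall_2)
    next
      fix x assume x: "x \<in> ?S \<inter> ?W"
      have "cis (c + ang (u * cis (- c))) = u" if "cmod u = 1" "Re (u * cis (- c)) > 0" for c u
      proof -
        have "u * cis (- c) = cis (ang (u * cis (- c)))" using ang_polar[OF that(2)] that(1) by (simp add: norm_mult)
        then have "cis (ang (u * cis (- c))) * cis c = u" by (metis cis_mult cis_zero add.left_inverse mult.assoc mult.right_neutral)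
        then show ?thesis by (simp add: cis_mult add.commute)
      qed
      then show "?\<psi> (vector [ang (fst x * cis (- a)), ang (snd x * cis (- b))]) = x"
        using x by (auto simp: prod_eq_iff)
    qed
    moreover have "p = ?\<psi> 0" "0 \<in> ?V" by (auto simp: ab)
    ultimately show "\<exists>V (\<psi> :: real^2 \<Rightarrow> complex \<times> complex). local_param ?S V \<psi> \<and> p \<in> \<psi> ` V" by blast
  qed
  moreover have "connected ?S" by (intro connected_Times connected_sphere) auto
  moreover have "smooth_embedding (tangent_space ?S) ?S torus_map"
    by (rule smooth_embedding_torus_map) (use solid_torus_dom in \<open>auto simp: solid_torus_def\<close>)
  ultimately show ?thesis using torus_map_boundary unfolding leaf_surface_def by blast
qed

section \<open>The foliation on the 3-sphere\<close>

text \<open>The angle \<open>\<theta>\<^sub>1\<close> along a plane leaf of positive height, up to a constant, as a function of the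
  height: the equation \<open>ramp s d\<theta>\<^sub>1 + 2 (1 - s) ds = 0\<close> for Legendrian surfaces is solved by
  \<open>\<theta>\<^sub>1 = c + spiral s\<close>.\<close>

definition spiral :: "real \<Rightarrow> real" where
  "spiral s = exp (1 / (s * (2 - s)))"

definition profile :: "real \<Rightarrow> real" where
  "profile \<rho> = exp (1 / (1 - \<rho> ^ 4))"

lemma profile_eq_spiral: "profile \<rho> = spiral (1 - \<rho>\<^sup>2)"
proof -
  have "(1 - \<rho>\<^sup>2) * (2 - (1 - \<rho>\<^sup>2)) = 1 - \<rho> ^ 4" by (simp add: algebra_simps power2_eq_square power4_eq_xxxx)
  then show ?thesis by (simp add: profile_def spiral_def)
qed

lemma C_inf_profile: "C_inf (ball 0 1) (\<lambda>w. profile (cmod w))"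
proof -
  have eq: "profile (cmod w) = exp (1 / (1 - (cmod w)\<^sup>2 * (cmod w)\<^sup>2))" for w
    by (simp add: profile_def power2_eq_square power4_eq_xxxx mult.assoc)
  have "(cmod w)\<^sup>2 * (cmod w)\<^sup>2 \<noteq> 1" if "w \<in> ball 0 1" for w
  proof -
    have "(cmod w)\<^sup>2 < 1" using that by (simp flip: cmod_le_1_iff)
    then have "(cmod w)\<^sup>2 * (cmod w)\<^sup>2 < 1" by (metis mult_strict_mono' mult_1 zero_le_power2)
    then show ?thesis by simp
  qed
  then show ?thesis unfolding eq by (intro C_inf_intros) auto
qed

lemma reeb_profile_profile: "reeb_profile profile" "reeb_profile (\<lambda>\<rho>. - profile \<rho>)"
proof -
  have "((\<lambda>\<rho>::real. 1 - \<rho> ^ 4) \<longlongrightarrow> 1 - 1 ^ 4) (at_left 1)" by (intro tendsto_intros)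
  moreover have "eventually (\<lambda>\<rho>::real. 1 - \<rho> ^ 4 > 0) (at_left 1)"
    unfolding eventually_at_left_field
    by (rule exI[of _ 0]) (auto intro!: power_Suc_less_one simp: power_less_one_iff)
  ultimately have "filterlim (\<lambda>\<rho>::real. 1 - \<rho> ^ 4) (at_right 0) (at_left 1)"
    by (intro filterlim_at_withinI) (auto elim: eventually_mono)
  from filterlim_compose[OF exp_at_top filterlim_compose[OF filterlim_inverse_at_top_right this]]
  have *: "filterlim profile at_top (at_left 1)"
    by (simp add: profile_def[abs_def] inverse_eq_divide)
  then show "reeb_profile profile" unfolding reeb_profile_def using C_inf_profile by (auto intro: smooth_onI)
  show "reeb_profile (\<lambda>\<rho>. - profile \<rho>)" unfolding reeb_profile_def
    using * C_inf_minus[OF C_inf_profile] by (auto intro: smooth_onI simp: filterlim_uminus_at_bot)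
qed

text \<open>A complete invariant of the leaves: the constant of integration of the leaf through \<open>z\<close>, as a point of
  the unit circle, and the side of the boundary torus. For negative height the two angles are interchanged
  and the leaves spiral in the opposite direction.\<close>

definition label :: "complex^2 \<Rightarrow> complex \<times> nat" where
  "label z = (if height z > 0 then (cis (- spiral (height z)) * sgn (z$1), 1)
     else if height z < 0 then (cis (spiral (- height z)) * sgn (z$2), 2) else (0, 0))"

definition leaf :: "complex \<times> nat \<Rightarrow> (complex^2) set" where
  "leaf l = {z \<in> S3. label z = l}"

definition S3_leaves :: "(complex^2) set set" where
  "S3_leaves = insert (leaf (0, 0)) (range (\<lambda>c. leaf (cis c, 1)) \<union> range (\<lambda>c. leaf (cis c, 2)))"

lemma leaf_0: "leaf (0, 0) = {z \<in> S3. height z = 0}"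
  by (auto simp: leaf_def label_def)

lemma sgn_scaleR_cis: "r > 0 \<Longrightarrow> sgn (r *\<^sub>R cis a) = cis a"
  unfolding sgn_scaleR by (simp add: sgn_eq)

lemma leaf_torus_map:
  "torus_map ` {(cis (c + \<eta> * profile (cmod w)), w) | w. w \<in> ball 0 1} =
    {z \<in> S3. height z > 0 \<and> cis (- \<eta> * spiral (height z)) * sgn (z$1) = cis c}" (is "torus_map ` ?A = ?B")
proof (intro equalityI subsetI)
  fix z assume "z \<in> torus_map ` ?A"
  then obtain w where w: "cmod w < 1" and z: "z = torus_map (cis (c + \<eta> * profile (cmod w)), w)" by auto
  have w2: "(cmod w)\<^sup>2 < 1" using w by (simp flip: cmod_le_1_iff)
  then have "(cis (c + \<eta> * profile (cmod w)), w) \<in> torus_dom" by (simp add: torus_dom_def)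
  from torus_map_S3[OF this] have z': "z \<in> S3" "height z = 1 - (cmod w)\<^sup>2" by (simp_all add: z)
  have "sgn (z$1) = cis (c + \<eta> * profile (cmod w))"
    unfolding z torus_map_def using w2 by (simp add: sgn_scaleR_cis)
  then show "z \<in> ?B" using z' w2 by (simp add: profile_eq_spiral cis_mult del: mem_sphere_0 mem_sphere)
next
  fix z assume "z \<in> ?B"
  then have z: "z \<in> S3" "height z > 0" "height z > -1" and c: "cis (- \<eta> * spiral (height z)) * sgn (z$1) = cis c" by auto
  note i = torus_inv_S3[OF z(1,3)]
  let ?w = "snd (torus_inv z)"
  have "cis (\<eta> * spiral (height z)) * (cis (- \<eta> * spiral (height z)) * sgn (z$1)) = cis (c + \<eta> * spiral (height z))"
    unfolding c by (simp add: cis_mult add.commute)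
  then have "sgn (z$1) = cis (c + \<eta> * spiral (height z))"
    by (simp add: cis_mult flip: mult.assoc)
  moreover have "fst (torus_inv z) = sgn (fst (torus_inv z))" using i(2) by (simp add: sgn_eq)
  moreover have "sgn (fst (torus_inv z)) = sgn (z$1)"
    using i(1) by (simp add: torus_inv_def sgn_scaleR torus_cod_def)
  moreover have "profile (cmod ?w) = spiral (height z)" by (simp add: profile_eq_spiral i(3))
  ultimately have "torus_inv z = (cis (c + \<eta> * profile (cmod ?w)), ?w)" by (simp add: prod_eq_iff)
  moreover have "?w \<in> ball 0 1" using i(3) z(2) by (simp add: cmod_le_1_iff(2))
  ultimately have "torus_inv z \<in> ?A" by blast
  then show "z \<in> torus_map ` ?A" using torus_map_inv[OF i(1)] by force
qed

lemma leaf_1: "leaf (cis c, 1) = torus_map ` {(cis (c + profile (cmod w)), w) | w. w \<in> ball 0 1}"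
  using leaf_torus_map[of c 1] by (auto simp: leaf_def label_def)

lemma leaf_2: "leaf (cis c, 2) = S3_swap ` torus_map ` {(cis (c + - profile (cmod w)), w) | w. w \<in> ball 0 1}"
proof -
  have "leaf (cis c, 2) = {z. S3_swap z \<in> S3 \<and> height (S3_swap z) > 0 \<and> cis (- (- 1) * spiral (height (S3_swap z))) * sgn (S3_swap z$1) = cis c}"
    by (auto simp: leaf_def label_def height_swap S3_swap_S3 simp del: mem_sphere_0 mem_sphere)
  also have "\<dots> = S3_swap ` {z \<in> S3. height z > 0 \<and> cis (- (- 1) * spiral (height z)) * sgn (z$1) = cis c}"
    by (rule swap_image_Collect[symmetric])
  also have "\<dots> = S3_swap ` torus_map ` {(cis (c + - profile (cmod w)), w) | w. w \<in> ball 0 1}"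
    using leaf_torus_map[of c "- 1"] by simp
  finally show ?thesis .
qed

text \<open>The leaves are the fibres of \<open>label\<close>, and at the same time the leaves of the two Reeb components.\<close>

lemma S3_leaves_reeb: "S3_leaves = (`) torus_map ` reeb_component profile \<union>
    (`) (\<lambda>x. S3_swap (torus_map x)) ` reeb_component (\<lambda>\<rho>. - profile \<rho>)"
proof -
  have "S3_swap ` {z \<in> S3. height z = 0} = {z \<in> S3. height z = 0}"
    using swap_image_Collect[of "\<lambda>z. z \<in> S3 \<and> height z = 0"]
    by (simp add: S3_swap_S3 height_swap del: mem_sphere_0 mem_sphere)
  then have "S3_swap ` torus_map ` (sphere 0 1 \<times> sphere 0 1) = leaf (0, 0)"
    by (simp add: torus_map_boundary leaf_0)
  then have swap: "(\<lambda>x. S3_swap (torus_map x)) ` (sphere 0 1 \<times> sphere 0 1) = leaf (0, 0)"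
    by (simp only: image_image)
  have 1: "torus_map ` {(cis (c + profile (cmod w)), w) | w. w \<in> ball 0 1} = leaf (cis c, 1)" for c
    by (rule leaf_1[symmetric])
  have 2: "(\<lambda>x. S3_swap (torus_map x)) ` {(cis (c + - profile (cmod w)), w) | w. w \<in> ball 0 1} = leaf (cis c, 2)" for c
    unfolding leaf_2 by (rule image_image[symmetric])
  have range: "(`) f ` range A = range (\<lambda>c. f ` A c)" for f :: "complex \<times> complex \<Rightarrow> complex^2" and A :: "real \<Rightarrow> _"
    by (rule image_image)
  show ?thesis
    unfolding S3_leaves_def reeb_component_def image_insert torus_map_boundary[folded leaf_0] swap range 1 2
    by (rule set_eqI) (simp only: insert_iff Un_iff, blast)
qed

lemma label_S3:
  assumes "z \<in> S3"
  obtains "label z = (0, 0)" | c where "label z = (cis c, 1)" | c where "label z = (cis c, 2)"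
proof -
  note h = height_S3[OF assms]
  have u: "\<exists>c. cis b * sgn x = cis c" if "x \<noteq> 0" for b and x :: complex
    using unit_cis[of "cis b * sgn x"] that by (simp add: norm_mult norm_sgn)
  have "height z > 0 \<Longrightarrow> z$1 \<noteq> 0" "height z < 0 \<Longrightarrow> z$2 \<noteq> 0" using h by auto
  then consider "height z > 0" "z$1 \<noteq> 0" | "height z < 0" "z$2 \<noteq> 0" | "height z = 0" by linarith
  then show ?thesis
  proof cases
    case 1
    then show ?thesis using u[of "z$1" "- spiral (height z)"] that(2) by (auto simp: label_def)
  next
    case 2
    then show ?thesis using u[of "z$2" "spiral (- height z)"] that(3) by (auto simp: label_def)
  next
    case 3
    then show ?thesis using that(1) by (simp add: label_def)
  qed
qed

lemma partition_S3_leaves: "partition_on S3 S3_leaves"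
proof (rule partition_onI)
  show "\<Union>S3_leaves = S3"
  proof (intro equalityI subsetI)
    fix z assume z: "z \<in> S3"
    have "leaf (label z) \<in> S3_leaves"
      by (rule label_S3[OF z]) (auto simp: S3_leaves_def)
    moreover have "z \<in> leaf (label z)" using z by (simp add: leaf_def)
    ultimately show "z \<in> \<Union>S3_leaves" by blast
  qed (auto simp: S3_leaves_def leaf_def)
next
  fix p q assume "p \<in> S3_leaves" "q \<in> S3_leaves" "p \<noteq> q"
  then obtain l m where "p = leaf l" "q = leaf m" "leaf l \<noteq> leaf m" unfolding S3_leaves_def by blast
  then show "disjnt p q" by (auto simp: leaf_def disjnt_def)
next
  have "{z \<in> S3. height z = 0} \<noteq> {}" using torus_map_boundary[symmetric] by auto
  moreover have "{(cis (c + h (cmod w)), w) | w. w \<in> ball 0 1} \<noteq> {}" for c and h :: "real \<Rightarrow> real"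
    by (auto intro!: exI[of _ 0])
  ultimately show "{} \<notin> S3_leaves"
    by (auto simp: S3_leaves_def leaf_0 leaf_1 leaf_2 simp del: One_nat_def)
qed

lemma leaf_surface_leaf:
  assumes "L \<in> S3_leaves"
  shows "leaf_surface L"
proof -
  have "leaf_surface (leaf (cis c, 1))" "leaf_surface (leaf (cis c, 2))" for c
    unfolding leaf_1 leaf_2
    using leaf_surface_plane[OF C_inf_profile] leaf_surface_swap leaf_surface_plane[OF C_inf_minus[OF C_inf_profile]]
    by blast+
  then show ?thesis using assms leaf_surface_torus by (auto simp: S3_leaves_def leaf_0)
qed

subsection \<open>Leaves are Legendrian\<close>

lemma spiral_derivative:
  assumes "0 < s" "s < 2"
  shows "(spiral has_real_derivative - (2 * (1 - s) / ramp s)) (at s)"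
proof -
  have v: "s * (2 - s) > 0" using assms by simp
  have e: "((\<lambda>v::real. exp (1 / v)) has_real_derivative exp (1 / v) * (- (1 / v\<^sup>2))) (at v)" if "v \<noteq> 0" for v
    using that by (auto intro!: derivative_eq_intros simp: power2_eq_square)
  have "((\<lambda>s. s * (2 - s)) has_real_derivative 2 * (1 - s)) (at s)"
    by (auto intro!: derivative_eq_intros simp: algebra_simps)
  from DERIV_chain2[OF e[OF less_imp_neq[OF v, symmetric]] this]
  have "(spiral has_real_derivative exp (1 / (s * (2 - s))) * (- (1 / (s * (2 - s))\<^sup>2)) * (2 * (1 - s))) (at s)"
    unfolding spiral_def[abs_def] .
  also have "exp (1 / (s * (2 - s))) * (- (1 / (s * (2 - s))\<^sup>2)) * (2 * (1 - s)) = - (2 * (1 - s) / ramp s)"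
    using v by (simp add: ramp_def flat_def exp_minus divide_inverse)
  finally show ?thesis .
qed

text \<open>The argument of \<open>z\<^sub>i\<close> on a plane leaf is \<open>c + \<sigma> * spiral (\<sigma> * height z)\<close>, that is, the number
  \<open>cis (- c) * cis (- \<sigma> * spiral (\<sigma> * height z)) * z\<^sub>i\<close> is real, where \<open>\<sigma>\<close> is the sign of the
  height. Differentiating this along the leaf gives the equation of Legendrian surfaces.\<close>

lemma plane_leaf_tangent:
  fixes L :: "(complex^2) set" and i :: 2
  assumes z: "z \<in> L" and s: "\<sigma> * height z > 0" and ht: "\<sigma> * height z < 2" and \<sigma>: "\<sigma> = 1 \<or> \<sigma> = -1"
    and L: "\<And>x. x \<in> L \<Longrightarrow> \<sigma> * height x > 0 \<Longrightarrow> cis (- \<sigma> * spiral (\<sigma> * height x)) * sgn (x$i) = cis c"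
    and u: "u \<in> tangent_space L z"
  shows "ramp (\<sigma> * height z) * Im (cnj (z$i) * u$i) = - 2 * (1 - \<sigma> * height z) * (cmod (z$i))\<^sup>2 * dheight z u"
proof -
  let ?h = "\<lambda>x. \<sigma> * height x"
  define U where "U = {x :: complex^2. 0 < ?h x \<and> ?h x < 2}"
  have hc: "C_inf UNIV ?h" by (intro C_inf_intros C_inf_height open_UNIV)
  have U: "open U" unfolding U_def
    by (intro open_Collect_conj open_Collect_less continuous_on_const C_inf_continuous[OF hc])
  have zU: "z \<in> U" using s ht by (simp add: U_def)
  define f where "f x = Im (cis (- c) * (cis (- \<sigma> * spiral (?h x)) * x$i))" for x :: "complex^2"
  have sp: "C_inf U (\<lambda>x. spiral (?h x))" unfolding spiral_def
    by (intro C_inf_intros C_inf_height U) (auto simp: U_def)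
  have f: "C_inf U f" unfolding f_def by (intro C_inf_intros sp U)
  have "f x = 0" if "x \<in> L \<inter> U" for x
  proof -
    have "cis (- \<sigma> * spiral (?h x)) * sgn (x$i) = cis c" using L that by (auto simp: U_def)
    then have "cis (- c) * (cis (- \<sigma> * spiral (?h x)) * sgn (x$i)) = 1" by (simp add: cis_mult)
    moreover have "x$i = cmod (x$i) *\<^sub>R sgn (x$i)" by (cases "x$i = 0") (auto simp: sgn_eq scaleR_conv_of_real)
    ultimately have "cis (- c) * (cis (- \<sigma> * spiral (?h x)) * x$i) = of_real (cmod (x$i))"
      by (metis (no_types, lifting) mult.right_neutral mult_scaleR_right scaleR_conv_of_real)
    then show ?thesis by (simp add: f_def)
  qed
  from tangent_space_agree[OF f C_inf_const[OF U] zU u this]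
  have f0: "frechet_derivative f (at z) u = 0" by (simp add: frechet_derivative_const)
  let ?S = "spiral (?h z)" and ?dS = "- (2 * (1 - ?h z) / ramp (?h z))"
  have "(?h has_derivative (\<lambda>v. \<sigma> * dheight z v)) (at z)"
    by (intro has_derivative_mult_right has_derivative_height)
  from diff_chain_at[OF this spiral_derivative[OF s ht, unfolded has_field_derivative_def]]
  have dS: "((\<lambda>x. spiral (?h x)) has_derivative (\<lambda>v. ?dS * (\<sigma> * dheight z v))) (at z)" by (simp add: o_def)
  have dcis: "((\<lambda>x. cis (- \<sigma> * spiral (?h x))) has_derivative
      (\<lambda>v. (- \<sigma> * (?dS * (\<sigma> * dheight z v))) *\<^sub>R (\<i> * cis (- \<sigma> * ?S)))) (at z)"
    by (intro has_derivative_cis has_derivative_mult_right dS)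
  have "((\<lambda>x. cis (- \<sigma> * spiral (?h x)) * x$i) has_derivative (\<lambda>v. cis (- \<sigma> * ?S) * v$i +
      ((- \<sigma> * (?dS * (\<sigma> * dheight z v))) *\<^sub>R (\<i> * cis (- \<sigma> * ?S))) * z$i)) (at z)"
    by (intro has_derivative_mult[OF dcis] bounded_linear_imp_has_derivative bounded_linear_vec_nth)
  then have "(f has_derivative (\<lambda>v. Im (cis (- c) * (cis (- \<sigma> * ?S) * v$i +
      ((- \<sigma> * (?dS * (\<sigma> * dheight z v))) *\<^sub>R (\<i> * cis (- \<sigma> * ?S))) * z$i)))) (at z)"
    unfolding f_def by (rule bounded_linear.has_derivative[OF bounded_linear_Im has_derivative_mult_right])
  from fun_cong[OF frechet_derivative_at[OF this], of u] f0 have e: "Im (cis (- c) * (cis (- \<sigma> * ?S) * u$i +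
      ((- \<sigma> * (?dS * (\<sigma> * dheight z u))) *\<^sub>R (\<i> * cis (- \<sigma> * ?S))) * z$i)) = 0"
    by (rule trans)
  define k where "k = ?dS * dheight z u"
  have \<sigma>2: "\<sigma> * \<sigma> = 1" using \<sigma> by auto
  then have sk: "- \<sigma> * (?dS * (\<sigma> * dheight z u)) = - k" unfolding k_def by algebra
  have "cis (- c) * cis (- \<sigma> * ?S) = cnj (sgn (z$i))"
  proof -
    have "cis (- \<sigma> * ?S) * sgn (z$i) = cis c" using L[OF z s] .
    then have "cis (- c) * cis (- \<sigma> * ?S) * sgn (z$i) = cis (- c) * cis c" by (simp only: mult.assoc)
    also have "cis (- c) * cis c = 1" by (simp add: cis_mult)
    finally have "cis (- c) * cis (- \<sigma> * ?S) * sgn (z$i) = 1" .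
    then have "cis (- c) * cis (- \<sigma> * ?S) * (sgn (z$i) * cnj (sgn (z$i))) = cnj (sgn (z$i))" by (metis mult.assoc mult_1)
    moreover have "sgn (z$i) * cnj (sgn (z$i)) = 1"
    proof -
      have "z$i \<noteq> 0" using \<open>cis (- \<sigma> * ?S) * sgn (z$i) = cis c\<close> by auto
      then have "cmod (sgn (z$i)) = 1" by (simp add: norm_sgn)
      then show ?thesis by (metis complex_norm_square mult.commute of_real_1 one_power2)
    qed
    ultimately show ?thesis by simp
  qed
  moreover have "cis (- c) * (cis (- \<sigma> * ?S) * u$i + ((- k) *\<^sub>R (\<i> * cis (- \<sigma> * ?S))) * z$i) =
      (cis (- c) * cis (- \<sigma> * ?S)) * (u$i - k *\<^sub>R (\<i> * z$i))"
    by (simp only: scaleR_conv_of_real of_real_minus) algebra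
  ultimately have "Im (cnj (sgn (z$i)) * (u$i - k *\<^sub>R (\<i> * z$i))) = 0"
    using e unfolding sk by simp
  moreover have "cnj (z$i) = cmod (z$i) *\<^sub>R cnj (sgn (z$i))"
    by (cases "z$i = 0") (auto simp: sgn_eq scaleR_conv_of_real)
  ultimately have "Im (cnj (z$i) * (u$i - k *\<^sub>R (\<i> * z$i))) = 0"
    by (simp only: mult_scaleR_left scaleR_complex.sel mult_zero_right)
  then have "Im (cnj (z$i) * u$i) = k * (cmod (z$i))\<^sup>2"
    unfolding cmod_power2 by (simp add: power2_eq_square algebra_simps)
  moreover have "ramp (?h z) > 0" using s ht by (rule ramp_pos)
  ultimately show ?thesis by (simp add: k_def field_simps)
qed


lemma coef_1: "coef 1 s = ramp s"
  by (simp add: coef_def flat_nonpos)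

text \<open>On a plane leaf one of the two coefficients of the contact form vanishes, and the remaining two
  terms cancel. On the torus all coefficients of angles vanish and the height is constant.\<close>

lemma alpha_leaf:
  assumes L: "L \<in> S3_leaves" and z: "z \<in> L" and u: "u \<in> tangent_space L z"
  shows "alpha (fam 1 z) (frechet_derivative (fam 1) (at z) u) = 0"
proof -
  have LS: "L \<subseteq> S3" using partition_S3_leaves L by (auto simp: partition_on_def simp del: mem_sphere_0 mem_sphere)
  then have zS: "z \<in> S3" using z by blast
  define s where "s = height z"
  note h = height_S3[OF zS, folded s_def]
  obtain l where l: "L = leaf l" "l = (0, 0) \<or> (\<exists>c. l = (cis c, 1)) \<or> (\<exists>c. l = (cis c, 2))"
    using L by (auto simp: S3_leaves_def)
  have lz: "label x = l" if "x \<in> L" for x using that by (simp add: l leaf_def)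
  have uS: "u \<in> tangent_space S3 z" using u tangent_space_mono[OF LS] by blast
  have "ramp s * Im (cnj (z$1) * u$1) + ramp (- s) * Im (cnj (z$2) * u$2) + (1 - s\<^sup>2) * dheight z u = 0"
    using l(2)
  proof (elim disjE exE)
    assume l0: "l = (0, 0)"
    then have h0: "height x = 0" if "x \<in> L" for x using that by (simp add: l leaf_0)
    have hc: "C_inf UNIV height" by (intro C_inf_height C_inf_intros open_UNIV)
    have "frechet_derivative height (at z) u = frechet_derivative (\<lambda>x. 0 :: real) (at z) u"
      by (rule tangent_space_agree[OF hc C_inf_const[OF open_UNIV] UNIV_I u]) (use h0 in auto)
    then have "dheight z u = 0"
      by (simp add: frechet_derivative_at[OF has_derivative_height, symmetric] frechet_derivative_const)
    then show ?thesis using h0[OF z] by (simp add: s_def ramp_nonpos_eq_0)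
  next
    fix c assume lc: "l = (cis c, 1)"
    have p: "height x > 0 \<and> cis (- spiral (height x)) * sgn (x$1) = cis c" if "x \<in> L" for x
      using lz[OF that] by (auto simp: lc label_def split: if_splits)
    have "ramp (1 * height z) * Im (cnj (z$1) * u$1) = - 2 * (1 - 1 * height z) * (cmod (z$1))\<^sup>2 * dheight z u"
      by (rule plane_leaf_tangent[OF z _ _ _ _ u, of _ _ c]) (use p z h in \<open>auto simp: s_def\<close>)
    then have "ramp s * Im (cnj (z$1) * u$1) = - 2 * (1 - s) * ((1 + s) / 2) * dheight z u"
      unfolding h(1) by (simp add: s_def)
    moreover have "ramp (- s) = 0" using p[OF z] by (simp add: s_def ramp_nonpos_eq_0)
    ultimately show ?thesis by (simp add: power2_eq_square field_simps)
  next
    fix c assume lc: "l = (cis c, 2)"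
    have p: "height x < 0 \<and> cis (spiral (- height x)) * sgn (x$2) = cis c" if "x \<in> L" for x
      using lz[OF that] by (auto simp: lc label_def split: if_splits)
    have "ramp (-1 * height z) * Im (cnj (z$2) * u$2) = - 2 * (1 - (-1) * height z) * (cmod (z$2))\<^sup>2 * dheight z u"
      by (rule plane_leaf_tangent[OF z _ _ _ _ u, of _ _ c]) (use p z h in \<open>auto simp: s_def\<close>)
    then have "ramp (- s) * Im (cnj (z$2) * u$2) = - 2 * (1 + s) * ((1 - s) / 2) * dheight z u"
      unfolding h(2) by (simp add: s_def)
    moreover have "ramp s = 0" using p[OF z] by (simp add: s_def ramp_nonpos_eq_0)
    ultimately show ?thesis by (simp add: power2_eq_square field_simps)
  qed
  then show ?thesis using fam_alpha[of 1 z s u] zS by (simp add: s_def coef_1)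
qed

lemma leaf_immersed_legendrian:
  assumes L: "L \<in> S3_leaves"
  shows "\<exists>S j. connected S \<and> immersed_surface S j \<and> j ` S = fam 1 ` L" "legendrian_submanifold (fam 1 ` L)"
proof -
  have LS: "L \<subseteq> S3" using partition_S3_leaves L by (auto simp: partition_on_def simp del: mem_sphere_0 mem_sphere)
  obtain S J where S: "connected S" "embedded_surface (S :: (complex \<times> complex) set)"
    and J: "smooth_embedding (tangent_space S) S J" "J ` S = L"
    using leaf_surface_leaf[OF L] by (auto simp: leaf_surface_def)
  have JL: "frechet_derivative J (at x) v \<in> tangent_space L (J x)" if "x \<in> S" "v \<in> tangent_space S x" for x v
    using smooth_embedding_tangent[OF J(1) that] J(2) by simp
  have "smooth_embedding (tangent_space S) S (\<lambda>x. fam 1 (J x))"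
  proof (rule smooth_embedding_compose[OF J(1) smooth_embedding_fam])
    show "J ` S \<subseteq> S3" using J(2) LS by simp
    show "frechet_derivative J (at x) v \<in> tangent_space S3 (J x)" if "x \<in> S" "v \<in> tangent_space S x" for x v
      using JL[OF that] tangent_space_mono[OF LS] by blast
  qed simp
  then have imm: "immersed_surface S (\<lambda>x. fam 1 (J x))"
    using S(2) by (simp add: immersed_surface_def smooth_embedding_def)
  have im: "(\<lambda>x. fam 1 (J x)) ` S = fam 1 ` L" using J(2) by auto
  show "\<exists>S j. connected S \<and> immersed_surface S j \<and> j ` S = fam 1 ` L" using S(1) imm im by blast
  have "alpha (fam 1 (J x)) (frechet_derivative (\<lambda>x. fam 1 (J x)) (at x) v) = 0"
    if x: "x \<in> S" and v: "v \<in> tangent_space S x" for x v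
  proof -
    have Jx: "J x \<in> L" using x J(2) by blast
    have "smooth_on S J" using J(1) by (simp add: smooth_embedding_def injective_immersion_def)
    moreover have "J x \<in> S3" using Jx LS by blast
    ultimately have "frechet_derivative (\<lambda>x. fam 1 (J x)) (at x) v =
        frechet_derivative (fam 1) (at (J x)) (frechet_derivative J (at x) v)"
      using x by (intro frechet_derivative_compose_smooth[OF smooth_on_fam_t]) auto
    then show ?thesis using alpha_leaf[OF L Jx JL[OF x v]] by simp
  qed
  moreover have "fam 1 ` L \<subseteq> S5" using fam_S5[of 1] LS by (auto simp del: mem_sphere_0 mem_sphere)
  ultimately show "legendrian_submanifold (fam 1 ` L)"
    unfolding legendrian_submanifold_def using imm im by blast
qed

section \<open>Foliated charts\<close>

lemma cube3_iff: "y \<in> cube3 \<longleftrightarrow> \<bar>y$1\<bar> < 1 \<and> \<bar>y$2\<bar> < 1 \<and> \<bar>y$3\<bar> < 1"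
  by (simp add: cube3_def forall_3)

lemma open_cube3: "open cube3"
proof -
  have eq: "cube3 = {y :: real^3. \<bar>y$1\<bar> < 1 \<and> \<bar>y$2\<bar> < 1 \<and> \<bar>y$3\<bar> < 1}" using cube3_iff by blast
  show ?thesis unfolding eq by (intro open_Collect_conj open_Collect_less continuous_intros)
qed

subsection \<open>Near an interior point of a solid torus\<close>

text \<open>The third coordinate is the constant of integration of the leaf. The first two range over a square
  within distance \<open>2\<close> of the origin, so the factor \<open>(1 - cmod w0) / 2\<close> keeps \<open>w\<close> in the unit disc.\<close>

definition plane_chart :: "(real \<Rightarrow> real) \<Rightarrow> complex \<Rightarrow> real \<Rightarrow> real^3 \<Rightarrow> complex^2" where
  "plane_chart h w0 b y = (let w = w0 + ((1 - cmod w0) / 2) *\<^sub>R Complex (y$1) (y$2) in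
     torus_map (cis (b + y$3 + h (cmod w)), w))"

lemma local_param_plane_chart:
  assumes h: "C_inf (ball 0 1) (\<lambda>w. h (cmod w))" and w0: "cmod w0 < 1"
  shows "local_param S3 cube3 (plane_chart h w0 b)"
    "y \<in> cube3 \<Longrightarrow> plane_chart h w0 b y \<in> torus_map ` {(cis (b + y$3 + h (cmod w)), w) | w. w \<in> ball 0 1}"
proof -
  define e where "e = (1 - cmod w0) / 2"
  have e: "e > 0" using w0 by (simp add: e_def)
  define W where "W y = w0 + e *\<^sub>R Complex (y$1) (y$2)" for y :: "real^3"
  have Wb: "W y \<in> ball 0 1" if "y \<in> cube3" for y
  proof -
    have "cmod (Complex (y$1) (y$2)) \<le> \<bar>y$1\<bar> + \<bar>y$2\<bar>" using cmod_le[of "Complex (y$1) (y$2)"] by simp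
    also have "\<dots> < 2" using that by (simp add: cube3_iff)
    finally have "cmod (e *\<^sub>R Complex (y$1) (y$2)) < e * 2" using e by simp
    also have "e * 2 = 1 - cmod w0" by (simp add: e_def)
    finally show ?thesis using norm_triangle_ineq[of w0 "e *\<^sub>R Complex (y$1) (y$2)"] by (simp add: W_def)
  qed
  have chart: "plane_chart h w0 b y = torus_map (cis (b + y$3 + h (cmod (W y))), W y)" for y
    by (simp add: plane_chart_def Let_def W_def e_def)
  show "plane_chart h w0 b y \<in> torus_map ` {(cis (b + y$3 + h (cmod w)), w) | w. w \<in> ball 0 1}" if "y \<in> cube3"
    unfolding chart using Wb[OF that] by blast
  have cW: "C_inf cube3 W"
  proof -
    have eq: "Complex u v = of_real u + \<i> * of_real v" for u v by (simp add: complex_eq_iff)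
    show ?thesis unfolding W_def eq by (intro C_inf_intros open_cube3)
  qed
  have hW: "C_inf cube3 (\<lambda>y. h (cmod (W y)))"
    by (rule C_inf_compose[OF h cW]) (use Wb in blast)
  have dom: "(cis (b + y$3 + h (cmod (W y))), W y) \<in> torus_dom" if "y \<in> cube3" for y
  proof -
    have "(cmod (W y))\<^sup>2 < 1" using Wb[OF that] by (simp flip: cmod_le_1_iff)
    then show ?thesis by (simp add: torus_dom_def)
  qed
  have C: "C_inf cube3 (plane_chart h w0 b)"
    unfolding chart[abs_def]
    by (rule C_inf_compose[OF C_inf_torus_map]) (use dom in \<open>auto intro!: C_inf_intros cW hW open_cube3\<close>)
  define N where "N = torus_cod \<inter> (\<lambda>z. snd (torus_inv z)) -` ball 0 1"
  have N: "open N" unfolding N_def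
    using C_inf_continuous[OF C_inf_snd[OF C_inf_torus_inv]] C_inf_open[OF C_inf_torus_inv]
    by (intro continuous_open_preimage) auto
  have iN: "C_inf N torus_inv" using N by (rule C_inf_subset[OF C_inf_torus_inv]) (auto simp: N_def)
  have hN: "C_inf N (\<lambda>z. h (cmod (snd (torus_inv z))))"
    by (rule C_inf_compose[OF h C_inf_snd[OF iN]]) (auto simp: N_def)
  define r where "r z = fst (torus_inv z) * cis (- (b + h (cmod (snd (torus_inv z)))))" for z
  have rN: "C_inf N r" unfolding r_def by (intro C_inf_intros iN hN N)
  define O' where "O' = N \<inter> (\<lambda>z. Re (r z)) -` {0<..}"
  have O: "open O'" unfolding O'_def
    using C_inf_continuous[OF C_inf_Re[OF rN]] N by (intro continuous_open_preimage) auto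
  define g :: "complex^2 \<Rightarrow> real^3" where
    "g z = vector [Re (snd (torus_inv z) - w0) / e, Im (snd (torus_inv z) - w0) / e, ang (r z)]" for z
  have sub: "C_inf O' torus_inv" "C_inf O' r"
    using C_inf_subset[OF iN O] C_inf_subset[OF rN O] by (auto simp: O'_def)
  have G: "C_inf O' g" unfolding g_def
    by (intro C_inf_intros C_inf_ang sub O) (use e in \<open>auto simp: O'_def\<close>)
  have r: "r (plane_chart h w0 b y) = 1 *\<^sub>R cis (y$3)" and inv: "torus_inv (plane_chart h w0 b y) = (cis (b + y$3 + h (cmod (W y))), W y)"
    if "y \<in> cube3" for y
  proof -
    show inv: "torus_inv (plane_chart h w0 b y) = (cis (b + y$3 + h (cmod (W y))), W y)"
      unfolding chart by (rule torus_inv_map[OF dom[OF that]])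
    show "r (plane_chart h w0 b y) = 1 *\<^sub>R cis (y$3)" by (simp add: r_def inv cis_mult)
  qed
  show "local_param S3 cube3 (plane_chart h w0 b)"
  proof (rule local_param_left_inverse[OF C G])
    show "plane_chart h w0 b ` cube3 \<subseteq> S3 \<inter> O'"
    proof
      fix z assume "z \<in> plane_chart h w0 b ` cube3"
      then obtain y where y: "y \<in> cube3" "z = plane_chart h w0 b y" by blast
      have "z \<in> S3" unfolding y(2) chart by (rule torus_map_S3(1)[OF dom[OF y(1)]]) simp
      moreover have "z \<in> torus_cod" unfolding y(2) chart using torus_map_cod dom[OF y(1)] by blast
      moreover have "Re (r z) > 0" unfolding y(2) r[OF y(1)] using y(1) by (intro ang_cis(2)) (auto simp: cube3_iff)
      ultimately show "z \<in> S3 \<inter> O'" using Wb[OF y(1)] by (simp add: O'_def N_def y(2) inv[OF y(1)])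
    qed
    show "g (plane_chart h w0 b y) = y" if "y \<in> cube3" for y
    proof -
      have "ang (1 *\<^sub>R cis (y$3)) = y$3" using that by (intro ang_cis(1)) (auto simp: cube3_iff)
      then show ?thesis unfolding g_def r[OF that] inv[OF that] using e by (simp add: W_def vec_eq_iff forall_3)
    qed
    show "plane_chart h w0 b (g z) = z" if "z \<in> S3 \<inter> O'" "g z \<in> cube3" for z
    proof -
      have z: "z \<in> S3" "z \<in> torus_cod" "Re (r z) > 0" using that by (auto simp: O'_def N_def)
      have "height z > - 1" using height_S3(2)[OF z(1)] z(2) by (simp add: torus_cod_def)
      from torus_inv_S3(2)[OF z(1) this] have "cmod (r z) = 1" by (simp add: r_def norm_mult)
      with ang_polar[OF z(3)] have rz: "cis (ang (r z)) = r z" by simp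
      have w: "W (g z) = snd (torus_inv z)" using e by (simp add: W_def g_def complex_eq_iff)
      have "cis (b + g z $ 3 + h (cmod (W (g z)))) = cis (ang (r z)) * cis (b + h (cmod (snd (torus_inv z))))"
        unfolding w by (simp add: g_def cis_mult algebra_simps)
      also have "\<dots> = r z * cis (b + h (cmod (snd (torus_inv z))))" unfolding rz ..
      also have "\<dots> = fst (torus_inv z)" by (simp add: r_def cis_mult mult.assoc)
      finally show ?thesis unfolding chart w using torus_map_inv[OF z(2)] by simp
    qed
  qed
qed

lemma plane_chart_through:
  assumes p: "p \<in> S3" "height p > 0" and h: "C_inf (ball 0 1) (\<lambda>w. h (cmod w))"
  obtains w0 b where "cmod w0 < 1" "plane_chart h w0 b 0 = p"
proof -
  have p': "height p > -1" using p by simp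
  note i = torus_inv_S3[OF p(1) p']
  define w0 where "w0 = snd (torus_inv p)"
  obtain a where a: "fst (torus_inv p) = cis a" using unit_cis[OF i(2)] by blast
  have "cmod w0 < 1" using i(3) p(2) unfolding cmod_le_1_iff w0_def by simp
  moreover have "plane_chart h w0 (a - h (cmod w0)) 0 = p"
  proof -
    have "Complex 0 0 = 0" by (simp add: complex_eq_iff)
    then have "plane_chart h w0 (a - h (cmod w0)) 0 = torus_map (cis a, w0)"
      by (simp add: plane_chart_def Let_def)
    also have "(cis a, w0) = torus_inv p" by (simp add: w0_def prod_eq_iff a)
    finally show ?thesis by (simp add: torus_map_inv[OF i(1)])
  qed
  ultimately show ?thesis using that by blast
qed

subsection \<open>Near the common boundary torus\<close>

text \<open>Foliated coordinates near the boundary torus need the map \<open>shift s u\<close> with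
  \<open>spiral (shift s u) = spiral s + u\<close> for \<open>s > 0\<close>, extended by \<open>shift s u = s\<close> to \<open>s \<le> 0\<close>. In terms of
  \<open>v = s (2 - s)\<close> it sends \<open>1 / v\<close> to \<open>ln (exp (1 / v) + u) = 1 / v + ln (1 + u flat v)\<close>. Written as
  below, this needs no division by \<open>v\<close> and is smooth across \<open>0\<close>: the holonomy along the torus is
  tangent to the identity to all orders.\<close>

definition shift_aux :: "real \<Rightarrow> real \<Rightarrow> real" where
  "shift_aux v u = v / (1 + v * ln (1 + u * flat v))"

definition shift :: "real \<Rightarrow> real \<Rightarrow> real" where
  "shift s u = 1 - sqrt (1 - shift_aux (s * (2 - s)) u)"

text \<open>The domain on which the formula for \<open>shift\<close> is smooth: the arguments of the logarithm and of the
  square root and the denominator are positive.\<close>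

definition shiftable :: "real \<Rightarrow> real \<Rightarrow> bool" where
  "shiftable s u \<longleftrightarrow> (let v = s * (2 - s) in
     1 + u * flat v > 0 \<and> 1 + v * ln (1 + u * flat v) > 0 \<and> shift_aux v u < 1)"

lemma shift_nonpos:
  assumes "s \<le> 0"
  shows "shiftable s u" "shift s u = s"
proof -
  have v: "s * (2 - s) \<le> 0" using assms by (simp add: mult_nonpos_nonneg)
  then have f: "flat (s * (2 - s)) = 0" by (rule flat_nonpos)
  show "shiftable s u" using v by (simp add: shiftable_def Let_def f shift_aux_def)
  have "1 - s * (2 - s) = (1 - s)\<^sup>2" by (simp add: power2_eq_square algebra_simps)
  then show "shift s u = s" using assms by (simp add: shift_def shift_aux_def f)
qed

lemma shift_pos:
  assumes s: "0 < s" "s < 1" and adm: "shiftable s u"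
  shows "0 < shift s u" "shift s u < 1" "spiral (shift s u) = spiral s + u"
    "shiftable (shift s u) (- u)" "shift (shift s u) (- u) = s"
proof -
  define v T where "v = s * (2 - s)" and "T = shift_aux v u"
  have v: "0 < v" "v < 1"
  proof -
    show "0 < v" using s by (simp add: v_def)
    have "1 - v = (1 - s)\<^sup>2" by (simp add: v_def power2_eq_square algebra_simps)
    moreover have "(1 - s)\<^sup>2 > 0" using s by simp
    ultimately show "v < 1" by linarith
  qed
  have f: "flat v = exp (- (1 / v))" using v by (simp add: flat_def)
  have a: "1 + u * flat v > 0" "1 + v * ln (1 + u * flat v) > 0" "T < 1"
    using adm by (auto simp: shiftable_def Let_def v_def T_def)
  have T: "0 < T" using v a by (simp add: T_def shift_aux_def)
  have sq: "sqrt (1 - T) > 0" "sqrt (1 - T) < 1" using T a by auto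
  have sh: "shift s u = 1 - sqrt (1 - T)" by (simp add: shift_def T_def v_def)
  show "0 < shift s u" "shift s u < 1" using sq by (auto simp: sh)
  have Tv: "shift s u * (2 - shift s u) = T"
    using a(3) by (simp add: sh algebra_simps flip: power2_eq_square)
  have iT: "1 / T = 1 / v + ln (1 + u * flat v)" using v a(2) by (simp add: T_def shift_aux_def field_simps)
  have eT: "exp (1 / T) = exp (1 / v) + u"
  proof -
    have "exp (1 / T) = exp (1 / v) * (1 + u * flat v)" unfolding iT using a(1) by (simp add: exp_add)
    also have "\<dots> = exp (1 / v) + u" by (simp add: f exp_minus field_simps)
    finally show ?thesis .
  qed
  then show "spiral (shift s u) = spiral s + u" by (simp add: spiral_def Tv v_def)
  have fT: "1 + - u * flat T = 1 / (1 + u * flat v)"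
  proof -
    have "flat T = 1 / exp (1 / T)" using T by (simp add: flat_def exp_minus inverse_eq_divide)
    moreover have "exp (1 / T) > 0" by simp
    ultimately have "1 + - u * flat T = exp (1 / v) / (exp (1 / v) + u)" unfolding eT by (simp add: field_simps)
    also have "exp (1 / v) + u = exp (1 / v) * (1 + u * flat v)" by (simp add: f exp_minus field_simps)
    finally show ?thesis by simp
  qed
  have l: "1 + T * ln (1 + - u * flat T) = T / v"
  proof -
    have "ln (1 + - u * flat T) = 1 / v - 1 / T" unfolding fT using a(1) iT by (simp add: ln_div)
    then show ?thesis using T v by (simp add: field_simps)
  qed
  then have TT: "shift_aux T (- u) = v" using T v by (simp add: shift_aux_def)
  show "shiftable (shift s u) (- u)"
    unfolding shiftable_def Let_def Tv TT l using T v fT a(1) by simp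
  have "sqrt (1 - v) = 1 - s"
  proof -
    have "1 - v = (1 - s)\<^sup>2" by (simp add: v_def power2_eq_square algebra_simps)
    then show ?thesis using s by simp
  qed
  then show "shift (shift s u) (- u) = s" unfolding shift_def[of "shift s u"] Tv TT by simp
qed

lemma shiftable_small:
  assumes s: "s < 1/4" and u: "\<bar>u\<bar> < 1"
  shows "shiftable s u"
proof (cases "s \<le> 0")
  case False
  define v where "v = s * (2 - s)"
  have v: "0 < v" "v < 1/2"
  proof -
    show "0 < v" using False s by (simp add: v_def)
    have "v = 2 * s - s * s" by (simp add: v_def algebra_simps)
    moreover have "s * s \<ge> 0" by simp
    ultimately show "v < 1/2" using s by linarith
  qed
  have f: "flat v = exp (- (1 / v))" using v by (simp add: flat_def)
  have "\<bar>u * flat v\<bar> \<le> \<bar>u\<bar> * 1"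
    unfolding abs_mult using flat_less_1[of v] flat_nonneg[of v] by (intro mult_left_mono) auto
  then have 1: "1 + u * flat v > 0" using u by linarith
  have e: "exp (1 / v) + u = exp (1 / v) * (1 + u * flat v)" by (simp add: f exp_minus field_simps)
  have "exp 1 < exp (1 / v) + u"
  proof -
    \<comment> \<open>\<open>exp (1 / v) + u > exp 2 - 1 > exp 1\<close> makes the new value of \<open>v\<close> less than 1\<close>
    have "2 \<le> 1 / v" using v by (simp add: field_simps)
    then have "exp (2::real) \<le> exp (1 / v)" by simp
    moreover have "exp (2::real) = exp 1 * exp 1" by (simp flip: exp_add)
    moreover have "exp (1::real) \<ge> 2" using exp_ge_add_one_self[of 1] by simp
    then have "exp (1::real) * exp 1 \<ge> 2 * exp 1" by (intro mult_right_mono) auto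
    ultimately show ?thesis using u \<open>exp (1::real) \<ge> 2\<close> by linarith
  qed
  then have "ln (exp 1) < ln (exp (1 / v) * (1 + u * flat v))" unfolding e by (subst ln_less_cancel_iff) (use 1 in auto)
  then have l: "1 < 1 / v + ln (1 + u * flat v)" using 1 by (simp add: ln_mult)
  then have l': "1 + v * ln (1 + u * flat v) > v" using v by (simp add: field_simps)
  then have "shift_aux v u < 1" using v by (simp add: shift_aux_def)
  then show ?thesis using 1 l' v by (simp add: shiftable_def Let_def flip: v_def)
qed (rule shift_nonpos)

text \<open>At most one of the two shifts differs from the identity, depending on the sign of \<open>s\<close>. So this
  moves points of positive height along the angle \<open>\<theta>\<^sub>1\<close> and points of negative height along
  \<open>\<theta>\<^sub>2\<close>, within their leaves, by one smooth formula.\<close>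

definition slide :: "real \<Rightarrow> real \<Rightarrow> real \<Rightarrow> real" where
  "slide s u v = shift s u - shift (- s) (- v) - s"

lemma slide:
  assumes s: "\<bar>s\<bar> < 1" and a: "shiftable s u" "shiftable (- s) (- v)"
  shows "\<bar>slide s u v\<bar> < 1" "slide (slide s u v) (- u) (- v) = s"
    "s > 0 \<Longrightarrow> slide s u v > 0 \<and> spiral (slide s u v) = spiral s + u"
    "s < 0 \<Longrightarrow> slide s u v < 0 \<and> spiral (- slide s u v) = spiral (- s) - v"
    "s = 0 \<Longrightarrow> slide s u v = 0"
proof -
  have pos: "slide s u v = shift s u" if "s > 0" for s u v
    using shift_nonpos(2)[of "- s"] that by (simp add: slide_def)
  have neg: "slide s u v = - shift (- s) (- v)" if "s < 0" for s u v
    using shift_nonpos(2)[of s] that by (simp add: slide_def)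
  have zero: "slide 0 u v = 0" for u v using shift_nonpos(2)[of 0] by (simp add: slide_def)
  note p = shift_pos[OF _ _ a(1)] and n = shift_pos[OF _ _ a(2)]
  show "s > 0 \<Longrightarrow> slide s u v > 0 \<and> spiral (slide s u v) = spiral s + u"
    using p s by (simp add: pos)
  show "s < 0 \<Longrightarrow> slide s u v < 0 \<and> spiral (- slide s u v) = spiral (- s) - v"
    using n s by (simp add: neg)
  show "s = 0 \<Longrightarrow> slide s u v = 0" by (simp add: zero)
  consider "s > 0" | "s = 0" | "s < 0" by linarith
  then show "\<bar>slide s u v\<bar> < 1" "slide (slide s u v) (- u) (- v) = s"
    using p n s by (cases; simp add: pos neg zero)+
qed

text \<open>The image of \<open>\<bar>s\<bar> < 1/8\<close> stays in \<open>\<bar>s\<bar> < 1/4\<close>, where the inverse \<open>slide s (- u) (- v)\<close> is defined for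
  all \<open>\<bar>u\<bar> < 1\<close> and \<open>\<bar>v\<bar> < 1\<close>.\<close>

lemma slide_small:
  assumes s: "\<bar>s\<bar> < 1/8" and u: "\<bar>u\<bar> < 1" "\<bar>v\<bar> < 1"
  shows "\<bar>slide s u v\<bar> < 1/4"
proof -
  have adm: "shiftable s u" "shiftable (- s) (- v)" using s u by (auto intro: shiftable_small)
  have s1: "\<bar>s\<bar> < 1" using s by linarith
  note sl = slide[OF s1 adm]
  have key: "s' < 1/4" if "0 < s" "s < 1/8" "0 < s'" "s' < 1" "spiral s' > spiral s - 1" for s s'
  proof (rule ccontr)
    assume "\<not> s' < 1/4"
    then have "s' \<ge> 1/4" by simp
    \<comment> \<open>otherwise \<open>spiral s' \<le> exp 3\<close>, while \<open>spiral s - 1 \<ge> exp 4 - 1 \<ge> exp 3\<close>\<close>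
    have "s' * (2 - s') - 7/16 = (s' - 1/4) * (7/4 - s')" by (simp add: field_simps)
    moreover have "(s' - 1/4) * (7/4 - s') \<ge> 0" using \<open>s' \<ge> 1/4\<close> that by simp
    ultimately have "s' * (2 - s') \<ge> 7/16" by linarith
    then have "1 / (s' * (2 - s')) \<le> 3" by (simp add: field_simps)
    then have 3: "spiral s' \<le> exp 3" by (simp add: spiral_def)
    have "s * (2 - s) = 2 * s - s * s" by (simp add: algebra_simps)
    moreover have "s * s \<ge> 0" by simp
    ultimately have "s * (2 - s) < 1/4" using that by linarith
    moreover have "s * (2 - s) > 0" using that by simp
    ultimately have "4 \<le> 1 / (s * (2 - s))" by (simp add: field_simps)
    then have 4: "exp 4 \<le> spiral s" by (simp add: spiral_def)
    have "exp (4::real) = exp 1 * exp 3" by (simp flip: exp_add)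
    moreover have "exp (1::real) \<ge> 2" using exp_ge_add_one_self[of 1] by simp
    then have "exp (1::real) * exp 3 \<ge> 2 * exp 3" by (intro mult_right_mono) auto
    moreover have "exp (3::real) \<ge> 1" by simp
    ultimately show False using 3 4 that(5) by linarith
  qed
  consider "s > 0" | "s = 0" | "s < 0" by linarith
  then show ?thesis
  proof cases
    case 1
    then show ?thesis using key[of s "slide s u v"] sl(1,3) s u by auto
  next
    case 3
    then show ?thesis using key[of "- s" "- slide s u v"] sl(1,4) s u by auto
  qed (use sl(5) in simp)
qed

lemma C_inf_shift:
  assumes "C_inf U f" "C_inf U g" and a: "\<And>x. x \<in> U \<Longrightarrow> shiftable (f x) (g x)"
  shows "C_inf U (\<lambda>x. shift (f x) (g x))"
proof -
  have a': "1 + g x * flat (f x * (2 - f x)) > 0"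
      "1 + f x * (2 - f x) * ln (1 + g x * flat (f x * (2 - f x))) \<noteq> 0"
      "1 - f x * (2 - f x) / (1 + f x * (2 - f x) * ln (1 + g x * flat (f x * (2 - f x)))) > 0" if "x \<in> U" for x
    using a[OF that] by (auto simp: shiftable_def Let_def shift_aux_def)
  show ?thesis unfolding shift_def shift_aux_def
    by (intro C_inf_intros assms(1,2) C_inf_open[OF assms(1)] a')
qed

lemma C_inf_slide:
  assumes "C_inf U f" "C_inf U g" "C_inf U h"
    and "\<And>x. x \<in> U \<Longrightarrow> shiftable (f x) (g x)" "\<And>x. x \<in> U \<Longrightarrow> shiftable (- f x) (- h x)"
  shows "C_inf U (\<lambda>x. slide (f x) (g x) (h x))"
  unfolding slide_def by (intro C_inf_intros C_inf_shift assms)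

text \<open>The first two coordinates are the angles and the third is, up to scale, the height at which the leaf meets
  the transversal over angles \<open>(a, b)\<close>.\<close>

definition boundary_chart :: "real \<Rightarrow> real \<Rightarrow> real^3 \<Rightarrow> complex^2" where
  "boundary_chart a b y = (let s = slide (y$3 / 8) (y$1) (y$2) in
     vector [sqrt ((1 + s) / 2) *\<^sub>R cis (a + y$1), sqrt ((1 - s) / 2) *\<^sub>R cis (b + y$2)])"

lemma boundary_chart:
  assumes y: "y \<in> cube3"
  shows "boundary_chart a b y \<in> S3" "height (boundary_chart a b y) = slide (y$3 / 8) (y$1) (y$2)"
    "\<bar>slide (y$3 / 8) (y$1) (y$2)\<bar> < 1/4" "shiftable (y$3 / 8) (y$1)" "shiftable (- (y$3 / 8)) (- y$2)"
proof -
  have y': "\<bar>y$3 / 8\<bar> < 1/8" "\<bar>y$1\<bar> < 1" "\<bar>y$2\<bar> < 1" using y by (auto simp: cube3_iff)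
  show s: "\<bar>slide (y$3 / 8) (y$1) (y$2)\<bar> < 1/4" using y' by (rule slide_small)
  show "shiftable (y$3 / 8) (y$1)" "shiftable (- (y$3 / 8)) (- y$2)" using y' by (auto intro!: shiftable_small)
  show "boundary_chart a b y \<in> S3" "height (boundary_chart a b y) = slide (y$3 / 8) (y$1) (y$2)"
    using s by (simp_all add: S3_iff height_def boundary_chart_def Let_def power_mult_distrib field_simps del: mem_sphere mem_sphere_0)
qed

lemma local_param_boundary_chart: "local_param S3 cube3 (boundary_chart a b)"
proof -
  let ?s = "\<lambda>y :: real^3. slide (y$3 / 8) (y$1) (y$2)"
  have cs: "C_inf cube3 ?s"
    by (intro C_inf_slide C_inf_intros open_cube3) (use boundary_chart(4,5) in auto)
  have pos: "(1 + ?s y) / 2 > 0" "(1 - ?s y) / 2 > 0" if "y \<in> cube3" for y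
    using boundary_chart(3)[OF that] by auto
  have C: "C_inf cube3 (boundary_chart a b)"
    unfolding boundary_chart_def Let_def by (intro C_inf_intros cs open_cube3 pos) auto
  define u v where "u z = z$1 * cis (- a)" and "v z = z$2 * cis (- b)" for z :: "complex^2"
  define N where "N = {z. Re (u z) > 0 \<and> Re (v z) > 0}"
  have N: "open N" unfolding N_def u_def v_def
    by (intro open_Collect_conj open_Collect_less continuous_intros)
  have cuv: "C_inf N u" "C_inf N v" unfolding u_def v_def by (intro C_inf_intros N)+
  have cang: "C_inf N (\<lambda>z. ang (u z))" "C_inf N (\<lambda>z. ang (v z))"
    by (intro C_inf_ang cuv; simp add: N_def)+
  have cN: "C_inf N (\<lambda>z. (height z, ang (u z), ang (v z)))"
    by (intro C_inf_intros C_inf_height cang N)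
  define O' where "O' = N \<inter> (\<lambda>z. (height z, ang (u z), ang (v z))) -` ({-1/4<..<1/4} \<times> {-1<..<1} \<times> {-1<..<1})"
  have O: "open O'" unfolding O'_def
    by (rule continuous_open_preimage[OF C_inf_continuous[OF cN] N]) (intro open_Times open_greaterThanLessThan)
  have O'D: "\<bar>height z\<bar> < 1/4" "\<bar>ang (u z)\<bar> < 1" "\<bar>ang (v z)\<bar> < 1" "Re (u z) > 0" "Re (v z) > 0" if "z \<in> O'" for z
    using that by (auto simp: O'_def N_def abs_less_iff)
  have adm: "shiftable (height z) (- ang (u z))" "shiftable (- height z) (- (- ang (v z)))" if "z \<in> O'" for z
    using O'D[OF that] by (auto intro!: shiftable_small)
  define g :: "complex^2 \<Rightarrow> real^3" where
    "g z = vector [ang (u z), ang (v z), 8 * slide (height z) (- ang (u z)) (- ang (v z))]" for z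
  have sub: "C_inf O' (\<lambda>z. ang (u z))" "C_inf O' (\<lambda>z. ang (v z))"
    using C_inf_subset[OF cang(1) O] C_inf_subset[OF cang(2) O] by (auto simp: O'_def)
  have G: "C_inf O' g" unfolding g_def
    by (intro C_inf_intros C_inf_slide C_inf_height sub O adm)
  have uv: "u (boundary_chart a b y) = sqrt ((1 + ?s y) / 2) *\<^sub>R cis (y$1)"
    "v (boundary_chart a b y) = sqrt ((1 - ?s y) / 2) *\<^sub>R cis (y$2)" for y
    by (simp_all add: u_def v_def boundary_chart_def Let_def cis_mult)
  have auv: "ang (u (boundary_chart a b y)) = y$1" "ang (v (boundary_chart a b y)) = y$2"
    "Re (u (boundary_chart a b y)) > 0" "Re (v (boundary_chart a b y)) > 0" if "y \<in> cube3" for y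
    unfolding uv using pos[OF that] that by (auto intro!: ang_cis simp: cube3_iff simp del: scaleR_complex.sel)
  show ?thesis
  proof (rule local_param_left_inverse[OF C G])
    show "boundary_chart a b ` cube3 \<subseteq> S3 \<inter> O'"
    proof
      fix z assume "z \<in> boundary_chart a b ` cube3"
      then obtain y where y: "y \<in> cube3" "z = boundary_chart a b y" by blast
      then show "z \<in> S3 \<inter> O'"
        using boundary_chart(1,2)[OF y(1), of a b] boundary_chart(3)[OF y(1), unfolded abs_less_iff] auv[OF y(1)] y(1)
        by (simp add: O'_def N_def cube3_iff abs_less_iff del: mem_sphere mem_sphere_0)
    qed
    show "g (boundary_chart a b y) = y" if "y \<in> cube3" for y
    proof -
      have "\<bar>y$3 / 8\<bar> < 1" using that by (simp add: cube3_iff)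
      from slide(2)[OF this boundary_chart(4,5)[OF that]] show ?thesis
        unfolding g_def boundary_chart(2)[OF that] auv[OF that] by (simp add: vec_eq_iff forall_3)
    qed
    show "boundary_chart a b (g z) = z" if "z \<in> S3 \<inter> O'" "g z \<in> cube3" for z
    proof -
      have z: "z \<in> S3" "z \<in> O'" using that by auto
      have "\<bar>height z\<bar> < 1" using O'D(1)[OF z(2)] by linarith
      from slide(2)[OF this adm[OF z(2)]] have s: "slide (g z $ 3 / 8) (g z $ 1) (g z $ 2) = height z"
        by (simp add: g_def)
      have "sqrt ((1 + height z) / 2) = cmod (z$1)" "sqrt ((1 - height z) / 2) = cmod (z$2)"
        by (simp_all flip: height_S3(1,2)[OF z(1)])
      moreover have "cmod (z$1) *\<^sub>R cis (a + ang (u z)) = z$1"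
      proof -
        have "cmod (z$1) *\<^sub>R cis (ang (u z)) = z$1 * cis (- a)"
          using ang_polar[OF O'D(4)[OF z(2)]] by (simp add: u_def norm_mult)
        then have "cmod (z$1) *\<^sub>R cis (ang (u z)) * cis a = z$1" by (simp add: cis_mult mult.assoc)
        then show ?thesis by (simp add: cis_mult add.commute)
      qed
      moreover have "cmod (z$2) *\<^sub>R cis (b + ang (v z)) = z$2"
      proof -
        have "cmod (z$2) *\<^sub>R cis (ang (v z)) = z$2 * cis (- b)"
          using ang_polar[OF O'D(5)[OF z(2)]] by (simp add: v_def norm_mult)
        then have "cmod (z$2) *\<^sub>R cis (ang (v z)) * cis b = z$2" by (simp add: cis_mult mult.assoc)
        then show ?thesis by (simp add: cis_mult add.commute)
      qed
      ultimately show ?thesis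
        unfolding boundary_chart_def Let_def s by (simp add: g_def vec_eq_iff forall_2)
    qed
  qed
qed

lemma label_boundary_chart:
  assumes y: "y \<in> cube3"
  shows "label (boundary_chart a b y) = (if y$3 > 0 then (cis (a - spiral (y$3 / 8)), 1)
    else if y$3 < 0 then (cis (b + spiral (- (y$3 / 8))), 2) else (0, 0))"
proof -
  let ?s = "slide (y$3 / 8) (y$1) (y$2)"
  have "\<bar>y$3 / 8\<bar> < 1" using y by (simp add: cube3_iff)
  note sl = slide[OF this boundary_chart(4,5)[OF y]]
  have pos: "sqrt ((1 + ?s) / 2) > 0" "sqrt ((1 - ?s) / 2) > 0" using boundary_chart(3)[OF y] by auto
  have sgn: "sgn (boundary_chart a b y $ 1) = cis (a + y$1)" "sgn (boundary_chart a b y $ 2) = cis (b + y$2)"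
    using pos by (simp_all add: boundary_chart_def Let_def sgn_scaleR_cis)
  consider "y$3 > 0" | "y$3 = 0" | "y$3 < 0" by linarith
  then show ?thesis
    using sl(3-5) by cases (simp_all add: label_def boundary_chart(2)[OF y] sgn cis_mult add.commute)
qed

lemma S3_foliated_chart:
  assumes p: "p \<in> S3"
  shows "\<exists>\<psi>. local_param S3 cube3 \<psi> \<and> p \<in> \<psi> ` cube3 \<and>
    (\<forall>y\<in>cube3. \<forall>y'\<in>cube3. y$3 = y'$3 \<longrightarrow> label (\<psi> y) = label (\<psi> y'))"
proof -
  have 0: "0 \<in> cube3" by (simp add: cube3_iff)
  consider "height p > 0" | "height p = 0" | "height p < 0" by linarith
  then show ?thesis
  proof cases
    case 1
    obtain w0 b where w: "cmod w0 < 1" "plane_chart profile w0 b 0 = p"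
      using plane_chart_through[OF p 1 C_inf_profile] .
    note c = local_param_plane_chart[OF C_inf_profile w(1), where b = b]
    have "label (plane_chart profile w0 b y) = (cis (b + y$3), 1)" if "y \<in> cube3" for y
      using c(2)[OF that] leaf_1[of "b + y$3"] by (auto simp: leaf_def)
    then show ?thesis using c(1) w(2) 0 by (intro exI[of _ "plane_chart profile w0 b"]) auto
  next
    case 2
    have "p \<in> torus_map ` (sphere 0 1 \<times> sphere 0 1)" using p 2 torus_map_boundary by blast
    then obtain x y where xy: "cmod x = 1" "cmod y = 1" "p = torus_map (x, y)" by (auto simp: dist_norm)
    obtain a b where ab: "x = cis a" "y = cis b" using unit_cis xy by metis
    have "slide 0 0 0 = 0" using shift_nonpos(2)[of 0] by (simp add: slide_def)
    then have "boundary_chart a b 0 = p"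
      by (simp add: boundary_chart_def Let_def xy(3) ab torus_map_def real_sqrt_divide)
    then show ?thesis using local_param_boundary_chart[of a b] 0 label_boundary_chart[of _ a b]
      by (intro exI[of _ "boundary_chart a b"]) auto
  next
    case 3
    then have "S3_swap p \<in> S3" "height (S3_swap p) > 0" using p by (simp_all add: S3_swap_S3 height_swap del: mem_sphere mem_sphere_0)
    from plane_chart_through[OF this C_inf_minus[OF C_inf_profile]]
    obtain w0 b where w: "cmod w0 < 1" "plane_chart (\<lambda>x. - profile x) w0 b 0 = S3_swap p" .
    let ?c = "plane_chart (\<lambda>x. - profile x) w0 b"
    note c = local_param_plane_chart[OF C_inf_minus[OF C_inf_profile] w(1), where b = b]
    have "label (S3_swap (?c y)) = (cis (b + y$3), 2)" if "y \<in> cube3" for y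
    proof -
      have "S3_swap (?c y) \<in> leaf (cis (b + y$3), 2)" unfolding leaf_2 using c(2)[OF that] by blast
      then show ?thesis by (simp add: leaf_def)
    qed
    moreover have "local_param S3 cube3 (\<lambda>y. S3_swap (?c y))"
      using local_param_embed[OF c(1) smooth_embedding_swap] by (simp add: swap_image_S3)
    moreover have "S3_swap (?c 0) = p" by (simp add: w(2))
    ultimately show ?thesis using 0 by (intro exI[of _ "\<lambda>y. S3_swap (?c y)"]) auto
  qed
qed

section \<open>The Reeb foliation\<close>

definition fam_leaves :: "(complex^3) set set" where
  "fam_leaves = (`) (fam 1) ` S3_leaves"

lemma codim1_foliation_fam: "codim1_foliation (fam_M 1) fam_leaves"
  unfolding codim1_foliation_def
proof (intro conjI ballI)
  have inj: "inj_on (fam 1) S3" by (rule inj_on_fam) simp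
  have ne: "{} \<notin> (`) (fam 1) ` S3_leaves"
    using partition_S3_leaves by (auto simp: partition_on_def)
  show "partition_on (fam_M 1) fam_leaves"
    using partition_on_inj_image[OF partition_S3_leaves inj] ne by (simp add: fam_M_def fam_leaves_def)
  show "\<exists>S j. connected S \<and> immersed_surface S j \<and> j ` S = L" if "L \<in> fam_leaves" for L
    using that leaf_immersed_legendrian(1) by (auto simp: fam_leaves_def)
  fix p assume "p \<in> fam_M 1"
  then obtain q where q: "q \<in> S3" "p = fam 1 q" by (auto simp: fam_M_def)
  obtain \<psi> where \<psi>: "local_param S3 cube3 \<psi>" "q \<in> \<psi> ` cube3"
    and lab: "\<And>y y'. y \<in> cube3 \<Longrightarrow> y' \<in> cube3 \<Longrightarrow> y$3 = y'$3 \<Longrightarrow> label (\<psi> y) = label (\<psi> y')"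
    using S3_foliated_chart[OF q(1)] by blast
  have sub: "\<psi> ` cube3 \<subseteq> S3" using \<psi>(1) openin_imp_subset[of euclidean S3] by (simp add: local_param_def)
  have "local_param (fam_M 1) cube3 (\<lambda>y. fam 1 (\<psi> y))"
    unfolding fam_M_def by (rule local_param_embed[OF \<psi>(1) smooth_embedding_fam]) simp
  moreover have "p \<in> (\<lambda>y. fam 1 (\<psi> y)) ` cube3" using \<psi>(2) q(2) by auto
  moreover have "fam 1 (\<psi> y') \<in> L"
    if L: "L \<in> fam_leaves" and y: "y \<in> cube3" "y' \<in> cube3" and yL: "fam 1 (\<psi> y) \<in> L" "y$3 = y'$3" for L y y'
  proof -
    obtain l where l: "L = fam 1 ` leaf l" using L by (auto simp: fam_leaves_def S3_leaves_def)
    have S: "\<psi> y \<in> S3" "\<psi> y' \<in> S3" using sub y by auto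
    have "leaf l \<subseteq> S3" by (auto simp: leaf_def)
    then have "\<psi> y \<in> leaf l" using yL(1) l inj_on_image_mem_iff[OF inj S(1)] by simp
    then have "\<psi> y' \<in> leaf l" using lab[OF y yL(2)] S(2) by (simp add: leaf_def)
    then show ?thesis using l by blast
  qed
  ultimately show "\<exists>\<psi>. local_param (fam_M 1) cube3 \<psi> \<and> p \<in> \<psi> ` cube3 \<and>
        (\<forall>L\<in>fam_leaves. \<forall>y\<in>cube3. \<forall>y'\<in>cube3. \<psi> y \<in> L \<and> y$3 = y'$3 \<longrightarrow> \<psi> y' \<in> L)"
    by (intro exI[of _ "\<lambda>y. fam 1 (\<psi> y)"]) blast
qed

lemma reeb_foliation_fam: "reeb_foliation (fam_M 1) fam_leaves"
proof -
  define \<Phi>1 \<Phi>2 where "\<Phi>1 x = fam 1 (torus_map x)" and "\<Phi>2 x = fam 1 (S3_swap (torus_map x))" for x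
  have inj: "inj_on (fam 1) S3" by (rule inj_on_fam) simp
  have sub: "torus_map ` solid_torus \<subseteq> S3" using torus_map_solid_torus by blast
  have emb: "smooth_embedding solid_torus_tangent solid_torus torus_map"
    by (rule smooth_embedding_torus_map[OF solid_torus_dom])
  have 1: "smooth_embedding solid_torus_tangent solid_torus \<Phi>1"
    unfolding \<Phi>1_def by (rule smooth_embedding_compose[OF emb smooth_embedding_fam sub torus_map_tangent]) auto
  have swap: "smooth_embedding solid_torus_tangent solid_torus (\<lambda>x. S3_swap (torus_map x))"
    by (rule smooth_embedding_compose[OF emb smooth_embedding_swap[of "\<lambda>_. UNIV" UNIV]]) auto
  have smooth: "smooth_on solid_torus torus_map" "smooth_on UNIV S3_swap"
    using C_inf_torus_map solid_torus_dom C_inf_swap by (auto intro: smooth_onI)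
  have 2: "smooth_embedding solid_torus_tangent solid_torus \<Phi>2"
    unfolding \<Phi>2_def
  proof (rule smooth_embedding_compose[OF swap smooth_embedding_fam])
    show "(\<lambda>x. S3_swap (torus_map x)) ` solid_torus \<subseteq> S3" using sub by (auto simp: S3_swap_S3 simp del: mem_sphere mem_sphere_0)
    fix x v assume x: "x \<in> solid_torus" and v: "v \<in> solid_torus_tangent x"
    show "frechet_derivative (\<lambda>x. S3_swap (torus_map x)) (at x) v \<in> tangent_space S3 (S3_swap (torus_map x))"
      using swap_tangent[OF torus_map_tangent[OF x v]] swap_image_S3
      by (simp add: frechet_derivative_compose_smooth[OF smooth(2,1) x UNIV_I])
  qed simp
  let ?P = "{z \<in> S3. height z \<ge> 0}" and ?N = "{z \<in> S3. height z \<le> 0}"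
  have swapN: "S3_swap ` ?P = ?N"
    using swap_image_Collect[of "\<lambda>z. z \<in> S3 \<and> height z \<ge> 0"]
    by (simp add: S3_swap_S3 height_swap del: mem_sphere mem_sphere_0)
  have im1: "\<Phi>1 ` solid_torus = fam 1 ` ?P"
    unfolding \<Phi>1_def torus_map_solid_torus[symmetric] by (simp only: image_image)
  have "\<Phi>2 ` solid_torus = fam 1 ` S3_swap ` torus_map ` solid_torus"
    by (simp add: \<Phi>2_def image_image)
  then have im2: "\<Phi>2 ` solid_torus = fam 1 ` ?N"
    unfolding torus_map_solid_torus swapN .
  have union: "\<Phi>1 ` solid_torus \<union> \<Phi>2 ` solid_torus = fam_M 1"
    unfolding im1 im2 fam_M_def image_Un[symmetric] by (rule arg_cong[of _ _ "(`) (fam 1)"]) auto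
  have inter: "\<Phi>1 ` solid_torus \<inter> \<Phi>2 ` solid_torus = \<Phi>1 ` (sphere 0 1 \<times> sphere 0 1)"
  proof -
    have "fam 1 ` ?P \<inter> fam 1 ` ?N = fam 1 ` (?P \<inter> ?N)"
      by (rule inj_on_image_Int[OF inj, symmetric]) auto
    also have "?P \<inter> ?N = torus_map ` (sphere 0 1 \<times> sphere 0 1)" unfolding torus_map_boundary by auto
    finally show ?thesis unfolding im1 im2 \<Phi>1_def by (simp add: image_image)
  qed
  have glue: "\<Phi>1 (a, b) = \<Phi>2 (b, a)" if "a \<in> sphere 0 1" "b \<in> sphere 0 1" for a b
  proof -
    have "torus_map (a, b) = S3_swap (torus_map (b, a))"
      using that by (simp add: torus_map_def S3_swap_def real_sqrt_divide)
    then show ?thesis by (simp add: \<Phi>1_def \<Phi>2_def)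
  qed
  have "fam_leaves = (`) \<Phi>1 ` reeb_component profile \<union> (`) \<Phi>2 ` reeb_component (\<lambda>\<rho>. - profile \<rho>)"
    unfolding fam_leaves_def S3_leaves_reeb image_Un image_image \<Phi>1_def \<Phi>2_def ..
  with 1 2 union inter glue reeb_profile_profile
  have "smooth_embedding solid_torus_tangent solid_torus \<Phi>1 \<and>
        smooth_embedding solid_torus_tangent solid_torus \<Phi>2 \<and>
        \<Phi>1 ` solid_torus \<union> \<Phi>2 ` solid_torus = fam_M 1 \<and>
        \<Phi>1 ` solid_torus \<inter> \<Phi>2 ` solid_torus = \<Phi>1 ` (sphere 0 1 \<times> sphere 0 1) \<and>
        (\<forall>a\<in>sphere 0 1. \<forall>b\<in>sphere 0 1. \<Phi>1 (a, b) = \<Phi>2 (b, a)) \<and>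
        reeb_profile profile \<and> reeb_profile (\<lambda>\<rho>. - profile \<rho>) \<and>
        fam_leaves = (`) \<Phi>1 ` reeb_component profile \<union> (`) \<Phi>2 ` reeb_component (\<lambda>\<rho>. - profile \<rho>)"
    by (intro conjI ballI)
  note all = this
  show ?thesis
    unfolding reeb_foliation_def
    by (rule conjI[OF codim1_foliation_fam], rule exI[of _ \<Phi>1], rule exI[of _ \<Phi>2], rule exI[of _ profile],
        rule exI[of _ "\<lambda>\<rho>. - profile \<rho>"], rule all)
qed

theorem theorem1p1:
  shows "\<exists>(M :: real \<Rightarrow> (complex^3) set) (Or :: real \<Rightarrow> (complex^3) orientation).
    smooth_S3_family {0..<3/2} M Or \<and>
    (M 0 = {z \<in> S5. z$3 = 0} \<and>
      (\<forall>x\<in>S3. Or 0 (incl x) = push_frames incl (S3_orientation x))) \<and>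
    (\<forall>t\<in>{0..<1}. contact_submanifold (M t) (Or t)) \<and>
    (\<exists>\<L>. reeb_foliation (M 1) \<L> \<and> (\<forall>L\<in>\<L>. legendrian_submanifold L)) \<and>
    (\<forall>t\<in>{1<..<3/2}. contact_submanifold (M t) (reverse_orientation (Or t)) \<and>
      overtwisted (M t))"
proof (intro exI[of _ fam_M] exI[of _ fam_Or] conjI ballI)
  show "smooth_S3_family {0..<3/2} fam_M fam_Or" by (rule smooth_S3_family_fam)
  show "fam_M 0 = {z \<in> S5. z$3 = 0}" by (rule fam_M_0)
  show "fam_Or 0 (incl x) = push_frames incl (S3_orientation x)" if "x \<in> S3" for x
    using that by (rule fam_Or_0)
  show "contact_submanifold (fam_M t) (fam_Or t)" if "t \<in> {0..<1}" for t
    using that by (intro contact_fam_less_1) auto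
  have "\<forall>L\<in>fam_leaves. legendrian_submanifold L"
    using leaf_immersed_legendrian(2) by (auto simp: fam_leaves_def)
  then show "\<exists>\<L>. reeb_foliation (fam_M 1) \<L> \<and> (\<forall>L\<in>\<L>. legendrian_submanifold L)"
    using reeb_foliation_fam by blast
  show "contact_submanifold (fam_M t) (reverse_orientation (fam_Or t))" if "t \<in> {1<..<3/2}" for t
    using that by (intro contact_fam_greater_1) auto
  show "overtwisted (fam_M t)" if "t \<in> {1<..<3/2}" for t
    using that by (intro overtwisted_fam) auto
qed

end
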